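(* Let $k$ be a field, $S=k[x_1,\dots,x_n]$, $\mathfrak m=(x_1,\dots,x_n)$, and $I=(f_1,\dots,f_r)$ a linearly presented $\mathfrak m$-primary ideal generated in degree $d$. Let $B=k[T_1,\dots,T_r]$, $W\subseteq\mathbb P^{r-1}$ the image of the map $\mathbb P^{n-1}\to\mathbb P^{r-1}$ defined by $f_1,\dots,f_r$, $I(W)\subseteq B$ its homogeneous ideal, $\Theta$ the Jacobian dual matrix of a presentation matrix of $I$, and $I_n(\Theta)$ its ideal of $n\times n$ minors. Then: (1) If $I_n(\Theta)$ has a linear resolution, then $I^{n-1}=\mathfrak m^{d(n-1)}$ (equivalently $\mathrm{reg}(I^{n-1})=(n-1)d$). (2) If $I_n(\Theta)=I(W)_{\ge n}$, then $I_n(\Theta)$ has a linear resolution if and only if $I^{n-1}=\mathfrak m^{d(n-1)}$.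
   Context: "Linearly presented" means the syzygy module of the forms $f_1,\dots,f_r$ (all of degree $d$) is generated by linear syzygies $\sum_i a_i(\mathbf x)f_i=0$. The defining ideal $J$ of $\mathrm{Sym}(I)$ is generated by the bilinear forms $\sum_i a_i(\mathbf x)T_i$; with $L_1,\dots,L_N$ minimal generators of $J$, $\Theta$ is the $N\times n$ matrix of linear forms in the $T_i$ with $\Theta(x_1,\dots,x_n)^T=(L_1,\dots,L_N)^T$, so $I_n(\Theta)$ is generated in degree $n$. $I(W)$ is the kernel of $B\to S$, $T_i\mapsto f_i$, and $I(W)_{\ge n}$ is the ideal of its elements of degree $\ge n$. "Linear resolution" means its minimal graded free resolution is linear, i.e. $\mathrm{reg}\,I_n(\Theta)=n$. *)

theory Defs
  imports "HOL-Library.Poly_Mapping" "HOL-Combinatorics.Permutations"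
begin

text \<open>Polynomials over a field 'a in countably many variables X_0, X_1, ...;
  a monomial is an exponent vector nat =>0 nat.  The ring k[X_0..X_(m-1)] is the set of
  polynomials all of whose monomials only involve variables with index < m.
  S = k[x_1..x_n] is modelled with m = n (x_(i+1) = X_i), B = k[T_1..T_r] with m = r.\<close>

type_synonym 'a mpoly = "(nat \<Rightarrow>\<^sub>0 nat) \<Rightarrow>\<^sub>0 'a"

definition Var :: "nat \<Rightarrow> 'a::comm_ring_1 mpoly" where
  "Var i = Poly_Mapping.single (Poly_Mapping.single i 1) 1"

definition Const :: "'a::comm_ring_1 \<Rightarrow> 'a mpoly" where
  "Const c = Poly_Mapping.single 0 c"

definition in_ring :: "nat \<Rightarrow> 'a::comm_ring_1 mpoly \<Rightarrow> bool" where
  "in_ring m p \<longleftrightarrow> (\<forall>mon\<in>Poly_Mapping.keys p. \<forall>i\<in>Poly_Mapping.keys mon. i < m)"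

definition tdeg :: "(nat \<Rightarrow>\<^sub>0 nat) \<Rightarrow> nat" where
  "tdeg mon = (\<Sum>i\<in>Poly_Mapping.keys mon. Poly_Mapping.lookup mon i)"

text \<open>homogeneous of degree d (the zero polynomial is homogeneous of every degree)\<close>
definition homog :: "nat \<Rightarrow> 'a::comm_ring_1 mpoly \<Rightarrow> bool" where
  "homog d p \<longleftrightarrow> (\<forall>mon\<in>Poly_Mapping.keys p. tdeg mon = d)"

definition gen_ideal :: "nat \<Rightarrow> 'a::comm_ring_1 mpoly set \<Rightarrow> 'a mpoly set" where
  "gen_ideal m G = {p. \<exists>F c. finite F \<and> F \<subseteq> G \<and> (\<forall>g\<in>F. in_ring m (c g))
                         \<and> p = (\<Sum>g\<in>F. c g * g)}"

definition ideal_prod :: "nat \<Rightarrow> 'a::comm_ring_1 mpoly set \<Rightarrow> 'a mpoly set \<Rightarrow> 'a mpoly set" where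
  "ideal_prod m I J = gen_ideal m {a * b | a b. a \<in> I \<and> b \<in> J}"

fun ideal_pow :: "nat \<Rightarrow> 'a::comm_ring_1 mpoly set \<Rightarrow> nat \<Rightarrow> 'a mpoly set" where
  "ideal_pow m I 0 = gen_ideal m {1}"
| "ideal_pow m I (Suc t) = ideal_prod m (ideal_pow m I t) I"

definition max_ideal :: "nat \<Rightarrow> 'a::comm_ring_1 mpoly set" where
  "max_ideal m = gen_ideal m (Var ` {..<m})"

definition radical :: "nat \<Rightarrow> 'a::comm_ring_1 mpoly set \<Rightarrow> 'a mpoly set" where
  "radical m I = {p. in_ring m p \<and> (\<exists>t. p ^ t \<in> I)}"

definition primary_for :: "nat \<Rightarrow> 'a::comm_ring_1 mpoly set \<Rightarrow> 'a mpoly set \<Rightarrow> bool" where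
  "primary_for m Q I \<longleftrightarrow> 1 \<notin> I \<and> radical m I = Q \<and>
     (\<forall>a b. in_ring m a \<longrightarrow> in_ring m b \<longrightarrow> a * b \<in> I \<longrightarrow> a \<notin> I \<longrightarrow> b \<in> radical m I)"

definition syz :: "nat \<Rightarrow> nat \<Rightarrow> (nat \<Rightarrow> 'a::comm_ring_1 mpoly) \<Rightarrow> (nat \<Rightarrow> 'a mpoly) set" where
  "syz n r f = {a. (\<forall>i<r. in_ring n (a i)) \<and> (\<forall>i\<ge>r. a i = 0) \<and> (\<Sum>i<r. a i * f i) = 0}"

definition lin_syz :: "nat \<Rightarrow> nat \<Rightarrow> (nat \<Rightarrow> 'a::comm_ring_1 mpoly) \<Rightarrow> (nat \<Rightarrow> 'a mpoly) set" where
  "lin_syz n r f = {a \<in> syz n r f. \<forall>i<r. homog 1 (a i)}"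

definition linearly_presented :: "nat \<Rightarrow> nat \<Rightarrow> (nat \<Rightarrow> 'a::comm_ring_1 mpoly) \<Rightarrow> bool" where
  "linearly_presented n r f \<longleftrightarrow>
     (\<forall>s\<in>syz n r f. \<exists>F c. finite F \<and> F \<subseteq> lin_syz n r f \<and> (\<forall>a\<in>F. in_ring n (c a))
        \<and> s = (\<lambda>i. \<Sum>a\<in>F. c a * a i))"

text \<open>a_0..a_(N-1) is a k-basis of the space of linear syzygies; the associated bilinear
  forms L_j = sum_i a_j i * T_i are then a minimal generating set of the defining ideal J
  of Sym(I) (when I is linearly presented)\<close>
definition lin_syz_basis :: "nat \<Rightarrow> nat \<Rightarrow> (nat \<Rightarrow> 'a::field mpoly) \<Rightarrow> nat \<Rightarrow> (nat \<Rightarrow> nat \<Rightarrow> 'a mpoly) \<Rightarrow> bool" where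
  "lin_syz_basis n r f N a \<longleftrightarrow>
     (\<forall>j<N. a j \<in> lin_syz n r f)
   \<and> (\<forall>c::nat \<Rightarrow> 'a. (\<forall>i. (\<Sum>j<N. Const (c j) * a j i) = 0) \<longrightarrow> (\<forall>j<N. c j = 0))
   \<and> (\<forall>s\<in>lin_syz n r f. \<exists>c::nat \<Rightarrow> 'a. s = (\<lambda>i. \<Sum>j<N. Const (c j) * a j i))"

text \<open>Jacobian dual matrix (N x n, entries linear forms in T_0..T_(r-1)):
  L_j = sum_l Theta j l * x_l, i.e. Theta j l = sum_i (coefficient of x_l in a j i) * T_i\<close>
definition jac_dual :: "nat \<Rightarrow> (nat \<Rightarrow> nat \<Rightarrow> 'a::comm_ring_1 mpoly) \<Rightarrow> nat \<Rightarrow> nat \<Rightarrow> 'a mpoly" where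
  "jac_dual r a j l = (\<Sum>i<r. Const (Poly_Mapping.lookup (a j i) (Poly_Mapping.single l 1)) * Var i)"

definition det_n :: "nat \<Rightarrow> (nat \<Rightarrow> nat \<Rightarrow> 'a::comm_ring_1) \<Rightarrow> 'a" where
  "det_n n M = (\<Sum>p | p permutes {..<n}. of_int (sign p) * (\<Prod>i<n. M i (p i)))"

definition minors_ideal :: "nat \<Rightarrow> nat \<Rightarrow> nat \<Rightarrow> (nat \<Rightarrow> nat \<Rightarrow> 'a::comm_ring_1 mpoly) \<Rightarrow> 'a mpoly set" where
  "minors_ideal r N n Th = gen_ideal r
     {det_n n (\<lambda>i l. Th (\<rho> i) l) | \<rho>. inj_on \<rho> {..<n} \<and> \<rho> ` {..<n} \<subseteq> {..<N}}"

definition subst :: "(nat \<Rightarrow> 'a::comm_ring_1 mpoly) \<Rightarrow> 'a mpoly \<Rightarrow> 'a mpoly" where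
  "subst f p = (\<Sum>mon\<in>Poly_Mapping.keys p. Const (Poly_Mapping.lookup p mon) * (\<Prod>i\<in>Poly_Mapping.keys mon. f i ^ Poly_Mapping.lookup mon i))"

definition IW :: "nat \<Rightarrow> (nat \<Rightarrow> 'a::comm_ring_1 mpoly) \<Rightarrow> 'a mpoly set" where
  "IW r f = {p. in_ring r p \<and> subst f p = 0}"

definition ideal_ge :: "nat \<Rightarrow> nat \<Rightarrow> 'a::comm_ring_1 mpoly set \<Rightarrow> 'a mpoly set" where
  "ideal_ge m D I = gen_ideal m {p \<in> I. \<exists>e\<ge>D. homog e p}"

definition vecs :: "nat \<Rightarrow> nat \<Rightarrow> (nat \<Rightarrow> 'a::comm_ring_1 mpoly) set" where
  "vecs m b = {v. (\<forall>j<b. in_ring m (v j)) \<and> (\<forall>j\<ge>b. v j = 0)}"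

definition mat_app :: "(nat \<Rightarrow> nat \<Rightarrow> 'a::comm_ring_1 mpoly) \<Rightarrow> nat \<Rightarrow> nat \<Rightarrow> (nat \<Rightarrow> 'a mpoly) \<Rightarrow> nat \<Rightarrow> 'a mpoly" where
  "mat_app M b' b v = (\<lambda>j. if j < b then (\<Sum>k<b'. M j k * v k) else 0)"

text \<open>J (an ideal of k[X_0..X_(m-1)]) has a linear resolution with generators in degree D:
  there is a graded free resolution
    ... -> B^(b 2) --M 2--> B^(b 1) --M 1--> B^(b 0) --g--> J -> 0
  with J minimally generated in degree D by g 0..g (b 0 - 1) and all differentials M t
  (t >= 1) given by matrices of linear forms.  (A resolution with linear differentials is
  minimal, so this says that the minimal graded free resolution of J is linear.)\<close>
definition linear_resolution :: "nat \<Rightarrow> nat \<Rightarrow> 'a::comm_ring_1 mpoly set \<Rightarrow> bool" where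
  "linear_resolution m D J \<longleftrightarrow>
    (\<exists>(b::nat \<Rightarrow> nat) (g::nat \<Rightarrow> 'a mpoly) (M::nat \<Rightarrow> nat \<Rightarrow> nat \<Rightarrow> 'a mpoly).
        (\<forall>j<b 0. in_ring m (g j) \<and> homog D (g j))
      \<and> J = gen_ideal m (g ` {..<b 0})
      \<and> (\<forall>t\<ge>1. \<forall>j<b (t - 1). \<forall>k<b t. in_ring m (M t j k) \<and> homog 1 (M t j k))
      \<and> {v \<in> vecs m (b 0). (\<Sum>j<b 0. v j * g j) = 0} = mat_app (M 1) (b 1) (b 0) ` vecs m (b 1)
      \<and> (\<forall>t\<ge>1. {v \<in> vecs m (b t). mat_app (M t) (b t) (b (t - 1)) v = (\<lambda>_. 0)}
                 = mat_app (M (t + 1)) (b (t + 1)) (b t) ` vecs m (b (t + 1))))"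

end

theory Submission
  imports Defs "Jordan_Normal_Form.Determinant" "HOL-Library.Function_Algebras"
begin

text \<open>
  Write \<open>S\<close> and \<open>B\<close> for the two polynomial rings, \<open>J = I\<^sub>n(\<Theta>)\<close>, and \<open>A\<close> for the subalgebra
  generated by the \<open>f i\<close>. A graded \<open>B\<close>-module generated in degree \<open>\<delta>\<close> has a linear resolution iff its
  Koszul homology \<open>H\<^sub>i\<close> with respect to the variables \<open>T\<^sub>l\<close> vanishes in all internal degrees above
  \<open>\<delta> + i\<close>. Since \<open>I\<close> contains powers of all variables, \<open>H\<^sub>i(f; S)\<close> vanishes in degrees above
  \<open>d (i + n) - n\<close>. If \<open>I\<^sup>n\<^sup>-\<^sup>1\<close> is a power of the maximal ideal, so that \<open>B\<^sub>t\<close> maps onto \<open>S\<^sub>d\<^sub>t\<close> for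
  \<open>t \<ge> n - 1\<close>, this vanishing transfers to the truncation of \<open>I(W)\<close> at \<open>n\<close>.

  Conversely, let \<open>J\<close> have a linear resolution. The \<open>(n - 1)\<close>-minors of \<open>\<Theta>\<close> generate an ideal primary
  to the irrelevant ideal of \<open>B\<close>: otherwise \<open>\<Theta> y = 0\<close> would hold along a line on which all \<open>f i\<close>
  are proportional, because linear syzygies generate the Koszul syzygies. Substituting the vectors of
  maximal minors for \<open>x\<close> shows that \<open>I(W) / J\<close> and the cokernel of \<open>A\<close> in the Veronese subring \<open>S\<^sup>(\<^sup>d\<^sup>)\<close> are torsion with respect to the
  \<open>T\<^sub>l\<close>. A nonzero socle element of one of them in degree at least \<open>n\<close>, respectively \<open>n - 1\<close>, would
  give a nonzero class in \<open>H\<^sub>r\<^sub>-\<^sub>1(T; J)\<close>, respectively \<open>H\<^sub>r\<^sub>-\<^sub>2(T; J)\<close>, in a degree where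
  it vanishes. Hence \<open>S\<^sub>d\<^sub>(\<^sub>n\<^sub>-\<^sub>1\<^sub>) \<subseteq> A\<close>.
\<close>

section \<open>Polynomials, homogeneous components and evaluation\<close>

text \<open>Both socle arguments are connecting homomorphisms made explicit. A socle element q gives
  the chain q e_0 ... e_(r-1), whose boundary has coefficients in the smaller module; injectivity of
  the top differential over a domain then forces q itself into that module. The thresholds are a
  degree count: a socle element of degree e sits in internal degree e + r of H_r. It moves to
  H_(r-1)(T; J), which vanishes above n + r - 1, so e >= n is enough. For the cokernel of A it moves
  twice, through H_(r-1)(T; A) to H_(r-2)(T; J), as I(W) and J agree in degrees at least n; this
  vanishes above n + r - 2, so degree n - 1 is enough, which is the source of the exponent n - 1.
  Conversely, coefficients of degree d e with e >= n lie in internal degree d (i + e), above the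
  bound d (i + n) - n. Torsion holds because the maximal minors of \<Theta> invert the map given by
  the forms: \<Theta>(f) x = 0 makes the minors at f proportional to x, and modulo J the values of f
  at the minors are proportional to T. Each proportionality is used as a polynomial identity or
  congruence, without localising.\<close>

abbreviation lkp where "lkp \<equiv> Poly_Mapping.lookup"
abbreviation kys where "kys \<equiv> Poly_Mapping.keys"

lemma sum_monomials: "(\<Sum>m\<in>kys p. Poly_Mapping.single m (lkp p m)) = p"
  by (rule poly_mapping_eqI)
    (auto simp: lookup_sum lookup_single when_def sum.delta' in_keys_iff)

lemma tdeg_superset:
  "finite X \<Longrightarrow> kys m \<subseteq> X \<Longrightarrow> tdeg m = (\<Sum>i\<in>X. lkp m i)"
  unfolding tdeg_def by (rule sum.mono_neutral_left) (auto simp: in_keys_iff)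

lemma keys_add_nat: "kys (m + m') = kys m \<union> kys (m' :: nat \<Rightarrow>\<^sub>0 nat)"
  by (auto simp: in_keys_iff lookup_add)

lemma tdeg_add: "tdeg (m + m') = tdeg m + tdeg m'"
proof -
  let ?X = "kys m \<union> kys m'"
  have "tdeg (m + m') = (\<Sum>i\<in>?X. lkp (m + m') i)" by (simp add: tdeg_def keys_add_nat)
  also have "\<dots> = (\<Sum>i\<in>?X. lkp m i) + (\<Sum>i\<in>?X. lkp m' i)"
    by (simp add: lookup_add sum.distrib)
  also have "\<dots> = tdeg m + tdeg m'" by (subst (1 2) tdeg_superset[of ?X]) auto
  finally show ?thesis .
qed

lemma tdeg_zero [simp]: "tdeg 0 = 0" by (simp add: tdeg_def)
lemma tdeg_single [simp]: "tdeg (Poly_Mapping.single i k) = k" by (simp add: tdeg_def)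

lemma tdeg_eq_0_iff: "tdeg m = 0 \<longleftrightarrow> m = 0"
  by (auto simp: tdeg_def in_keys_iff intro: poly_mapping_eqI)

lemma Const_0 [simp]: "Const 0 = 0" by (simp add: Const_def)
lemma Const_1 [simp]: "Const 1 = 1" by (simp add: Const_def)
lemma Const_add: "Const (a + b) = Const a + Const b" by (simp add: Const_def single_add)
lemma Const_mult: "Const (a * b) = Const a * Const b" by (simp add: Const_def mult_single)
lemma lookup_Const_mult: "lkp (Const c * p) m = c * lkp p m"
  by (simp add: Const_def mult_map_scale_conv_mult[symmetric] Poly_Mapping.map.rep_eq when_def)

lemma in_ring_0 [simp]: "in_ring m 0" by (simp add: in_ring_def)
lemma in_ring_Const [simp]: "in_ring m (Const c)" by (simp add: in_ring_def Const_def)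
lemma in_ring_1 [simp]: "in_ring m 1" using in_ring_Const[of m 1] by simp
lemma in_ring_Var [simp]: "i < m \<Longrightarrow> in_ring m (Var i)" by (auto simp: in_ring_def Var_def split: if_splits)
lemma in_ring_add [simp]: "in_ring m p \<Longrightarrow> in_ring m q \<Longrightarrow> in_ring m (p + q)"
  using keys_add[of p q] unfolding in_ring_def by blast
lemma in_ring_uminus [simp]: "in_ring m (- p) = in_ring m p"
  by (simp add: in_ring_def in_keys_iff)
lemma in_ring_diff [simp]: "in_ring m p \<Longrightarrow> in_ring m q \<Longrightarrow> in_ring m (p - q)"
  using in_ring_add[of m p "- q"] by simp
lemma in_ring_mult [simp]:
  assumes "in_ring m p" "in_ring m q" shows "in_ring m (p * q)"
  unfolding in_ring_def
proof (intro ballI)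
  fix mon i assume "mon \<in> kys (p * q)" "i \<in> kys mon"
  then obtain a b where "mon = a + b" "a \<in> kys p" "b \<in> kys q" using keys_mult[of p q] by blast
  with \<open>i \<in> kys mon\<close> assms show "i < m" by (auto simp: keys_add_nat in_ring_def)
qed
lemma in_ring_power [simp]: "in_ring m p \<Longrightarrow> in_ring m (p ^ k)" by (induction k) auto
lemma in_ring_sum [simp]: "(\<And>x. x \<in> X \<Longrightarrow> in_ring m (g x)) \<Longrightarrow> in_ring m (sum g X)"
  by (induction X rule: infinite_finite_induct) auto
lemma in_ring_prod [simp]: "(\<And>x. x \<in> X \<Longrightarrow> in_ring m (g x)) \<Longrightarrow> in_ring m (prod g X)"
  by (induction X rule: infinite_finite_induct) auto
lemma in_ring_of_int [simp]: "in_ring m (of_int k)"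
  using in_ring_Const[of m "of_int k"] by (simp add: Const_def)

lemma homog_0 [simp]: "homog e 0" by (simp add: homog_def)
lemma homog_Const [simp]: "homog 0 (Const c)" by (simp add: homog_def Const_def)
lemma homog_1 [simp]: "homog 0 1" using homog_Const[of 1] by simp
lemma homog_Var [simp]: "homog (Suc 0) (Var i)" by (simp add: homog_def Var_def)
lemma homog_add [simp]: "homog e p \<Longrightarrow> homog e q \<Longrightarrow> homog e (p + q)"
  using keys_add[of p q] unfolding homog_def by blast
lemma homog_uminus [simp]: "homog e (- p) = homog e p" by (simp add: homog_def in_keys_iff)
lemma homog_diff [simp]: "homog e p \<Longrightarrow> homog e q \<Longrightarrow> homog e (p - q)"
  using homog_add[of e p "- q"] by simp
lemma homog_mult:
  assumes "homog a p" "homog b q" shows "homog (a + b) (p * q)"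
  unfolding homog_def
proof
  fix mon assume "mon \<in> kys (p * q)"
  then obtain m m' where "mon = m + m'" "m \<in> kys p" "m' \<in> kys q" using keys_mult[of p q] by blast
  with assms show "tdeg mon = a + b" by (auto simp: tdeg_add homog_def)
qed
lemma homog_sum [simp]: "(\<And>x. x \<in> X \<Longrightarrow> homog e (g x)) \<Longrightarrow> homog e (sum g X)"
  by (induction X rule: infinite_finite_induct) auto
lemma homog_power: "homog e p \<Longrightarrow> homog (e * k) (p ^ k)"
proof (induction k)
  case (Suc k)
  then show ?case using homog_mult[of e p "e * k" "p ^ k"] by simp
qed simp
lemma homog_prod: "(\<And>x. x \<in> X \<Longrightarrow> homog (e x) (g x)) \<Longrightarrow> homog (sum e X) (prod g X)"
  by (induction X rule: infinite_finite_induct) (auto intro: homog_mult)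

section \<open>Homogeneous components\<close>

definition part :: "((nat \<Rightarrow>\<^sub>0 nat) \<Rightarrow> bool) \<Rightarrow> 'a::comm_ring_1 mpoly \<Rightarrow> 'a mpoly" where
  "part P p = Poly_Mapping.mapp (\<lambda>m c. if P m then c else 0) p"

lemma lookup_part: "lkp (part P p) m = (if P m then lkp p m else 0)"
  by (auto simp: part_def lookup_mapp when_def in_keys_iff)
lemma keys_part: "kys (part P p) = {m \<in> kys p. P m}"
  by (auto simp: in_keys_iff lookup_part split: if_splits)
lemma part_add: "part P (p + q) = part P p + part P q"
  by (rule poly_mapping_eqI) (simp add: lookup_part lookup_add)
lemma part_0 [simp]: "part P 0 = 0"
  by (rule poly_mapping_eqI) (simp add: lookup_part)
lemma part_sum: "part P (sum g X) = (\<Sum>x\<in>X. part P (g x))"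
  by (induction X rule: infinite_finite_induct) (auto simp: part_add)
lemma in_ring_part: "in_ring m p \<Longrightarrow> in_ring m (part P p)"
  by (auto simp: in_ring_def keys_part)

abbreviation hc :: "nat \<Rightarrow> 'a::comm_ring_1 mpoly \<Rightarrow> 'a mpoly" where
  "hc e \<equiv> part (\<lambda>m. tdeg m = e)"

lemma homog_hc [simp]: "homog e (hc e p)" by (auto simp: homog_def keys_part)
lemma hc_homog: "homog e p \<Longrightarrow> hc e' p = (if e' = e then p else 0)"
  by (rule poly_mapping_eqI) (auto simp: lookup_part homog_def in_keys_iff)
lemma sum_hc: "finite E \<Longrightarrow> tdeg ` kys p \<subseteq> E \<Longrightarrow> (\<Sum>e\<in>E. hc e p) = p"
  by (rule poly_mapping_eqI) (auto simp: lookup_sum lookup_part sum.delta simp flip: not_in_keys_iff_lookup_eq_zero)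
lemma hc_mult_homog:
  assumes q: "homog D q"
  shows "hc (e + D) (p * q) = hc e p * q"
proof -
  let ?E = "insert e (tdeg ` kys p)"
  have "hc (e + D) (p * q) = hc (e + D) ((\<Sum>e'\<in>?E. hc e' p) * q)"
    by (subst sum_hc[of ?E p]) auto
  also have "\<dots> = (\<Sum>e'\<in>?E. hc (e + D) (hc e' p * q))" by (simp add: sum_distrib_right part_sum)
  also have "\<dots> = (\<Sum>e'\<in>?E. if e' = e then hc e' p * q else 0)"
    by (intro sum.cong refl) (auto simp: hc_homog[OF homog_mult[OF homog_hc q]])
  also have "\<dots> = hc e p * q" by (subst sum.delta) auto
  finally show ?thesis .
qed

section \<open>Evaluation along a homomorphism of coefficients\<close>

definition mono_eval :: "(nat \<Rightarrow> 'r::comm_ring_1) \<Rightarrow> (nat \<Rightarrow>\<^sub>0 nat) \<Rightarrow> 'r" where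
  "mono_eval y m = (\<Prod>i\<in>kys m. y i ^ lkp m i)"

text \<open>The coefficient map \<open>h\<close> lets one evaluation serve both for
  \<open>subst\<close>, where \<open>h\<close> is \<open>Const\<close>, and for restriction to a
  line, where the values are univariate polynomials over the ring in the variables
  \<open>T\<close>.\<close>

definition peval :: "('k::comm_ring_1 \<Rightarrow> 'r::comm_ring_1) \<Rightarrow> (nat \<Rightarrow> 'r) \<Rightarrow> 'k mpoly \<Rightarrow> 'r" where
  "peval h y p = (\<Sum>m\<in>kys p. h (lkp p m) * mono_eval y m)"

lemma subst_peval: "subst y p = peval Const y p"
  by (simp add: subst_def peval_def mono_eval_def)

lemma mono_eval_superset:
  "finite X \<Longrightarrow> kys m \<subseteq> X \<Longrightarrow> mono_eval y m = (\<Prod>i\<in>X. y i ^ lkp m i)"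
  unfolding mono_eval_def by (rule prod.mono_neutral_left) (auto simp: in_keys_iff)

lemma mono_eval_add: "mono_eval y (m + m') = mono_eval y m * mono_eval y m'"
proof -
  let ?X = "kys m \<union> kys m'"
  have "mono_eval y (m + m') = (\<Prod>i\<in>?X. y i ^ lkp (m + m') i)"
    by (simp add: mono_eval_def keys_add_nat)
  also have "\<dots> = (\<Prod>i\<in>?X. y i ^ lkp m i) * (\<Prod>i\<in>?X. y i ^ lkp m' i)"
    by (simp add: lookup_add power_add prod.distrib)
  also have "\<dots> = mono_eval y m * mono_eval y m'"
    by (subst (1 2) mono_eval_superset[of ?X]) auto
  finally show ?thesis .
qed

lemma mono_eval_0 [simp]: "mono_eval y 0 = 1" by (simp add: mono_eval_def)
lemma mono_eval_single [simp]: "mono_eval y (Poly_Mapping.single i k) = y i ^ k"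
  by (simp add: mono_eval_def)
lemma mono_eval_scale: "mono_eval (\<lambda>i. c * y i) m = c ^ tdeg m * mono_eval y m"
  by (simp add: mono_eval_def tdeg_def power_mult_distrib prod.distrib power_sum)

locale coeff_hom =
  fixes h :: "'k::comm_ring_1 \<Rightarrow> 'r::comm_ring_1"
  assumes h_0 [simp]: "h 0 = 0" and h_1 [simp]: "h 1 = 1"
    and h_add: "h (a + b) = h a + h b" and h_mult: "h (a * b) = h a * h b"
begin

lemma peval_superset:
  "finite X \<Longrightarrow> kys p \<subseteq> X \<Longrightarrow> peval h y p = (\<Sum>m\<in>X. h (lkp p m) * mono_eval y m)"
  unfolding peval_def by (rule sum.mono_neutral_left) (auto simp: in_keys_iff)

lemma peval_0 [simp]: "peval h y 0 = 0" by (simp add: peval_def)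

lemma peval_add: "peval h y (p + q) = peval h y p + peval h y q"
proof -
  let ?X = "kys p \<union> kys q"
  have "peval h y (p + q) = (\<Sum>m\<in>?X. h (lkp (p + q) m) * mono_eval y m)"
    by (rule peval_superset) (use keys_add[of p q] in auto)
  also have "\<dots> = (\<Sum>m\<in>?X. h (lkp p m) * mono_eval y m) + (\<Sum>m\<in>?X. h (lkp q m) * mono_eval y m)"
    by (simp add: lookup_add h_add sum.distrib distrib_right)
  also have "\<dots> = peval h y p + peval h y q" by (subst (1 2) peval_superset[of ?X]) auto
  finally show ?thesis .
qed

lemma peval_sum: "peval h y (sum g X) = (\<Sum>x\<in>X. peval h y (g x))"
  by (induction X rule: infinite_finite_induct) (auto simp: peval_add)

lemma peval_single: "peval h y (Poly_Mapping.single m c) = h c * mono_eval y m"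
  by (cases "c = 0") (simp_all add: peval_def)

lemma peval_mult: "peval h y (p * q) = peval h y p * peval h y q"
proof -
  let ?s = Poly_Mapping.single
  have "p * q = (\<Sum>m\<in>kys p. ?s m (lkp p m)) * (\<Sum>m\<in>kys q. ?s m (lkp q m))"
    by (simp add: sum_monomials)
  also have "\<dots> = (\<Sum>m\<in>kys p. \<Sum>m'\<in>kys q. ?s (m + m') (lkp p m * lkp q m'))"
    by (simp add: sum_product mult_single)
  finally have "peval h y (p * q) =
      (\<Sum>m\<in>kys p. \<Sum>m'\<in>kys q. (h (lkp p m) * mono_eval y m) * (h (lkp q m') * mono_eval y m'))"
    by (simp add: peval_sum peval_single mono_eval_add h_mult algebra_simps)
  then show ?thesis by (simp add: peval_def sum_product)
qed

lemma peval_Const [simp]: "peval h y (Const c) = h c" by (simp add: Const_def peval_single)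
lemma peval_1 [simp]: "peval h y 1 = 1" using peval_Const[of y 1] by (simp del: peval_Const)
lemma peval_Var [simp]: "peval h y (Var i) = y i" by (simp add: Var_def peval_single)
lemma peval_uminus: "peval h y (- p) = - peval h y p"
  using peval_add[of y p "- p"] by (simp add: eq_neg_iff_add_eq_0 add.commute)
lemma peval_diff: "peval h y (p - q) = peval h y p - peval h y q"
  using peval_add[of y p "- q"] by (simp add: peval_uminus)
lemma peval_power: "peval h y (p ^ k) = peval h y p ^ k" by (induction k) (auto simp: peval_mult)
lemma peval_prod: "peval h y (prod g X) = (\<Prod>x\<in>X. peval h y (g x))"
  by (induction X rule: infinite_finite_induct) (auto simp: peval_mult)

lemma peval_subst: "peval h y (subst g p) = peval h (\<lambda>i. peval h y (g i)) p"
  unfolding subst_def peval_def[of h _ p] mono_eval_def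
  by (simp add: peval_sum peval_mult peval_prod peval_power)

lemma peval_scale:
  "homog e p \<Longrightarrow> peval h (\<lambda>i. c * y i) p = c ^ e * peval h y p"
  by (auto simp: peval_def mono_eval_scale homog_def sum_distrib_left mult_ac intro!: sum.cong)

lemma peval_cong: "in_ring n p \<Longrightarrow> (\<And>i. i < n \<Longrightarrow> y i = y' i) \<Longrightarrow> peval h y p = peval h y' p"
  unfolding peval_def mono_eval_def in_ring_def by (auto intro!: sum.cong prod.cong arg_cong2[where f="(*)"])

lemma peval_closed:
  assumes C: "0 \<in> C" "1 \<in> C" "\<And>a b. a \<in> C \<Longrightarrow> b \<in> C \<Longrightarrow> a + b \<in> C" "\<And>a b. a \<in> C \<Longrightarrow> b \<in> C \<Longrightarrow> a * b \<in> C"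
    and "\<And>c. h c \<in> C" and p: "in_ring n p" and y: "\<And>i. i < n \<Longrightarrow> y i \<in> C"
  shows "peval h y p \<in> C"
proof -
  have pow: "y i ^ k \<in> C" if "i < n" for i k by (induction k) (use C y[OF that] in auto)
  have pr: "prod g X \<in> C" if "\<And>x. x \<in> X \<Longrightarrow> g x \<in> C" for X :: "nat set" and g using that
    by (induction X rule: infinite_finite_induct) (use C in auto)
  have su: "sum g X \<in> C" if "\<And>x. x \<in> X \<Longrightarrow> g x \<in> C" for X :: "(nat \<Rightarrow>\<^sub>0 nat) set" and g using that
    by (induction X rule: infinite_finite_induct) (use C in auto)
  show ?thesis
    unfolding peval_def mono_eval_def
    by (intro su C(4) assms(5) pr pow) (use p in \<open>auto simp: in_ring_def\<close>)
qed

end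

interpretation Const: coeff_hom Const
  by unfold_locales (auto simp: Const_add Const_mult)

lemmas subst_add = Const.peval_add[folded subst_peval]
  and subst_mult = Const.peval_mult[folded subst_peval]
  and subst_diff = Const.peval_diff[folded subst_peval]
  and subst_uminus = Const.peval_uminus[folded subst_peval]
  and subst_sum = Const.peval_sum[folded subst_peval]
  and subst_prod = Const.peval_prod[folded subst_peval]
  and subst_power = Const.peval_power[folded subst_peval]
  and subst_scale = Const.peval_scale[folded subst_peval]
  and subst_cong = Const.peval_cong[folded subst_peval]
  and subst_subst = Const.peval_subst[folded subst_peval]
lemmas subst_Const [simp] = Const.peval_Const[folded subst_peval]
  and subst_Var [simp] = Const.peval_Var[folded subst_peval]
  and subst_0 [simp] = Const.peval_0[folded subst_peval]
  and subst_1 [simp] = Const.peval_1[folded subst_peval]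

lemma subst_Var_id: "subst Var p = p"
proof -
  have "mono_eval Var m = (Poly_Mapping.single m 1 :: 'a mpoly)" for m
  proof -
    have pw: "Var i ^ k = (Poly_Mapping.single (Poly_Mapping.single i k) 1 :: 'a mpoly)" for i k
      by (induction k) (auto simp: Var_def mult_single simp flip: single_add)
    have pr: "(\<Prod>i\<in>X. Poly_Mapping.single (g i) (1::'a)) = Poly_Mapping.single (sum g X) 1"
      if "finite X" for X :: "nat set" and g :: "nat \<Rightarrow> (nat \<Rightarrow>\<^sub>0 nat)"
      using that by (induction X) (auto simp: mult_single)
    show ?thesis by (simp add: mono_eval_def pw pr sum_monomials)
  qed
  then show ?thesis
    unfolding subst_peval peval_def by (simp add: Const_def mult_single sum_monomials)
qed

lemma subst_in_ring:
  assumes "in_ring r p" "\<And>i. i < r \<Longrightarrow> in_ring n (y i)"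
  shows "in_ring n (subst y p)"
  unfolding subst_peval
  using Const.peval_closed[where C="Collect (in_ring n)" and y=y and p=p and n=r] assms by simp

lemma homog_mono_eval:
  assumes "\<And>i. i \<in> kys m \<Longrightarrow> homog d (y i)"
  shows "homog (d * tdeg m) (mono_eval y m)"
  unfolding mono_eval_def tdeg_def sum_distrib_left by (rule homog_prod) (simp add: assms homog_power)

lemma subst_homog:
  assumes p: "in_ring r p" "homog e p" and y: "\<And>i. i < r \<Longrightarrow> homog d (y i)"
  shows "homog (d * e) (subst y p)"
  unfolding subst_peval peval_def
proof (rule homog_sum)
  fix m assume m: "m \<in> kys p"
  have "homog (d * tdeg m) (mono_eval y m)" by (rule homog_mono_eval) (use p y m in \<open>auto simp: in_ring_def\<close>)
  then show "homog (d * e) (Const (lkp p m) * mono_eval y m)"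
    using homog_mult[OF homog_Const] p m by (fastforce simp: homog_def)
qed

text \<open>Since \<open>d\<close> is positive, components of distinct degrees \<open>e\<close> land
  in distinct degrees \<open>d * e\<close> and cannot mix.\<close>

lemma subst_hc:
  assumes p: "in_ring r p" and y: "\<And>i. i < r \<Longrightarrow> homog d (y i)" and d: "d \<ge> 1"
  shows "hc (d * e) (subst y p) = subst y (hc e p)"
proof -
  let ?E = "insert e (tdeg ` kys p)"
  have "hc (d * e) (subst y p) = hc (d * e) (subst y (\<Sum>e'\<in>?E. hc e' p))"
    by (subst sum_hc[of ?E p]) auto
  also have "\<dots> = (\<Sum>e'\<in>?E. hc (d * e) (subst y (hc e' p)))" by (simp add: subst_sum part_sum)
  also have "\<dots> = (\<Sum>e'\<in>?E. if e' = e then subst y (hc e' p) else 0)"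
    using d by (intro sum.cong refl)
      (auto simp: hc_homog[OF subst_homog[OF in_ring_part[OF p] homog_hc y]])
  also have "\<dots> = subst y (hc e p)" by (subst sum.delta) auto
  finally show ?thesis .
qed

section \<open>The Koszul complex\<close>

definition ksgn :: "nat \<Rightarrow> nat set \<Rightarrow> 'a::comm_ring_1" where
  "ksgn l A = (- 1) ^ card {a \<in> A. a < l}"

text \<open>A chain \<open>c\<close> stands for the sum of the \<open>c A\<close> times e_A. This is
  the coefficient at e_A of its Koszul boundary, collected from the sets with one more
  index.\<close>

definition kd :: "nat \<Rightarrow> (nat \<Rightarrow> 'a::comm_ring_1) \<Rightarrow> (nat set \<Rightarrow> 'a) \<Rightarrow> nat set \<Rightarrow> 'a" where
  "kd r f c A = (\<Sum>l\<in>{..<r} - A. ksgn l A * f l * c (insert l A))"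

text \<open>Left exterior multiplication by e_l.\<close>

definition kh :: "nat \<Rightarrow> (nat set \<Rightarrow> 'a::comm_ring_1) \<Rightarrow> nat set \<Rightarrow> 'a" where
  "kh l c A = (if l \<in> A then ksgn l A * c (A - {l}) else 0)"

text \<open>The value 0 off the \<open>i\<close>-subsets makes equality of chains equality of
  functions. The coefficient set is a parameter because \<open>kd\<close> raises degrees, so cycles
  and their primitives live in different graded pieces.\<close>

definition kchain :: "nat \<Rightarrow> nat \<Rightarrow> 'b::zero set \<Rightarrow> (nat set \<Rightarrow> 'b) \<Rightarrow> bool" where
  "kchain r i Z c \<longleftrightarrow> (\<forall>A. if A \<subseteq> {..<r} \<and> card A = i then c A \<in> Z else c A = 0)"

lemma kchainD: "kchain r i Z c \<Longrightarrow> A \<subseteq> {..<r} \<Longrightarrow> card A = i \<Longrightarrow> c A \<in> Z"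
  and kchain_out: "kchain r i Z c \<Longrightarrow> \<not> (A \<subseteq> {..<r} \<and> card A = i) \<Longrightarrow> c A = 0"
  by (auto simp: kchain_def)

lemma kchain_in: "kchain r i Z c \<Longrightarrow> 0 \<in> Z \<Longrightarrow> c A \<in> Z"
  by (auto simp: kchain_def split: if_splits dest!: spec[of _ A])

lemma ksgn_sq: "ksgn l A * (ksgn l A :: 'a::comm_ring_1) = 1"
  by (simp add: ksgn_def flip: power_mult_distrib)

lemma ksgn_insert: "l \<notin> A \<Longrightarrow> ksgn m (insert l A) = (if l < m then - ksgn m A else ksgn m A)"
proof -
  assume l: "l \<notin> A"
  have fin: "finite {a \<in> A. a < m}" by (rule finite_subset[of _ "{..<m}"]) auto
  show ?thesis
  proof (cases "l < m")
    case True
    then have "{a \<in> insert l A. a < m} = insert l {a \<in> A. a < m}" by auto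
    then show ?thesis using l fin True by (simp add: ksgn_def)
  next
    case False
    then have "{a \<in> insert l A. a < m} = {a \<in> A. a < m}" by auto
    then show ?thesis using False by (simp add: ksgn_def)
  qed
qed

lemma ksgn_remove: "ksgn l (A - {l}) = ksgn l A"
proof -
  have "{a \<in> A - {l}. a < l} = {a \<in> A. a < l}" by auto
  then show ?thesis by (simp add: ksgn_def)
qed

lemma ksgn_swap:
  assumes "l \<notin> A" "m \<notin> A" "l \<noteq> m"
  shows "ksgn l A * ksgn m (insert l A) = - (ksgn m A * ksgn l (insert m A) :: 'a::comm_ring_1)"
  using assms by (auto simp: ksgn_insert)

text \<open>The diagonal is left out of the sum, so antisymmetry is enough in characteristic 2 as
  well.\<close>

lemma sum_antisym:
  fixes g :: "'b \<Rightarrow> 'b \<Rightarrow> 'a::ab_group_add"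
  assumes "finite X" "\<And>l m. l \<in> X \<Longrightarrow> m \<in> X \<Longrightarrow> l \<noteq> m \<Longrightarrow> g l m = - g m l"
  shows "(\<Sum>l\<in>X. \<Sum>m\<in>X - {l}. g l m) = 0"
  using assms
proof (induction X)
  case (insert x X)
  have "(\<Sum>l\<in>insert x X. \<Sum>m\<in>insert x X - {l}. g l m)
      = (\<Sum>m\<in>X. g x m) + (\<Sum>l\<in>X. \<Sum>m\<in>insert x X - {l}. g l m)"
    using insert.hyps by (simp add: insert_Diff_if)
  also have "(\<Sum>l\<in>X. \<Sum>m\<in>insert x X - {l}. g l m) = (\<Sum>l\<in>X. g l x + (\<Sum>m\<in>X - {l}. g l m))"
  proof (rule sum.cong[OF refl])
    fix l assume "l \<in> X"
    then have "insert x X - {l} = insert x (X - {l})" using insert.hyps by auto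
    then show "(\<Sum>m\<in>insert x X - {l}. g l m) = g l x + (\<Sum>m\<in>X - {l}. g l m)"
      using insert.hyps by simp
  qed
  also have "\<dots> = (\<Sum>l\<in>X. g l x)"
    using insert.IH[OF insert.prems] by (simp add: sum.distrib)
  also have "(\<Sum>m\<in>X. g x m) = (\<Sum>l\<in>X. - g l x)"
  proof (intro sum.cong refl)
    fix m assume "m \<in> X"
    then show "g x m = - g m x" using insert.hyps by (intro insert.prems) auto
  qed
  finally show ?case by (simp add: sum_negf)
qed simp

text \<open>Each unordered pair of indices missing from \<open>A\<close> contributes twice, with
  opposite signs by \<open>ksgn_swap\<close>.\<close>

lemma kd_kd: "kd r f (kd r f c) A = 0"
proof -
  let ?X = "{..<r} - A"
  have "kd r f (kd r f c) A = (\<Sum>l\<in>?X. \<Sum>m\<in>?X - {l}.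
      ksgn l A * ksgn m (insert l A) * (f l * f m * c (insert l (insert m A))))"
    unfolding kd_def
    by (intro sum.cong refl) (auto simp: sum_distrib_left mult_ac insert_commute intro!: sum.cong)
  also have "\<dots> = 0"
  proof (rule sum_antisym)
    fix l m assume "l \<in> ?X" "m \<in> ?X" "l \<noteq> m"
    then have "ksgn l A * ksgn m (insert l A) = - (ksgn m A * ksgn l (insert m A) :: 'a)"
      by (intro ksgn_swap) auto
    then show "ksgn l A * ksgn m (insert l A) * (f l * f m * c (insert l (insert m A)))
        = - (ksgn m A * ksgn l (insert m A) * (f m * f l * c (insert m (insert l A))))"
      by (simp add: insert_commute[of l m] mult.commute[of "f l"])
  qed simp
  finally show ?thesis .
qed

text \<open>Exterior multiplication by e_l is a homotopy between multiplication by
  \<open>f l\<close> and zero. Hence the ideal of the \<open>f l\<close> annihilates Koszul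
  homology, on which the descent through powers of the variables rests.\<close>

lemma kd_kh:
  assumes l: "l < r"
  shows "kd r f (kh l c) A + kh l (kd r f c) A = f l * c A"
proof (cases "l \<in> A")
  case False
  have "kd r f (kh l c) A = (\<Sum>m\<in>{..<r} - A. if m = l then ksgn l A * f l * (ksgn l A * c A) else 0)"
    unfolding kd_def
  proof (intro sum.cong refl)
    fix m assume m: "m \<in> {..<r} - A"
    have "ksgn l (insert l A) = (ksgn l A :: 'a)" using False by (simp add: ksgn_insert)
    then show "ksgn m A * f m * kh l c (insert m A)
        = (if m = l then ksgn l A * f l * (ksgn l A * c A) else 0)"
      using False m by (auto simp: kh_def)
  qed
  also have "\<dots> = ksgn l A * f l * (ksgn l A * c A)" using l False by (simp add: sum.delta)
  also have "\<dots> = (ksgn l A * ksgn l A) * f l * c A" by (simp only: mult_ac)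
  finally show ?thesis using False by (simp add: kh_def ksgn_sq)
next
  case True
  let ?X = "{..<r} - A" and ?A = "A - {l}"
  have X: "{..<r} - ?A = insert l ?X" "l \<notin> ?X" using l True by auto
  have "kh l (kd r f c) A = ksgn l A * (\<Sum>m\<in>{..<r} - ?A. ksgn m ?A * f m * c (insert m ?A))"
    using True by (simp add: kh_def kd_def)
  also have "\<dots> = ksgn l A * (ksgn l A * f l * c A) + (\<Sum>m\<in>?X. ksgn l A * ksgn m ?A * f m * c (insert m ?A))"
    unfolding X(1) using X(2) True by (simp add: ksgn_remove insert_absorb distrib_left sum_distrib_left mult_ac)
  also have "ksgn l A * (ksgn l A * f l * c A) = (ksgn l A * ksgn l A) * f l * c A"
    by (simp only: mult_ac)
  also have "\<dots> = f l * c A" by (simp add: ksgn_sq)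
  finally have 1: "kh l (kd r f c) A = f l * c A + (\<Sum>m\<in>?X. ksgn l A * ksgn m ?A * f m * c (insert m ?A))" .
  have 2: "kd r f (kh l c) A = (\<Sum>m\<in>?X. - (ksgn l A * ksgn m ?A * f m * c (insert m ?A)))"
    unfolding kd_def
  proof (intro sum.cong refl)
    fix m assume m: "m \<in> ?X"
    then have ml: "m \<noteq> l" using True by auto
    have a: "insert m A - {l} = insert m ?A" using ml by auto
    have "ksgn m A = (if l < m then - ksgn m ?A else ksgn m ?A :: 'a)"
      using ksgn_insert[of l ?A m, where 'a='a] True by (simp add: insert_absorb)
    moreover have "ksgn l (insert m A) = (if m < l then - ksgn l A else ksgn l A :: 'a)"
      using ksgn_insert[of m A l, where 'a='a] m by simp
    ultimately have key: "ksgn m A * ksgn l (insert m A) = - (ksgn l A * ksgn m ?A :: 'a)"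
      using ml by (cases "l < m") (auto simp: mult.commute)
    have "ksgn m A * f m * kh l c (insert m A) = (ksgn m A * ksgn l (insert m A)) * f m * c (insert m ?A)"
      using True a by (simp add: kh_def mult_ac)
    then show "ksgn m A * f m * kh l c (insert m A) = - (ksgn l A * ksgn m ?A * f m * c (insert m ?A))"
      by (simp add: key)
  qed
  show ?thesis unfolding 1 2 by (simp add: sum_negf)
qed

lemma kd_diff: "kd r f (\<lambda>A. c A - c' A) A = kd r f c A - kd r f c' A"
  by (simp add: kd_def right_diff_distrib sum_subtractf)
lemma kd_scale: "kd r f (\<lambda>A. x * c A) A = x * kd r f c A"
  by (simp add: kd_def sum_distrib_left mult_ac)
lemma kd_sum: "kd r f (\<lambda>A. \<Sum>x\<in>X. c x A) A = (\<Sum>x\<in>X. kd r f (c x) A)"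
  unfolding kd_def sum_distrib_left by (rule sum.swap)
lemma kd_zero [simp]: "kd r f (\<lambda>_. 0) A = 0" by (simp add: kd_def)

lemma kd_out:
  assumes c: "kchain r i Z c" and A: "\<not> (A \<subseteq> {..<r} \<and> Suc (card A) = i)"
  shows "kd r f c A = 0"
  unfolding kd_def
proof (rule sum.neutral, rule)
  fix l assume l: "l \<in> {..<r} - A"
  have "\<not> (insert l A \<subseteq> {..<r} \<and> card (insert l A) = i)"
    using A l by (auto simp: finite_subset[of A "{..<r}"])
  then show "ksgn l A * f l * c (insert l A) = 0" using kchain_out[OF c] by simp
qed

lemma kd_closed:
  assumes "kchain r i Z c" "0 \<in> Z" "0 \<in> Z'"
    and "\<And>a b. a \<in> Z' \<Longrightarrow> b \<in> Z' \<Longrightarrow> a + b \<in> Z'" "\<And>a. a \<in> Z' \<Longrightarrow> - a \<in> Z'"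
    and "\<And>l a. l < r \<Longrightarrow> a \<in> Z \<Longrightarrow> f l * a \<in> Z'"
  shows "kd r f c A \<in> Z'"
proof -
  have sgn: "ksgn l A * a \<in> Z'" if "a \<in> Z'" for a l
    using that assms by (cases "even (card {a \<in> A. a < l})") (auto simp: ksgn_def)
  have "sum g X \<in> Z'" if "\<And>x. x \<in> X \<Longrightarrow> g x \<in> Z'" for X :: "nat set" and g
    using that by (induction X rule: infinite_finite_induct) (use assms in auto)
  then show ?thesis unfolding kd_def mult.assoc
    by (rule) (use assms kchain_in[OF assms(1,2)] sgn in auto)
qed

lemma kchain_kd:
  assumes "kchain r (Suc i) Z c" "0 \<in> Z" "0 \<in> Z'"
    and "\<And>a b. a \<in> Z' \<Longrightarrow> b \<in> Z' \<Longrightarrow> a + b \<in> Z'" "\<And>a. a \<in> Z' \<Longrightarrow> - a \<in> Z'"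
    and "\<And>l a. l < r \<Longrightarrow> a \<in> Z \<Longrightarrow> f l * a \<in> Z'"
  shows "kchain r i Z' (kd r f c)"
  unfolding kchain_def using kd_closed[OF assms] kd_out[OF assms(1)] by auto

lemma kchain_kh:
  assumes c: "kchain r i Z c" and l: "l < r" and Z: "0 \<in> Z" "\<And>a. a \<in> Z \<Longrightarrow> - a \<in> Z"
  shows "kchain r (Suc i) Z (kh l c)"
  unfolding kchain_def
proof
  fix A
  have sgn: "ksgn l A * a \<in> Z" if "a \<in> Z" for a
    using that Z by (cases "even (card {a \<in> A. a < l})") (auto simp: ksgn_def)
  have "A - {l} \<subseteq> {..<r} \<and> card (A - {l}) = i \<longleftrightarrow> A \<subseteq> {..<r} \<and> card A = Suc i" if "l \<in> A"
  proof -
    have "A - {l} \<subseteq> {..<r} \<longleftrightarrow> A \<subseteq> {..<r}" using l by auto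
    moreover have "card A = Suc (card (A - {l}))" if "A \<subseteq> {..<r}"
      using finite_subset[OF that] \<open>l \<in> A\<close> by (metis card_Suc_Diff1 finite_lessThan)
    ultimately show ?thesis by auto
  qed
  then show "if A \<subseteq> {..<r} \<and> card A = Suc i then kh l c A \<in> Z else kh l c A = 0"
    using kchainD[OF c, of "A - {l}"] kchain_out[OF c, of "A - {l}"] sgn Z(1)
    by (cases "l \<in> A") (auto simp: kh_def)
qed

section \<open>Exactness of the Koszul complex in high degrees\<close>

definition forms :: "nat \<Rightarrow> nat \<Rightarrow> 'a::comm_ring_1 mpoly set" where
  "forms n e = {p. in_ring n p \<and> homog e p}"

lemma forms_0 [simp]: "0 \<in> forms n e" by (simp add: forms_def)
lemma forms_add [simp]: "p \<in> forms n e \<Longrightarrow> q \<in> forms n e \<Longrightarrow> p + q \<in> forms n e" by (simp add: forms_def)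
lemma forms_diff [simp]: "p \<in> forms n e \<Longrightarrow> q \<in> forms n e \<Longrightarrow> p - q \<in> forms n e" by (simp add: forms_def)
lemma forms_uminus [simp]: "p \<in> forms n e \<Longrightarrow> - p \<in> forms n e" by (simp add: forms_def)
lemma forms_sum: "(\<And>x. x \<in> X \<Longrightarrow> g x \<in> forms n e) \<Longrightarrow> sum g X \<in> forms n e" by (simp add: forms_def)
lemma forms_mult: "p \<in> forms n a \<Longrightarrow> q \<in> forms n b \<Longrightarrow> p * q \<in> forms n (a + b)"
  by (simp add: forms_def homog_mult)
lemma forms_Const: "Const c \<in> forms n 0" by (simp add: forms_def)
lemma forms_Var: "i < n \<Longrightarrow> Var i \<in> forms n (Suc 0)" by (simp add: forms_def)
lemma forms_power: "p \<in> forms n e \<Longrightarrow> p ^ k \<in> forms n (e * k)" by (simp add: forms_def homog_power)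
lemma forms_hc: "in_ring n p \<Longrightarrow> hc e p \<in> forms n e" by (simp add: forms_def in_ring_part)

lemma single_mult_sum:
  "Poly_Mapping.single a c * p = (\<Sum>m\<in>kys p. Poly_Mapping.single (a + m) (c * lkp p m))"
proof -
  have "Poly_Mapping.single a c * p = Poly_Mapping.single a c * (\<Sum>m\<in>kys p. Poly_Mapping.single m (lkp p m))"
    by (simp add: sum_monomials)
  then show ?thesis by (simp add: sum_distrib_left mult_single)
qed

lemma lookup_single_mult:
  fixes a :: "nat \<Rightarrow>\<^sub>0 nat"
  shows "lkp (Poly_Mapping.single a c * p) (a + m) = c * lkp p m"
proof -
  have "lkp (Poly_Mapping.single a c * p) (a + m) = (\<Sum>m'\<in>kys p. if m' = m then c * lkp p m' else 0)"
    by (simp add: single_mult_sum lookup_sum lookup_single when_def)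
  then show ?thesis by (simp add: sum.delta in_keys_iff)
qed

lemma Var_power: "Var i ^ k = Poly_Mapping.single (Poly_Mapping.single i k) 1"
  by (induction k) (auto simp: Var_def mult_single simp flip: single_add)

section \<open>Ideals generated by the N-th powers of the first j variables\<close>

definition powmon :: "nat \<Rightarrow> nat \<Rightarrow> 'a::comm_ring_1 mpoly set" where
  "powmon N j = {p. \<forall>m\<in>kys p. \<exists>i<j. lkp m i \<ge> N}"

lemma powmon_0 [simp]: "powmon N 0 = {0}" by (auto simp: powmon_def)
lemma powmon_zero [simp]: "0 \<in> powmon N j" by (simp add: powmon_def)
lemma powmon_add [simp]: "p \<in> powmon N j \<Longrightarrow> q \<in> powmon N j \<Longrightarrow> p + q \<in> powmon N j"
  using keys_add[of p q] unfolding powmon_def by blast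
lemma powmon_uminus [simp]: "p \<in> powmon N j \<Longrightarrow> - p \<in> powmon N j"
  by (simp add: powmon_def in_keys_iff)
lemma powmon_diff [simp]: "p \<in> powmon N j \<Longrightarrow> q \<in> powmon N j \<Longrightarrow> p - q \<in> powmon N j"
  using powmon_add[of p N j "- q"] by simp
lemma powmon_mult [simp]:
  assumes "p \<in> powmon N j" shows "q * p \<in> powmon N j"
  unfolding powmon_def
proof safe
  fix m assume "m \<in> kys (q * p)"
  then obtain m1 m2 where m: "m = m1 + m2" "m2 \<in> kys p" using keys_mult[of q p] by blast
  with assms obtain i where "i < j" "lkp m2 i \<ge> N" by (auto simp: powmon_def)
  then show "\<exists>i<j. lkp m i \<ge> N" unfolding m by (intro exI[of _ i]) (simp add: lookup_add)
qed
lemma powmon_sum [simp]: "(\<And>x. x \<in> X \<Longrightarrow> g x \<in> powmon N j) \<Longrightarrow> sum g X \<in> powmon N j"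
  by (induction X rule: infinite_finite_induct) auto
lemma powmon_mono: "j \<le> j' \<Longrightarrow> p \<in> powmon N j \<Longrightarrow> p \<in> powmon N j'"
  unfolding powmon_def using less_le_trans by blast
lemma powmon_Var: "Var j ^ N * p \<in> powmon N (Suc j)"
proof -
  have "Var j ^ N \<in> powmon N (Suc j)" by (auto simp: powmon_def Var_power split: if_splits)
  then show ?thesis by (subst mult.commute) (rule powmon_mult)
qed

text \<open>The factor changes only the exponent of \<open>Var j\<close>, whereas membership in
  \<open>powmon N j\<close> is read off the exponents of smaller index.\<close>

lemma powmon_regular:
  assumes "Var j ^ N * p \<in> powmon N j" shows "p \<in> powmon N j"
  unfolding powmon_def
proof safe
  fix m assume m: "m \<in> kys p"
  let ?a = "Poly_Mapping.single j N"
  have "?a + m \<in> kys (Var j ^ N * p)"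
    using m by (simp add: Var_power in_keys_iff lookup_single_mult)
  with assms obtain i where "i < j" "lkp (?a + m) i \<ge> N" by (auto simp: powmon_def)
  then show "\<exists>i<j. lkp m i \<ge> N" by (intro exI[of _ i]) (simp add: lookup_add lookup_single)
qed

text \<open>The witness collects the monomials divisible by x_j^N; it is homogeneous and so can be a
  coefficient of a chain in lower degree.\<close>

lemma powmon_decomp:
  assumes p: "p \<in> powmon N (Suc j)" "p \<in> forms n (a + N)"
  obtains v where "v \<in> forms n a" "p - Var j ^ N * v \<in> powmon N j"
proof
  let ?X = "{m \<in> kys p. lkp m j \<ge> N}"
  define v where "v = (\<Sum>m\<in>?X. Poly_Mapping.single (m - Poly_Mapping.single j N) (lkp p m))"
  have split: "Poly_Mapping.single j N + (m - Poly_Mapping.single j N) = m" if "lkp m j \<ge> N" for m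
    by (rule poly_mapping_eqI) (use that in \<open>auto simp: lookup_add lookup_minus lookup_single when_def\<close>)
  show "v \<in> forms n a"
    unfolding v_def
  proof (rule forms_sum)
    fix m assume m: "m \<in> ?X"
    have "tdeg m = a + N" using m p by (auto simp: forms_def homog_def)
    then have "tdeg (m - Poly_Mapping.single j N) = a"
      using tdeg_add[of "Poly_Mapping.single j N" "m - Poly_Mapping.single j N"] split m by auto
    moreover have "kys (m - Poly_Mapping.single j N) \<subseteq> kys m" by (auto simp: in_keys_iff lookup_minus)
    ultimately show "Poly_Mapping.single (m - Poly_Mapping.single j N) (lkp p m) \<in> forms n a"
      using m p by (auto simp: forms_def in_ring_def homog_def)
  qed
  have "Var j ^ N * v = (\<Sum>m\<in>?X. Poly_Mapping.single m (lkp p m))"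
    unfolding v_def Var_power sum_distrib_left mult_single using split by (intro sum.cong) auto
  then have "p - Var j ^ N * v = (\<Sum>m\<in>kys p. Poly_Mapping.single m (lkp p m)) - (\<Sum>m\<in>?X. Poly_Mapping.single m (lkp p m))"
    by (simp add: sum_monomials)
  also have "\<dots> = (\<Sum>m\<in>kys p - ?X. Poly_Mapping.single m (lkp p m))"
    by (subst sum_diff) auto
  also have "\<dots> \<in> powmon N j"
  proof (rule powmon_sum)
    fix m assume "m \<in> kys p - ?X"
    with p(1) obtain i where "i < Suc j" "lkp m i \<ge> N" "\<not> lkp m j \<ge> N" by (auto simp: powmon_def)
    then show "Poly_Mapping.single m (lkp p m) \<in> powmon N j"
      by (auto simp: powmon_def less_Suc_eq intro!: exI[of _ i])
  qed
  finally show "p - Var j ^ N * v \<in> powmon N j" .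
qed

text \<open>Pigeonhole: \<open>n * (N - 1)\<close> is the top degree of the quotient by the N-th
  powers of n variables.\<close>

lemma powmon_large:
  assumes p: "p \<in> forms n e" and e: "e > n * (N - 1)" shows "p \<in> powmon N n"
proof -
  have "\<exists>i<n. lkp m i \<ge> N" if m: "m \<in> kys p" for m
  proof (rule ccontr)
    assume "\<not> ?thesis"
    then have *: "\<And>i. i < n \<Longrightarrow> lkp m i \<le> N - 1" by fastforce
    have "tdeg m = (\<Sum>i<n. lkp m i)" by (rule tdeg_superset) (use p m in \<open>auto simp: forms_def in_ring_def\<close>)
    also have "\<dots> \<le> (\<Sum>i<n. N - 1)" by (rule sum_mono) (use * in auto)
    finally show False using p m e by (auto simp: forms_def homog_def)
  qed
  then show ?thesis by (simp add: powmon_def)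
qed

text \<open>Koszul homology of forms modulo the powers \<open>x\<^sub>0\<^sup>N, \<dots>, x\<^sub>j\<^sub>-\<^sub>1\<^sup>N\<close>, by descending induction on \<open>j\<close>:
  since \<open>x\<^sub>j\<^sup>N\<close> lies in the ideal of the \<open>f l\<close>, it annihilates the Koszul homology, so a cycle
  lifts to one of the next higher degree modulo one more power. Once all variables are used up,
  the forms of the relevant degree vanish.\<close>
lemma koszul_exact_mod:
  fixes f :: "nat \<Rightarrow> 'a::comm_ring_1 mpoly"
  assumes f: "\<And>l. l < r \<Longrightarrow> f l \<in> forms n d" and N: "d \<le> N"
    and g: "\<And>j l. j < n \<Longrightarrow> l < r \<Longrightarrow> g j l \<in> forms n (N - d)"
    and gf: "\<And>j. j < n \<Longrightarrow> Var j ^ N = (\<Sum>l<r. g j l * f l)"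
    and j: "j \<le> n" and deg: "a + d + (n - j) * N > n * (N - 1) + (n - j) * d"
    and z: "kchain r q (forms n (a + d)) z" "\<And>A. kd r f z A \<in> powmon N j"
  shows "\<exists>w. kchain r (Suc q) (forms n a) w \<and> (\<forall>A. z A - kd r f w A \<in> powmon N j)"
  using j deg z
proof (induction j arbitrary: q a z rule: inc_induct)
  case base
  then have "z A \<in> powmon N n" for A
    using powmon_large[of "z A" n "a + d" N] kchain_in[OF base(2)] by simp
  then show ?case by (intro exI[of _ "\<lambda>_. 0"]) (simp add: kchain_def)
next
  case (step j)
  note z = step.prems(2,3)
  \<comment> \<open>The homotopies \<open>kh l\<close>, weighted by the coefficients of x_j^N in
    terms of the \<open>f l\<close>, give a primitive of x_j^N z modulo the earlier powers.\<close>
  define w where "w A = (\<Sum>l<r. g j l * kh l z A)" for A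
  have w: "kchain r (Suc q) (forms n ((a + N - d) + d)) w"
  proof -
    have kc: "kchain r (Suc q) (forms n (a + d)) (kh l z)" if "l < r" for l
      by (rule kchain_kh[OF z(1) that]) auto
    have eq: "(a + N - d) + d = (N - d) + (a + d)" using N by simp
    show ?thesis
      unfolding kchain_def w_def eq
      using kchainD[OF kc] kchain_out[OF kc] g[OF step.hyps(2)]
      by (auto intro!: forms_sum forms_mult sum.neutral)
  qed
  have kdw: "kd r f w A - Var j ^ N * z A \<in> powmon N j" for A
  proof -
    have "kd r f w A = (\<Sum>l<r. g j l * kd r f (kh l z) A)"
      unfolding w_def by (simp add: kd_sum kd_scale)
    also have "\<dots> = (\<Sum>l<r. g j l * (f l * z A - kh l (kd r f z) A))"
      by (intro sum.cong refl arg_cong2[where f="(*)"]) (simp add: eq_diff_eq kd_kh)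
    also have "\<dots> = Var j ^ N * z A - (\<Sum>l<r. g j l * kh l (kd r f z) A)"
      unfolding gf[OF step.hyps(2)] by (simp add: algebra_simps sum_subtractf sum_distrib_left)
    finally have "kd r f w A - Var j ^ N * z A = - (\<Sum>l<r. g j l * kh l (kd r f z) A)" by simp
    moreover have "kh l (kd r f z) A \<in> powmon N j" for l using z(2) by (auto simp: kh_def)
    ultimately show ?thesis by simp
  qed
  \<comment> \<open>Once the j-th power is added to the ideal, the term x_j^N z is absorbed and
    \<open>w\<close> is a cycle, in a coefficient degree higher by N - d.\<close>
  have kdw': "kd r f w A \<in> powmon N (Suc j)" for A
    using powmon_add[OF powmon_mono[OF _ kdw[of A], of "Suc j"] powmon_Var[of j N "z A"]] by simp
  \<comment> \<open>The gain N - d in degree is exactly offset by passing from \<open>n - j\<close>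
    to \<open>n - Suc j\<close>, so the strict inequality is an invariant.\<close>
  have "(n - j) * N = (n - Suc j) * N + N" "(n - j) * d = (n - Suc j) * d + d"
    using step.hyps(2) by (metis Suc_diff_Suc add.commute mult_Suc)+
  then have "a + N - d + d + (n - Suc j) * N > n * (N - 1) + (n - Suc j) * d"
    using step.prems(1) N by linarith
  from step.IH[OF this w kdw'] obtain u where
    u: "kchain r (Suc (Suc q)) (forms n (a + N - d)) u" "\<And>A. w A - kd r f u A \<in> powmon N (Suc j)" by blast
  have wu: "w A - kd r f u A \<in> forms n (a + N)" for A
  proof -
    have "kd r f u A \<in> forms n ((a + N - d) + d)"
      by (rule kd_closed[OF u(1)]) (auto simp: add.commute[of _ d] intro!: forms_mult f)
    then show ?thesis using kchain_in[OF w] N by simp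
  qed
  \<comment> \<open>What \<open>u\<close> leaves of \<open>w\<close> is divisible by x_j^N modulo
    the earlier powers. The quotient is the wanted primitive of \<open>z\<close>, by cancelling
    x_j^N after taking boundaries.\<close>
  have "\<exists>v. v \<in> forms n a \<and> w A - kd r f u A - Var j ^ N * v \<in> powmon N j" for A
    using powmon_decomp[OF u(2) wu] by metis
  then obtain v0 where v0: "\<And>A. v0 A \<in> forms n a" "\<And>A. w A - kd r f u A - Var j ^ N * v0 A \<in> powmon N j"
    by metis
  define v where "v A = (if A \<subseteq> {..<r} \<and> card A = Suc q then v0 A else 0)" for A
  have v: "kchain r (Suc q) (forms n a) v" using v0 by (simp add: kchain_def v_def)
  have v': "w A - kd r f u A - Var j ^ N * v A \<in> powmon N j" for A
    using v0(2)[of A] kchain_out[OF w, of A] kd_out[OF u(1), of A f] by (auto simp: v_def)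
  have "z A - kd r f v A \<in> powmon N j" for A
  proof (rule powmon_regular)
    have "kd r f (\<lambda>A. w A - kd r f u A - Var j ^ N * v A) A \<in> powmon N j"
      by (subst kd_def) (intro powmon_sum powmon_mult v')
    then have "kd r f w A - Var j ^ N * kd r f v A \<in> powmon N j"
      by (simp add: kd_diff kd_scale kd_kd)
    from powmon_diff[OF this kdw[of A]]
    show "Var j ^ N * (z A - kd r f v A) \<in> powmon N j" by (simp add: right_diff_distrib)
  qed
  with v show ?case by blast
qed

text \<open>The case without powers. For \<open>N \<ge> 1\<close> the degree hypothesis says a + d +
  n > n d: the auxiliary exponent drops out of the bound.\<close>

lemma koszul_exact:
  fixes f :: "nat \<Rightarrow> 'a::comm_ring_1 mpoly"
  assumes f: "\<And>l. l < r \<Longrightarrow> f l \<in> forms n d" and N: "d \<le> N"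
    and g: "\<And>j l. j < n \<Longrightarrow> l < r \<Longrightarrow> g j l \<in> forms n (N - d)"
    and gf: "\<And>j. j < n \<Longrightarrow> Var j ^ N = (\<Sum>l<r. g j l * f l)"
    and deg: "a + d + n * N > n * (N - 1) + n * d"
    and z: "kchain r q (forms n (a + d)) z" "\<And>A. kd r f z A = 0"
  obtains w where "kchain r (Suc q) (forms n a) w" "\<And>A. kd r f w A = z A"
proof -
  have "\<exists>w. kchain r (Suc q) (forms n a) w \<and> (\<forall>A. z A - kd r f w A \<in> powmon N 0)"
    by (rule koszul_exact_mod[where g=g, OF f N g gf]) (use deg z in auto)
  then show ?thesis using that by auto
qed

text \<open>For d = N = 1 the degree hypothesis holds for every \<open>a\<close>, so the complex is
  exact wherever the coefficients have positive degree.\<close>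

lemma koszul_exact_Var:
  fixes z :: "nat set \<Rightarrow> 'a::comm_ring_1 mpoly"
  assumes z: "kchain r q (forms r (Suc a)) z" "\<And>A. kd r Var z A = 0"
  obtains w where "kchain r (Suc q) (forms r a) w" "\<And>A. kd r Var w A = z A"
proof (rule koszul_exact[where f=Var and n=r and d=1 and N=1 and a=a and z=z and q=q
    and g="\<lambda>j l. if l = j then 1 else 0 :: 'a mpoly"])
  show "Var j ^ 1 = (\<Sum>l<r. (if l = j then 1 else 0) * Var l :: 'a mpoly)" if "j < r" for j
    using that by (simp add: if_distrib[of "\<lambda>x. x * _"] cong: if_cong)
qed (use z that in \<open>auto simp: forms_def\<close>)

section \<open>Koszul homology of modules with a linear resolution\<close>

definition vkd :: "nat \<Rightarrow> (nat set \<Rightarrow> nat \<Rightarrow> 'a::comm_ring_1 mpoly) \<Rightarrow> nat set \<Rightarrow> nat \<Rightarrow> 'a mpoly" where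
  "vkd r z A = (\<lambda>j. kd r Var (\<lambda>A. z A j) A)"

definition gpart :: "(nat \<Rightarrow> 'a::comm_ring_1 mpoly) set \<Rightarrow> nat \<Rightarrow> (nat \<Rightarrow> 'a mpoly) set" where
  "gpart Z e = {v \<in> Z. \<forall>j. homog e (v j)}"

text \<open>Coefficients of degree \<open>Suc e\<close> in homological degree \<open>i\<close> have
  internal degree e + i + 1. Vanishing for all \<open>e \<ge> \<delta>\<close> therefore means
  vanishing above \<delta> + i.\<close>

definition kvan :: "nat \<Rightarrow> (nat \<Rightarrow> 'a::comm_ring_1 mpoly) set \<Rightarrow> nat \<Rightarrow> nat \<Rightarrow> bool" where
  "kvan r Z i e \<longleftrightarrow> (\<forall>z. kchain r i (gpart Z (Suc e)) z \<longrightarrow> (\<forall>A. vkd r z A = 0)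
     \<longrightarrow> (\<exists>w. kchain r (Suc i) (gpart Z e) w \<and> (\<forall>A. vkd r w A = z A)))"

text \<open>Graded submodules of a free module; closure under \<open>hc\<close> encodes the
  grading.\<close>

definition vsub :: "nat \<Rightarrow> nat \<Rightarrow> (nat \<Rightarrow> 'a::comm_ring_1 mpoly) set \<Rightarrow> bool" where
  "vsub r b Z \<longleftrightarrow> Z \<subseteq> vecs r b \<and> 0 \<in> Z \<and> (\<forall>v\<in>Z. \<forall>w\<in>Z. v + w \<in> Z)
     \<and> (\<forall>p. in_ring r p \<longrightarrow> (\<forall>v\<in>Z. (\<lambda>j. p * v j) \<in> Z)) \<and> (\<forall>v\<in>Z. \<forall>e. (\<lambda>j. hc e (v j)) \<in> Z)"

lemma vsubD:
  assumes "vsub r b Z"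
  shows "Z \<subseteq> vecs r b" "0 \<in> Z" "\<And>v w. v \<in> Z \<Longrightarrow> w \<in> Z \<Longrightarrow> v + w \<in> Z"
    "\<And>p v. in_ring r p \<Longrightarrow> v \<in> Z \<Longrightarrow> (\<lambda>j. p * v j) \<in> Z" "\<And>v e. v \<in> Z \<Longrightarrow> (\<lambda>j. hc e (v j)) \<in> Z"
  using assms by (auto simp: vsub_def)

lemma vsub_uminus: "vsub r b Z \<Longrightarrow> v \<in> Z \<Longrightarrow> - v \<in> Z"
  using vsubD(4)[of r b Z "- 1" v] by (simp add: fun_Compl_def)
lemma vsub_diff: "vsub r b Z \<Longrightarrow> v \<in> Z \<Longrightarrow> w \<in> Z \<Longrightarrow> v - w \<in> Z"
  using vsubD(3)[of r b Z v "- w"] vsub_uminus[of r b Z w] by simp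
lemma vsub_sum: "vsub r b Z \<Longrightarrow> (\<And>x. x \<in> X \<Longrightarrow> g x \<in> Z) \<Longrightarrow> sum g X \<in> Z"
  by (induction X rule: infinite_finite_induct) (auto simp: vsubD)

lemma sum_fun_app: "sum g X j = (\<Sum>x\<in>X. g x j)"
  by (induction X rule: infinite_finite_induct) auto

lemma vecs_in_ring: "v \<in> vecs r b \<Longrightarrow> in_ring r (v j)"
  by (cases "j < b") (auto simp: vecs_def)

lemma vsub_vecs: "vsub r b (vecs r b)"
  by (auto simp: vsub_def vecs_def in_ring_part)

lemma gpart_0: "vsub r b Z \<Longrightarrow> 0 \<in> gpart Z e" by (simp add: gpart_def vsubD)
lemma gpart_add: "vsub r b Z \<Longrightarrow> v \<in> gpart Z e \<Longrightarrow> w \<in> gpart Z e \<Longrightarrow> v + w \<in> gpart Z e"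
  by (simp add: gpart_def vsubD)
lemma gpart_diff: "vsub r b Z \<Longrightarrow> v \<in> gpart Z e \<Longrightarrow> w \<in> gpart Z e \<Longrightarrow> v - w \<in> gpart Z e"
  by (simp add: gpart_def vsub_diff)
lemma gpart_sum: "vsub r b Z \<Longrightarrow> (\<And>x. x \<in> X \<Longrightarrow> g x \<in> gpart Z e) \<Longrightarrow> sum g X \<in> gpart Z e"
  by (induction X rule: infinite_finite_induct) (auto simp: gpart_0 gpart_add)
lemma gpart_mult: "vsub r b Z \<Longrightarrow> v \<in> gpart Z e \<Longrightarrow> p \<in> forms r a \<Longrightarrow> (\<lambda>j. p * v j) \<in> gpart Z (a + e)"
  by (simp add: gpart_def vsubD forms_def homog_mult)
lemma gpart_hc: "vsub r b Z \<Longrightarrow> v \<in> Z \<Longrightarrow> (\<lambda>j. hc e (v j)) \<in> gpart Z e"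
  by (simp add: gpart_def vsubD)
lemma gpart_vecs: "v \<in> gpart (vecs r b) e \<longleftrightarrow> (\<forall>j<b. v j \<in> forms r e) \<and> (\<forall>j\<ge>b. v j = 0)"
  by (auto simp: gpart_def vecs_def forms_def) (metis homog_0 le_less_linear)

lemma kchain_gpart_diff:
  "vsub r b Z \<Longrightarrow> kchain r i (gpart Z e) z \<Longrightarrow> kchain r i (gpart Z e) w \<Longrightarrow> kchain r i (gpart Z e) (\<lambda>A. z A - w A)"
  by (auto simp: kchain_def gpart_diff)

lemma kchain_mono: "kchain r i Z z \<Longrightarrow> Z \<subseteq> Z' \<Longrightarrow> kchain r i Z' z"
  by (auto simp: kchain_def)

lemma kchain_change: "kchain r i Z z \<Longrightarrow> (\<And>A. z A \<in> Z \<Longrightarrow> z A \<in> Z') \<Longrightarrow> kchain r i Z' z"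
  by (simp add: kchain_def)

lemma kchain_map:
  "kchain r i Z z \<Longrightarrow> \<phi> 0 = 0 \<Longrightarrow> (\<And>v. v \<in> Z \<Longrightarrow> \<phi> v \<in> Z') \<Longrightarrow> kchain r i Z' (\<lambda>A. \<phi> (z A))"
  by (simp add: kchain_def)

lemma gpart_mono: "Z \<subseteq> Z' \<Longrightarrow> gpart Z e \<subseteq> gpart Z' e" by (auto simp: gpart_def)

lemma vkd_vkd: "vkd r (vkd r z) A = 0"
  by (rule ext) (simp add: vkd_def kd_kd)
lemma vkd_diff: "vkd r (\<lambda>A. z A - w A) A = vkd r z A - vkd r w A"
  by (rule ext) (simp add: vkd_def kd_diff)

lemma vkd_sum: "vkd r z A = (\<Sum>l\<in>{..<r} - A. (\<lambda>j. ksgn l A * Var l * z (insert l A) j))"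
  by (rule ext) (simp add: vkd_def kd_def sum_fun_app)

lemma ksgn_forms: "ksgn l A \<in> forms r 0"
  using forms_power[OF forms_uminus[OF forms_Const[of 1 r]]] by (simp add: ksgn_def)

lemma vkd_out:
  assumes c: "kchain r i Z c" and A: "\<not> (A \<subseteq> {..<r} \<and> Suc (card A) = i)"
  shows "vkd r c A = 0"
proof
  fix j
  have "kchain r i UNIV (\<lambda>A. c A j)" using c by (auto simp: kchain_def)
  from kd_out[OF this A] show "vkd r c A j = 0 j" by (simp add: vkd_def)
qed

lemma vkd_gpart:
  assumes "vsub r b Z" "kchain r i (gpart Z e) z"
  shows "vkd r z A \<in> gpart Z (Suc e)"
  unfolding vkd_sum
proof (rule gpart_sum[OF assms(1)])
  fix l assume "l \<in> {..<r} - A"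
  then have "ksgn l A * Var l \<in> forms r (Suc 0)"
    using forms_mult[OF ksgn_forms forms_Var, of l r l A] by simp
  from gpart_mult[OF assms(1) kchain_in[OF assms(2) gpart_0[OF assms(1)]] this]
  show "(\<lambda>j. ksgn l A * Var l * z (insert l A) j) \<in> gpart Z (Suc e)" by simp
qed

lemma kchain_vkd:
  assumes "vsub r b Z" "kchain r (Suc i) (gpart Z e) z"
  shows "kchain r i (gpart Z (Suc e)) (vkd r z)"
  using vkd_gpart[OF assms] vkd_out[OF assms(2)] by (simp add: kchain_def)

lemma kvan_vecs: "kvan r (vecs r b) i e"
  unfolding kvan_def
proof (intro allI impI)
  fix z :: "nat set \<Rightarrow> nat \<Rightarrow> 'a mpoly"
  assume z: "kchain r i (gpart (vecs r b) (Suc e)) z" "\<forall>A. vkd r z A = 0"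
  have "\<exists>w. kchain r (Suc i) (forms r e) w \<and> (\<forall>A. kd r Var w A = z A j)" if "j < b" for j
  proof (rule koszul_exact_Var)
    show "kchain r i (forms r (Suc e)) (\<lambda>A. z A j)"
      unfolding kchain_def using kchainD[OF z(1)] kchain_out[OF z(1)] that by (auto simp: gpart_vecs)
    show "kd r Var (\<lambda>A. z A j) A = 0" for A
      using z(2) fun_cong[of "vkd r z A" 0 j] unfolding vkd_def by simp
  qed blast
  then obtain w where w: "\<And>j. j < b \<Longrightarrow> kchain r (Suc i) (forms r e) (w j)"
    "\<And>j A. j < b \<Longrightarrow> kd r Var (w j) A = z A j" by metis
  define w' where "w' A = (\<lambda>j. if j < b then w j A else 0)" for A
  have "kchain r (Suc i) (gpart (vecs r b) e) w'"
    using kchainD[OF w(1)] kchain_out[OF w(1)] unfolding kchain_def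
    by (auto simp: gpart_vecs w'_def fun_eq_iff)
  moreover have "vkd r w' A = z A" for A
  proof
    fix j
    show "vkd r w' A j = z A j"
    proof (cases "j < b")
      case True then show ?thesis using w(2)[of j A] by (simp add: vkd_def w'_def)
    next
      case False
      then have "z A j = 0" using kchain_in[OF z(1) gpart_0[OF vsub_vecs], of A] by (simp add: gpart_vecs)
      then show ?thesis using False by (simp add: vkd_def w'_def)
    qed
  qed
  ultimately show "\<exists>w. kchain r (Suc i) (gpart (vecs r b) e) w \<and> (\<forall>A. vkd r w A = z A)" by blast
qed

section \<open>Homogeneous matrices acting on graded free modules\<close>

lemma mat_app_diff: "mat_app M b c (v - w) = mat_app M b c v - mat_app M b c w"
  by (rule ext) (simp add: mat_app_def right_diff_distrib sum_subtractf)
lemma mat_app_add: "mat_app M b c (v + w) = mat_app M b c v + mat_app M b c w"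
  by (rule ext) (simp add: mat_app_def distrib_left sum.distrib)
lemma mat_app_0 [simp]: "mat_app M b c 0 = 0" "mat_app M b c (\<lambda>_. 0) = 0"
  by (rule ext, simp add: mat_app_def)+
lemma mat_app_mult: "mat_app M b c (\<lambda>k. p * v k) = (\<lambda>j. p * mat_app M b c v j)"
  by (rule ext) (simp add: mat_app_def sum_distrib_left mult_ac)
lemma mat_app_sum: "mat_app M b c (sum g X) = (\<Sum>x\<in>X. mat_app M b c (g x))"
  by (induction X rule: infinite_finite_induct) (simp_all only: sum.infinite sum.empty sum.insert mat_app_0 mat_app_add not_False_eq_True)

lemma vkd_mat_app: "vkd r (\<lambda>A. mat_app M b c (z A)) A = mat_app M b c (vkd r z A)"
  unfolding vkd_sum mat_app_sum by (simp add: mat_app_mult)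

definition homat :: "nat \<Rightarrow> nat \<Rightarrow> nat \<Rightarrow> nat \<Rightarrow> (nat \<Rightarrow> nat \<Rightarrow> 'a::comm_ring_1 mpoly) \<Rightarrow> bool" where
  "homat r \<delta> b c M \<longleftrightarrow> (\<forall>j<c. \<forall>k<b. M j k \<in> forms r \<delta>)"

lemma mat_app_hc:
  assumes "homat r \<delta> b c M"
  shows "mat_app M b c (\<lambda>k. hc e (v k)) = (\<lambda>j. hc (e + \<delta>) (mat_app M b c v j))"
proof
  fix j
  have "hc (e + \<delta>) (M j k * v k) = M j k * hc e (v k)" if "j < c" "k < b" for k
    using assms that hc_mult_homog[of \<delta> "M j k" e "v k"] by (simp add: homat_def forms_def mult.commute)
  then show "mat_app M b c (\<lambda>k. hc e (v k)) j = hc (e + \<delta>) (mat_app M b c v j)"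
    by (simp add: mat_app_def part_sum)
qed

lemma mat_app_gpart:
  assumes "homat r \<delta> b c M" "v \<in> gpart (vecs r b) e"
  shows "mat_app M b c v \<in> gpart (vecs r c) (e + \<delta>)"
  using assms unfolding gpart_vecs by (auto simp: mat_app_def homat_def add.commute[of e] intro!: forms_sum forms_mult)

lemma homog_lift:
  assumes M: "homat r \<delta> b c M" and v: "v \<in> gpart (mat_app M b c ` vecs r b) (e + \<delta>)"
  obtains u where "u \<in> gpart (vecs r b) e" "mat_app M b c u = v"
proof -
  from v obtain u where u: "u \<in> vecs r b" "v = mat_app M b c u" "\<And>j. homog (e + \<delta>) (v j)"
    by (auto simp: gpart_def)
  have "mat_app M b c (\<lambda>k. hc e (u k)) = v"
    by (rule ext) (simp add: mat_app_hc[OF M] hc_homog[OF u(3)] flip: u(2))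
  with gpart_hc[OF vsub_vecs u(1), of e] show ?thesis by (rule that)
qed

lemma kchain_lift:
  assumes M: "homat r \<delta> b c M" and z: "kchain r i (gpart (mat_app M b c ` vecs r b) (e + \<delta>)) z"
  obtains u where "kchain r i (gpart (vecs r b) e) u" "\<And>A. mat_app M b c (u A) = z A"
proof -
  have "\<exists>u. if A \<subseteq> {..<r} \<and> card A = i then u \<in> gpart (vecs r b) e \<and> mat_app M b c u = z A else u = 0" for A
  proof (cases "A \<subseteq> {..<r} \<and> card A = i")
    case True
    then show ?thesis using homog_lift[OF M kchainD[OF z]] by metis
  qed auto
  then obtain u where u: "\<And>A. if A \<subseteq> {..<r} \<and> card A = i
      then u A \<in> gpart (vecs r b) e \<and> mat_app M b c (u A) = z A else u A = 0" by metis
  have "kchain r i (gpart (vecs r b) e) u" unfolding kchain_def using u by meson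
  moreover have "mat_app M b c (u A) = z A" for A
    using u[of A] kchain_out[OF z, of A] by (cases "A \<subseteq> {..<r} \<and> card A = i") auto
  ultimately show ?thesis by (rule that)
qed

text \<open>Dimension shifting: free modules have no Koszul homology with coefficients of positive
  degree, so H_i of the image of \<open>M t\<close> is controlled by H_(i-1) of the kernel of
  \<open>M t\<close>, which is the image of \<open>M (Suc t)\<close>.\<close>

lemma linear_resolution_vanish:
  fixes M :: "nat \<Rightarrow> nat \<Rightarrow> nat \<Rightarrow> 'a::comm_ring_1 mpoly"
  assumes M: "\<And>t. homat r (\<delta> t) (b (Suc t)) (b t) (M t)"
    and ex: "\<And>t. {v \<in> vecs r (b (Suc t)). mat_app (M t) (b (Suc t)) (b t) v = 0}
        = mat_app (M (Suc t)) (b (Suc (Suc t))) (b (Suc t)) ` vecs r (b (Suc (Suc t)))"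
    and \<delta>: "\<And>t. \<delta> (Suc t) = 1" and e: "e \<ge> \<delta> t"
  shows "kvan r (mat_app (M t) (b (Suc t)) (b t) ` vecs r (b (Suc t))) i e"
  using e
proof (induction i arbitrary: t e)
  \<comment> \<open>Common to both cases: a lift \<open>u\<close> of the cycle is corrected by a
    chain \<open>w\<close> in the kernel with the same boundary, and u - w is then a cycle over a
    free module. Only the origin of \<open>w\<close> depends on \<open>i\<close>.\<close>
  have step: "kvan r (mat_app (M t) (b (Suc t)) (b t) ` vecs r (b (Suc t))) i e"
    if e: "e \<ge> \<delta> t" and
      H: "\<And>u. kchain r i (gpart (vecs r (b (Suc t))) (Suc (e - \<delta> t))) u \<Longrightarrow>
        (\<And>A. mat_app (M t) (b (Suc t)) (b t) (vkd r u A) = 0) \<Longrightarrow>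
        \<exists>w. kchain r i (gpart (vecs r (b (Suc t))) (Suc (e - \<delta> t))) w
          \<and> (\<forall>A. mat_app (M t) (b (Suc t)) (b t) (w A) = 0) \<and> (\<forall>A. vkd r w A = vkd r u A)" for t i e
    unfolding kvan_def
  proof (intro allI impI)
    let ?m = "mat_app (M t) (b (Suc t)) (b t)" and ?F = "vecs r (b (Suc t)) :: (nat \<Rightarrow> 'a mpoly) set"
    fix z assume z: "kchain r i (gpart (?m ` ?F) (Suc e)) z" "\<forall>A. vkd r z A = 0"
    from e have eq: "Suc e = Suc (e - \<delta> t) + \<delta> t" by simp
    from kchain_lift[OF M z(1)[unfolded eq]] obtain u where
      u: "kchain r i (gpart ?F (Suc (e - \<delta> t))) u" "\<And>A. ?m (u A) = z A" by blast
    have "?m (vkd r u A) = 0" for A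
      using z(2) vkd_mat_app[of r "M t" "b (Suc t)" "b t" u A] by (simp add: u(2))
    from H[OF u(1) this] obtain w where w: "kchain r i (gpart ?F (Suc (e - \<delta> t))) w"
      "\<And>A. ?m (w A) = 0" "\<And>A. vkd r w A = vkd r u A" by blast
    have "kchain r i (gpart ?F (Suc (e - \<delta> t))) (\<lambda>A. u A - w A)"
      by (rule kchain_gpart_diff[OF vsub_vecs u(1) w(1)])
    moreover have "\<forall>A. vkd r (\<lambda>A. u A - w A) A = 0" by (simp add: vkd_diff w(3))
    ultimately obtain v where v: "kchain r (Suc i) (gpart ?F (e - \<delta> t)) v"
      "\<And>A. vkd r v A = u A - w A"
      using kvan_vecs[of r "b (Suc t)" i "e - \<delta> t", where 'a='a] unfolding kvan_def by blast
    have "kchain r (Suc i) (gpart (?m ` ?F) e) (\<lambda>A. ?m (v A))"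
    proof (rule kchain_map[OF v(1)])
      fix x assume x: "x \<in> gpart ?F (e - \<delta> t)"
      from mat_app_gpart[OF M[of t] x] e x show "?m x \<in> gpart (?m ` ?F) e" by (simp add: gpart_def)
    qed (rule mat_app_0)
    moreover have "vkd r (\<lambda>A. ?m (v A)) A = z A" for A
      by (simp add: vkd_mat_app v(2) mat_app_diff u(2) w(2))
    ultimately show "\<exists>w. kchain r (Suc i) (gpart (?m ` ?F) e) w \<and> (\<forall>A. vkd r w A = z A)" by blast
  qed
  {
    case 0
    show ?case
    proof (rule step[OF 0])
      fix u :: "nat set \<Rightarrow> nat \<Rightarrow> 'a mpoly"
      assume u: "kchain r 0 (gpart (vecs r (b (Suc t))) (Suc (e - \<delta> t))) u"
      have "vkd r u A = 0" for A by (rule vkd_out[OF u]) simp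
      then show "\<exists>w. kchain r 0 (gpart (vecs r (b (Suc t))) (Suc (e - \<delta> t))) w
          \<and> (\<forall>A. mat_app (M t) (b (Suc t)) (b t) (w A) = 0) \<and> (\<forall>A. vkd r w A = vkd r u A)"
        by (intro exI[of _ "\<lambda>_. 0"]) (auto simp: kchain_def gpart_0[OF vsub_vecs] vkd_def)
    qed
  next
    case (Suc i)
    show ?case
    proof (rule step[OF Suc.prems])
      let ?m = "mat_app (M t) (b (Suc t)) (b t)" and ?F = "vecs r (b (Suc t)) :: (nat \<Rightarrow> 'a mpoly) set"
      fix u assume u: "kchain r (Suc i) (gpart ?F (Suc (e - \<delta> t))) u" "\<And>A. ?m (vkd r u A) = 0"
      let ?Z = "{v \<in> ?F. ?m v = 0}"
      have "kchain r i (gpart ?F (Suc (Suc (e - \<delta> t)))) (vkd r u)" by (rule kchain_vkd[OF vsub_vecs u(1)])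
      then have "kchain r i (gpart ?Z (Suc (Suc (e - \<delta> t)))) (vkd r u)"
        by (rule kchain_change) (use u(2) in \<open>auto simp: gpart_def\<close>)
      \<comment> \<open>The boundary of the lift is a cycle in the next syzygy module, of
        homological degree lower by one. Its coefficient degree qualifies, since Suc (e - \<delta>
        t) is at least 1 = \<delta> (Suc t).\<close>
      moreover have "kvan r ?Z i (Suc (e - \<delta> t))"
        unfolding ex by (rule Suc.IH) (simp add: \<delta>)
      ultimately obtain w where w: "kchain r (Suc i) (gpart ?Z (Suc (e - \<delta> t))) w" "\<And>A. vkd r w A = vkd r u A"
        unfolding kvan_def using vkd_vkd by blast
      have "?m (w A) = 0" for A
        using kchainD[OF w(1), of A] kchain_out[OF w(1), of A]
        by (cases "A \<subseteq> {..<r} \<and> card A = Suc i") (auto simp: gpart_def)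
      then show "\<exists>w. kchain r (Suc i) (gpart ?F (Suc (e - \<delta> t))) w
          \<and> (\<forall>A. ?m (w A) = 0) \<and> (\<forall>A. vkd r w A = vkd r u A)"
        using w kchain_mono[OF w(1) gpart_mono, of ?F] by blast
    qed
  }
qed

section \<open>Linear resolutions from vanishing Koszul homology\<close>

lemma finite_monomials: "finite {m. kys m \<subseteq> {..<r} \<and> tdeg m = e}"
proof (rule finite_imageD)
  let ?X = "{m. kys m \<subseteq> {..<r} \<and> tdeg m = e}"
  have "(\<lambda>m. restrict (lkp m) {..<r}) ` ?X \<subseteq> PiE {..<r} (\<lambda>_. {..e})"
  proof (intro image_subsetI PiE_I)
    fix m i assume m: "m \<in> ?X" and i: "i \<in> {..<r}"
    have "lkp m i \<le> (\<Sum>i<r. lkp m i)" by (rule member_le_sum) (use i in auto)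
    then show "restrict (lkp m) {..<r} i \<in> {..e}" using tdeg_superset[of "{..<r}" m] m i by simp
  qed auto
  then show "finite ((\<lambda>m. restrict (lkp m) {..<r}) ` ?X)"
    by (rule finite_subset) (auto intro: finite_PiE)
  show "inj_on (\<lambda>m. restrict (lkp m) {..<r}) ?X"
  proof (rule inj_onI)
    fix m m' assume m: "m \<in> ?X" "m' \<in> ?X" and eq: "restrict (lkp m) {..<r} = restrict (lkp m') {..<r}"
    show "m = m'"
    proof (rule poly_mapping_eqI)
      fix i
      show "lkp m i = lkp m' i"
      proof (cases "i < r")
        case True then show ?thesis using fun_cong[OF eq, of i] by simp
      next
        case False
        then have "i \<notin> kys m" "i \<notin> kys m'" using m by auto
        then show ?thesis by (simp add: in_keys_iff)
      qed
    qed
  qed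
qed

text \<open>A graded piece lies in the span of finitely many monomials times unit vectors. The basis
  is indexed by numbers because it will form the columns of a matrix.\<close>

lemma gpart_basis:
  fixes Z :: "(nat \<Rightarrow> 'a::field mpoly) set"
  assumes Z: "vsub r c Z"
  obtains b and u :: "nat \<Rightarrow> nat \<Rightarrow> 'a mpoly" where
    "\<And>k. k < b \<Longrightarrow> u k \<in> gpart Z e"
    "\<And>v. v \<in> gpart Z e \<Longrightarrow> \<exists>x. v = (\<lambda>j. \<Sum>k<b. Const (x k) * u k j)"
    "\<And>x k. (\<lambda>j. \<Sum>k<b. Const (x k) * u k j) = 0 \<Longrightarrow> k < b \<Longrightarrow> x k = 0"
proof -
  interpret vs: vector_space "\<lambda>(x::'a) (v::nat \<Rightarrow> 'a mpoly). (\<lambda>j. Const x * v j)"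
    by unfold_locales (auto simp: fun_eq_iff Const_add Const_mult algebra_simps)
  let ?V = "gpart Z e"
  let ?T = "(\<lambda>(j0, m) j. if j = j0 then Poly_Mapping.single m 1 else (0::'a mpoly)) ` ({..<c} \<times> {m. kys m \<subseteq> {..<r} \<and> tdeg m = e})"
  have fin: "finite ?T" using finite_monomials by blast
  have VT: "?V \<subseteq> vs.span ?T"
  proof
    fix v assume "v \<in> ?V"
    then have v: "v \<in> gpart (vecs r c) e" using vsubD(1)[OF Z] by (auto simp: gpart_def)
    have "v = (\<Sum>j0<c. \<Sum>m\<in>kys (v j0). (\<lambda>j. Const (lkp (v j0) m) * (if j = j0 then Poly_Mapping.single m 1 else 0)))"
    proof
      fix j
      have "(\<Sum>j0<c. \<Sum>m\<in>kys (v j0). (\<lambda>j. Const (lkp (v j0) m) * (if j = j0 then Poly_Mapping.single m 1 else 0))) j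
          = (\<Sum>j0<c. if j0 = j then (\<Sum>m\<in>kys (v j0). Poly_Mapping.single m (lkp (v j0) m)) else 0)"
        unfolding sum_fun_app by (rule sum.cong[OF refl]) (auto simp: Const_def mult_single)
      also have "\<dots> = (if j < c then v j else 0)" by (simp add: sum_monomials)
      also have "\<dots> = v j" using v by (simp add: gpart_vecs)
      finally show "v j = (\<Sum>j0<c. \<Sum>m\<in>kys (v j0). (\<lambda>j. Const (lkp (v j0) m) * (if j = j0 then Poly_Mapping.single m 1 else 0))) j"
        by simp
    qed
    also have "\<dots> \<in> vs.span ?T"
    proof (intro vs.span_sum vs.span_scale vs.span_base)
      fix j0 m assume "j0 \<in> {..<c}" "m \<in> kys (v j0)"
      then have "(j0, m) \<in> {..<c} \<times> {m. kys m \<subseteq> {..<r} \<and> tdeg m = e}"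
        using v by (auto simp: gpart_vecs forms_def in_ring_def homog_def)
      then show "(\<lambda>j. if j = j0 then Poly_Mapping.single m 1 else 0) \<in> ?T" by (rule rev_image_eqI) auto
    qed
    finally show "v \<in> vs.span ?T" .
  qed
  obtain U where U: "U \<subseteq> ?V" "vs.independent U" "?V \<subseteq> vs.span U"
    by (rule vs.maximal_independent_subset)
  have "finite U" using vs.independent_span_bound[OF fin U(2)] U(1) VT by blast
  then obtain u where u: "bij_betw u {..<card U} U" using ex_bij_betw_nat_finite[of U] by (auto simp: atLeast0LessThan)
  have re: "(\<Sum>w\<in>U. (\<lambda>j. Const (y w) * w j)) = (\<lambda>j. \<Sum>k<card U. Const (y (u k)) * u k j)" for y
    by (rule ext) (simp add: sum_fun_app sum.reindex_bij_betw[OF u, symmetric])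
  show ?thesis
  proof (rule that[of "card U" u])
    show "u k \<in> ?V" if "k < card U" for k using u U(1) that by (auto simp: bij_betw_def)
    show "\<exists>x. v = (\<lambda>j. \<Sum>k<card U. Const (x k) * u k j)" if "v \<in> ?V" for v
    proof -
      have "v \<in> vs.span U" using that U(3) by blast
      then obtain y where "v = (\<Sum>w\<in>U. (\<lambda>j. Const (y w) * w j))"
        using vs.span_finite[OF \<open>finite U\<close>] by auto
      then show ?thesis using re[of y] by (intro exI[of _ "\<lambda>k. y (u k)"]) simp
    qed
    show "x k = 0" if x: "(\<lambda>j. \<Sum>k<card U. Const (x k) * u k j) = 0" and k: "k < card U" for x k
    proof -
      define y where "y w = x (the_inv_into {..<card U} u w)" for w
      have yu: "y (u k) = x k" if "k < card U" for k
        using u that unfolding y_def bij_betw_def by (simp add: the_inv_into_f_f)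
      have "(\<Sum>w\<in>U. (\<lambda>j. Const (y w) * w j)) = (\<lambda>j. \<Sum>k<card U. Const (x k) * u k j)"
        unfolding re by (intro ext sum.cong) (auto simp: yu)
      then have "(\<Sum>w\<in>U. (\<lambda>j. Const (y w) * w j)) = 0" using x by simp
      then have "y (u k) = 0" using vs.independentD[OF U(2) \<open>finite U\<close> order_refl] u k
        by (auto simp: bij_betw_def)
      then show ?thesis using yu[OF k] by simp
    qed
  qed
qed

lemma vsub_sum_hc:
  assumes Z: "vsub r c Z" and v: "v \<in> Z" and V: "\<And>e. (\<lambda>j. hc e (v j)) \<in> V"
    and V0: "0 \<in> V" "\<And>v w. v \<in> V \<Longrightarrow> w \<in> V \<Longrightarrow> v + w \<in> V"
  shows "v \<in> V"
proof -
  let ?E = "\<Union>j<c. tdeg ` kys (v j)"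
  have "v = (\<Sum>e\<in>?E. (\<lambda>j. hc e (v j)))"
  proof
    fix j
    have "v j = 0 \<or> j < c" using vsubD(1)[OF Z] v by (auto simp: vecs_def)
    then show "v j = (\<Sum>e\<in>?E. (\<lambda>j. hc e (v j))) j"
      unfolding sum_fun_app by (subst sum_hc) auto
  qed
  also have "(\<Sum>e\<in>X. (\<lambda>j. hc e (v j))) \<in> V" for X
    using V0 V by (induction X rule: infinite_finite_induct) (simp_all only: sum.infinite sum.empty sum.insert not_False_eq_True)
  finally show ?thesis .
qed

text \<open>Every chain of homological degree 0 is a cycle, so vanishing of H_0 says that the piece
  of degree e + 1 is generated by the piece of degree e.\<close>

lemma kvan_0_generates:
  assumes Z: "vsub r c Z" and k: "kvan r Z 0 e" and v: "v \<in> gpart Z (Suc e)"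
  obtains w where "\<And>l. w l \<in> gpart Z e" "v = (\<Sum>l<r. (\<lambda>j. Var l * w l j))"
proof -
  define z where "z A = (if A = {} then v else 0)" for A :: "nat set"
  have z: "kchain r 0 (gpart Z (Suc e)) z"
    using v by (auto simp: kchain_def z_def dest: finite_subset)
  moreover have "\<forall>A. vkd r z A = 0" using vkd_out[OF z] by auto
  ultimately obtain w where w: "kchain r (Suc 0) (gpart Z e) w" "\<And>A. vkd r w A = z A"
    using k unfolding kvan_def by blast
  have "v = vkd r w {}" by (simp add: w(2) z_def)
  also have "\<dots> = (\<Sum>l<r. (\<lambda>j. Var l * w {l} j))" by (simp add: vkd_sum ksgn_def)
  finally show ?thesis using that[of "\<lambda>l. w {l}"] kchain_in[OF w(1) gpart_0[OF Z]] by blast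
qed

text \<open>One step of the minimal resolution, with a k-basis of the lowest piece as columns.
  Vanishing of H_0 makes the columns generate, their independence leaves no constants in the kernel,
  and H_i of the kernel is controlled by H_(i+1) of \<open>Z\<close>. The kernel satisfies the same
  hypotheses with \<delta> = 1, which makes every later matrix linear.\<close>

lemma linear_step:
  fixes Z :: "(nat \<Rightarrow> 'a::field mpoly) set"
  assumes Z: "vsub r c Z" and low: "\<And>e. e < \<delta> \<Longrightarrow> gpart Z e \<subseteq> {0}"
    and van: "\<And>i e. e \<ge> \<delta> \<Longrightarrow> kvan r Z i e"
  obtains b and M :: "nat \<Rightarrow> nat \<Rightarrow> 'a mpoly" where
    "homat r \<delta> b c M" "Z = mat_app M b c ` vecs r b"
    "vsub r b {v \<in> vecs r b. mat_app M b c v = 0}"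
    "gpart {v \<in> vecs r b. mat_app M b c v = 0} 0 \<subseteq> {0}"
    "\<And>i e. e \<ge> 1 \<Longrightarrow> kvan r {v \<in> vecs r b. mat_app M b c v = 0} i e"
proof -
  obtain b and u :: "nat \<Rightarrow> nat \<Rightarrow> 'a mpoly" where
    u: "\<And>k. k < b \<Longrightarrow> u k \<in> gpart Z \<delta>"
    and sp: "\<And>v. v \<in> gpart Z \<delta> \<Longrightarrow> \<exists>x. v = (\<lambda>j. \<Sum>k<b. Const (x k) * u k j)"
    and ind: "\<And>x k. (\<lambda>j. \<Sum>k<b. Const (x k) * u k j) = 0 \<Longrightarrow> k < b \<Longrightarrow> x k = 0"
    by (rule gpart_basis[OF Z, of \<delta>]) (rule that)
  define M where "M j k = u k j" for j k
  let ?m = "mat_app M b c" and ?F = "vecs r b :: (nat \<Rightarrow> 'a mpoly) set"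
  let ?K = "{v \<in> ?F. ?m v = 0}"
  have u': "u k \<in> gpart (vecs r c) \<delta>" if "k < b" for k
    using u[OF that] vsubD(1)[OF Z] by (auto simp: gpart_def)
  have M: "homat r \<delta> b c M" using u' by (auto simp: homat_def M_def gpart_vecs)
  have app: "?m v = (\<lambda>j. \<Sum>k<b. v k * u k j)" for v
    using u' by (auto simp: mat_app_def M_def gpart_vecs fun_eq_iff mult.commute intro!: sum.cong)
  have app': "?m v = (\<Sum>k<b. (\<lambda>j. v k * u k j))" for v
    unfolding app by (rule ext) (simp add: sum_fun_app)
  have im: "?m ` ?F \<subseteq> Z"
    unfolding app' using u by (auto intro!: vsub_sum[OF Z] vsubD(4)[OF Z] simp: vecs_def gpart_def)
  have gim: "gpart Z (\<delta> + e) \<subseteq> ?m ` ?F" for e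
  proof (induction e)
    case 0
    show ?case
    proof
      fix v assume "v \<in> gpart Z (\<delta> + 0)"
      then obtain x where "v = (\<lambda>j. \<Sum>k<b. Const (x k) * u k j)" using sp by auto
      then have "v = ?m (\<lambda>k. if k < b then Const (x k) else 0)" by (simp add: app)
      moreover have "(\<lambda>k. if k < b then Const (x k) else 0) \<in> ?F" by (simp add: vecs_def)
      ultimately show "v \<in> ?m ` ?F" by (rule image_eqI)
    qed
  next
    case (Suc e)
    show ?case
    proof
      fix v assume "v \<in> gpart Z (\<delta> + Suc e)"
      then obtain w where w: "\<And>l. w l \<in> gpart Z (\<delta> + e)" "v = (\<Sum>l<r. (\<lambda>j. Var l * w l j))"
        using kvan_0_generates[OF Z van, of "\<delta> + e" v] by auto
      then have "\<exists>y. \<forall>l. y l \<in> ?F \<and> w l = ?m (y l)" using Suc by (intro choice) blast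
      then obtain y where y: "\<And>l. y l \<in> ?F" "\<And>l. w l = ?m (y l)" by blast
      have "v = ?m (\<Sum>l<r. (\<lambda>k. Var l * y l k))"
        unfolding w(2) y(2) mat_app_sum mat_app_mult ..
      moreover have "(\<Sum>l<r. (\<lambda>k. Var l * y l k)) \<in> ?F"
        by (intro vsub_sum[OF vsub_vecs] vsubD(4)[OF vsub_vecs] y) auto
      ultimately show "v \<in> ?m ` ?F" by blast
    qed
  qed
  have gim': "gpart Z e \<subseteq> ?m ` ?F" for e
  proof (cases "e < \<delta>")
    case True
    have "0 \<in> ?m ` ?F" by (rule image_eqI[of _ _ 0]) (auto simp: vsubD(2)[OF vsub_vecs])
    then show ?thesis using low[OF True] by blast
  next
    case False
    then show ?thesis using gim[of "e - \<delta>"] by simp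
  qed
  have Zim: "Z = ?m ` ?F"
  proof
    show "Z \<subseteq> ?m ` ?F"
    proof
      fix v assume v: "v \<in> Z"
      show "v \<in> ?m ` ?F"
      proof (rule vsub_sum_hc[OF Z v])
        show "(\<lambda>j. hc e (v j)) \<in> ?m ` ?F" for e using gim' gpart_hc[OF Z v] by blast
        show "0 \<in> ?m ` ?F" by (rule image_eqI[of _ _ 0]) (auto simp: vsubD(2)[OF vsub_vecs])
        fix v w assume "v \<in> ?m ` ?F" "w \<in> ?m ` ?F"
        then obtain v' w' where "v' \<in> ?F" "v = ?m v'" "w' \<in> ?F" "w = ?m w'" by blast
        then have "v + w = ?m (v' + w')" "v' + w' \<in> ?F"
          by (simp_all only: mat_app_add vsubD(3)[OF vsub_vecs])
        then show "v + w \<in> ?m ` ?F" by (rule image_eqI)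
      qed
    qed
  qed (rule im)
  have K: "vsub r b ?K"
    unfolding vsub_def
  proof (intro conjI ballI allI impI)
    fix v e assume v: "v \<in> ?K"
    have "?m (\<lambda>k. hc e (v k)) = (\<lambda>j. hc (e + \<delta>) (?m v j))" by (rule mat_app_hc[OF M])
    also have "\<dots> = 0" using v by (simp add: fun_eq_iff)
    finally show "(\<lambda>k. hc e (v k)) \<in> ?K" using v vsubD(5)[OF vsub_vecs] by blast
  next
    fix p :: "'a mpoly" and v assume "in_ring r p" "v \<in> ?K"
    then show "(\<lambda>k. p * v k) \<in> ?K"
      using vsubD(4)[OF vsub_vecs, of r p v b] mat_app_mult[of M b c p v] by (simp add: fun_eq_iff)
  next
    fix v w assume "v \<in> ?K" "w \<in> ?K"
    then show "v + w \<in> ?K" using vsubD(3)[OF vsub_vecs, of v r b w] mat_app_add[of M b c v w] by simp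
  qed (auto simp: vsubD(2)[OF vsub_vecs])
  have K0: "gpart ?K 0 \<subseteq> {0}"
  proof
    fix v assume "v \<in> gpart ?K 0"
    then have v: "v \<in> ?F" "?m v = 0" "\<And>k. homog 0 (v k)" by (auto simp: gpart_def)
    \<comment> \<open>A kernel vector of degree 0 has constant entries, hence is a linear relation
      among basis vectors.\<close>
    have vc: "v k = Const (lkp (v k) 0)" for k
      by (rule poly_mapping_eqI)
        (use v(3)[of k] in \<open>auto simp: Const_def lookup_single when_def homog_def tdeg_eq_0_iff in_keys_iff\<close>)
    have "(\<lambda>j. \<Sum>k<b. Const (lkp (v k) 0) * u k j) = 0" using v(2) unfolding app by (simp flip: vc)
    from ind[OF this] have "v k = 0" if "k < b" for k using vc[of k] that by simp
    then have "v = 0" using v(1) by (auto simp: vecs_def fun_eq_iff) (metis not_le)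
    then show "v \<in> {0}" by simp
  qed
  have Kvan: "kvan r ?K i e" if e: "e \<ge> 1" for i e
    unfolding kvan_def
  proof (intro allI impI)
    fix z assume z: "kchain r i (gpart ?K (Suc e)) z" "\<forall>A. vkd r z A = 0"
    have "kchain r i (gpart ?F (Suc e)) z" by (rule kchain_mono[OF z(1) gpart_mono]) auto
    then obtain w where w: "kchain r (Suc i) (gpart ?F e) w" "\<And>A. vkd r w A = z A"
      using kvan_vecs[of r b i e, where 'a='a] z(2) unfolding kvan_def by blast
    have mz: "?m (z A) = 0" for A
      using kchain_in[OF z(1) gpart_0[OF K], of A] by (simp add: gpart_def)
    \<comment> \<open>The primitive \<open>w\<close> of \<open>z\<close> in the free module may
      leave the kernel. Its image is a cycle over \<open>Z\<close>, hence a boundary; subtracting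
      the boundary of a lift brings \<open>w\<close> into the kernel and does not affect its own
      boundary.\<close>
    have "kchain r (Suc i) (gpart Z (Suc (e - 1 + \<delta>))) (\<lambda>A. ?m (w A))"
    proof (rule kchain_map[OF w(1)])
      fix v assume v: "v \<in> gpart ?F e"
      from mat_app_gpart[OF M v] e v show "?m v \<in> gpart Z (Suc (e - 1 + \<delta>))"
        unfolding Zim by (auto simp: gpart_def)
    qed (rule mat_app_0)
    moreover have "\<forall>A. vkd r (\<lambda>A. ?m (w A)) A = 0" by (simp add: vkd_mat_app w(2) mz)
    moreover have "kvan r Z (Suc i) (e - 1 + \<delta>)" by (rule van) simp
    ultimately obtain y where y: "kchain r (Suc (Suc i)) (gpart Z (e - 1 + \<delta>)) y" "\<And>A. vkd r y A = ?m (w A)"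
      unfolding kvan_def by blast
    from kchain_lift[OF M y(1)[unfolded Zim]] obtain y' where
      y': "kchain r (Suc (Suc i)) (gpart ?F (e - 1)) y'" "\<And>A. ?m (y' A) = y A" by blast
    have ky: "kchain r (Suc i) (gpart ?F e) (vkd r y')" using kchain_vkd[OF vsub_vecs y'(1)] e by simp
    have my: "?m (w A - vkd r y' A) = 0" for A
      by (simp add: mat_app_diff y'(2) y(2) flip: vkd_mat_app)
    have "kchain r (Suc i) (gpart ?K e) (\<lambda>A. w A - vkd r y' A)"
      by (rule kchain_change[OF kchain_gpart_diff[OF vsub_vecs w(1) ky]]) (use my in \<open>auto simp: gpart_def\<close>)
    moreover have "vkd r (\<lambda>A. w A - vkd r y' A) A = z A" for A
      by (simp add: vkd_diff w(2) vkd_vkd)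
    ultimately show "\<exists>w. kchain r (Suc i) (gpart ?K e) w \<and> (\<forall>A. vkd r w A = z A)" by blast
  qed
  show ?thesis by (rule that[OF M Zim K K0 Kvan])
qed

text \<open>The ring condition is put on the scalars alone, so that sets such as those of all
  \<open>x\<close> with \<open>x * h\<close> in an ideal qualify without a side condition on
  \<open>x\<close>.\<close>

definition pideal :: "nat \<Rightarrow> 'a::comm_ring_1 mpoly set \<Rightarrow> bool" where
  "pideal m U \<longleftrightarrow> 0 \<in> U \<and> (\<forall>a\<in>U. \<forall>b\<in>U. a + b \<in> U) \<and> (\<forall>c a. in_ring m c \<longrightarrow> a \<in> U \<longrightarrow> c * a \<in> U)"

lemma pideal_0: "pideal m U \<Longrightarrow> 0 \<in> U"
  and pideal_add: "pideal m U \<Longrightarrow> a \<in> U \<Longrightarrow> b \<in> U \<Longrightarrow> a + b \<in> U"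
  and pideal_mult: "pideal m U \<Longrightarrow> in_ring m c \<Longrightarrow> a \<in> U \<Longrightarrow> c * a \<in> U"
  by (auto simp: pideal_def)
lemma pideal_mult2: "pideal m U \<Longrightarrow> in_ring m c \<Longrightarrow> a \<in> U \<Longrightarrow> a * c \<in> U"
  using pideal_mult[of m U c a] by (simp add: mult.commute)
lemma pideal_uminus: "pideal m U \<Longrightarrow> a \<in> U \<Longrightarrow> - a \<in> U"
  using pideal_mult[of m U "- 1" a] by simp
lemma pideal_diff: "pideal m U \<Longrightarrow> a \<in> U \<Longrightarrow> b \<in> U \<Longrightarrow> a - b \<in> U"
  using pideal_add[of m U a "- b"] pideal_uminus by auto
lemma pideal_sum: "pideal m U \<Longrightarrow> (\<And>x. x \<in> X \<Longrightarrow> g x \<in> U) \<Longrightarrow> sum g X \<in> U"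
  by (induction X rule: infinite_finite_induct) (auto simp: pideal_0 pideal_add)

lemma pideal_gen_ideal: "pideal m (gen_ideal m G)"
  unfolding pideal_def
proof (intro conjI ballI allI impI)
  show "0 \<in> gen_ideal m G" by (auto simp: gen_ideal_def intro!: exI[of _ "{}"])
next
  fix a b assume "a \<in> gen_ideal m G" "b \<in> gen_ideal m G"
  then obtain F c F' c' where F: "finite F" "F \<subseteq> G" "\<forall>g\<in>F. in_ring m (c g)" "a = (\<Sum>g\<in>F. c g * g)"
    and F': "finite F'" "F' \<subseteq> G" "\<forall>g\<in>F'. in_ring m (c' g)" "b = (\<Sum>g\<in>F'. c' g * g)"
    unfolding gen_ideal_def by blast
  let ?c = "\<lambda>g. (if g \<in> F then c g else 0) + (if g \<in> F' then c' g else 0)"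
  have "(\<Sum>g\<in>F \<union> F'. ?c g * g) = (\<Sum>g\<in>F \<union> F'. (if g \<in> F then c g else 0) * g)
      + (\<Sum>g\<in>F \<union> F'. (if g \<in> F' then c' g else 0) * g)" by (simp add: distrib_right sum.distrib)
  also have "(\<Sum>g\<in>F \<union> F'. (if g \<in> F then c g else 0) * g) = a"
    unfolding F(4) by (rule sum.mono_neutral_cong_right) (use F F' in auto)
  also have "(\<Sum>g\<in>F \<union> F'. (if g \<in> F' then c' g else 0) * g) = b"
    unfolding F'(4) by (rule sum.mono_neutral_cong_right) (use F F' in auto)
  finally have "a + b = (\<Sum>g\<in>F \<union> F'. ?c g * g)" by simp
  moreover have "\<forall>g\<in>F \<union> F'. in_ring m (?c g)" using F F' by auto
  ultimately show "a + b \<in> gen_ideal m G"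
    unfolding gen_ideal_def using F F' by (intro CollectI exI[of _ "F \<union> F'"] exI[of _ ?c]) simp
next
  fix p a :: "'a mpoly" assume p: "in_ring m p" and "a \<in> gen_ideal m G"
  then obtain F c where F: "finite F" "F \<subseteq> G" "\<forall>g\<in>F. in_ring m (c g)" "a = (\<Sum>g\<in>F. c g * g)"
    unfolding gen_ideal_def by blast
  then show "p * a \<in> gen_ideal m G"
    unfolding gen_ideal_def using p
    by (intro CollectI exI[of _ F] exI[of _ "\<lambda>g. p * c g"]) (auto simp: sum_distrib_left mult.assoc)
qed

lemma gen_ideal_base: "g \<in> G \<Longrightarrow> g \<in> gen_ideal m G"
  unfolding gen_ideal_def by (intro CollectI exI[of _ "{g}"] exI[of _ "\<lambda>_. 1"]) simp

lemma gen_ideal_least: "pideal m U \<Longrightarrow> G \<subseteq> U \<Longrightarrow> gen_ideal m G \<subseteq> U"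
  unfolding gen_ideal_def by (auto intro!: pideal_sum pideal_mult)

lemma gen_ideal_in_ring: "\<forall>g\<in>G. in_ring m g \<Longrightarrow> p \<in> gen_ideal m G \<Longrightarrow> in_ring m p"
  unfolding gen_ideal_def by (auto intro!: in_ring_sum in_ring_mult)

text \<open>\<open>gen_ideal\<close> sums over a set of generators, whereas presentations and
  resolutions index them, possibly with repetitions. Going through minimality of the generated ideal
  avoids reindexing.\<close>

lemma gen_ideal_image:
  "gen_ideal m (g ` {..<b::nat}) = {p. \<exists>v\<in>vecs m b. p = (\<Sum>j<b. v j * g j)}" (is "_ = ?R")
proof
  have "pideal m ?R"
    unfolding pideal_def
  proof (intro conjI ballI allI impI)
    show "0 \<in> ?R" using vsubD(2)[OF vsub_vecs] by (auto intro!: bexI[of _ 0])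
    fix a b' assume "a \<in> ?R" "b' \<in> ?R"
    then obtain v w where "v \<in> vecs m b" "w \<in> vecs m b" "a = (\<Sum>j<b. v j * g j)" "b' = (\<Sum>j<b. w j * g j)" by blast
    then show "a + b' \<in> ?R" using vsubD(3)[OF vsub_vecs, of v m b w]
      by (intro CollectI bexI[of _ "v + w"]) (auto simp: distrib_right sum.distrib)
  next
    fix c a :: "'a mpoly" assume c: "in_ring m c" and "a \<in> ?R"
    then obtain v where "v \<in> vecs m b" "a = (\<Sum>j<b. v j * g j)" by blast
    then show "c * a \<in> ?R" using vsubD(4)[OF vsub_vecs c, of v b]
      by (intro CollectI bexI[of _ "\<lambda>j. c * v j"]) (auto simp: sum_distrib_left mult.assoc)
  qed
  moreover have "g ` {..<b} \<subseteq> ?R"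
  proof safe
    fix j assume j: "j < b"
    let ?v = "\<lambda>i. if i = j then 1 else 0 :: 'a mpoly"
    have "?v \<in> vecs m b" using j by (simp add: vecs_def)
    moreover have "g j = (\<Sum>i<b. ?v i * g i)" using j by (simp add: if_distrib[of "\<lambda>x. x * _"] cong: if_cong)
    ultimately show "\<exists>v\<in>vecs m b. g j = (\<Sum>i<b. v i * g i)" by (intro bexI[of _ ?v])
  qed
  ultimately show "gen_ideal m (g ` {..<b}) \<subseteq> ?R" by (rule gen_ideal_least)
  show "?R \<subseteq> gen_ideal m (g ` {..<b})"
    by (auto simp: vecs_def intro!: pideal_sum[OF pideal_gen_ideal] pideal_mult[OF pideal_gen_ideal] intro: gen_ideal_base)
qed

section \<open>Ideals as graded submodules of a free module of rank one\<close>

definition vec1 :: "nat \<Rightarrow> 'a::comm_ring_1 mpoly set \<Rightarrow> (nat \<Rightarrow> 'a mpoly) set" where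
  "vec1 r J = {v \<in> vecs r 1. v 0 \<in> J}"

definition kvan1 :: "nat \<Rightarrow> 'a::comm_ring_1 mpoly set \<Rightarrow> nat \<Rightarrow> nat \<Rightarrow> bool" where
  "kvan1 r J i e \<longleftrightarrow> (\<forall>z. kchain r i (J \<inter> forms r (Suc e)) z \<longrightarrow> (\<forall>A. kd r Var z A = 0)
     \<longrightarrow> (\<exists>w. kchain r (Suc i) (J \<inter> forms r e) w \<and> (\<forall>A. kd r Var w A = z A)))"

lemma gpart_vec1: "v \<in> gpart (vec1 r J) e \<longleftrightarrow> v 0 \<in> J \<inter> forms r e \<and> (\<forall>j\<ge>1. v j = 0)"
  using gpart_vecs[of v r 1 e] by (auto simp: gpart_def vec1_def)

lemma kvan_vec1: "kvan r (vec1 r J) i e \<longleftrightarrow> kvan1 r J i e"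
proof -
  let ?up = "\<lambda>z (A :: nat set) j. if j = (0::nat) then z A else (0 :: 'a mpoly)"
  have up: "kchain r i (gpart (vec1 r J) e) (?up z) \<longleftrightarrow> kchain r i (J \<inter> forms r e) z" for i e z
    unfolding kchain_def gpart_vec1 by (auto simp: fun_eq_iff split: if_splits)
  have dn: "kchain r i (J \<inter> forms r e) (\<lambda>A. z A 0) \<and> z = ?up (\<lambda>A. z A 0)"
    if "kchain r i (gpart (vec1 r J) e) z" for i e and z :: "nat set \<Rightarrow> nat \<Rightarrow> 'a mpoly"
  proof -
    have "z A j = 0" if "j \<noteq> 0" for A j
    proof (cases "A \<subseteq> {..<r} \<and> card A = i")
      case True
      then have "z A \<in> gpart (vec1 r J) e"
        using \<open>kchain r i (gpart (vec1 r J) e) z\<close> by (simp add: kchainD)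
      then show ?thesis using \<open>j \<noteq> 0\<close> unfolding gpart_vec1 by (cases j) auto
    next
      case False
      then show ?thesis
        using kchain_out[OF \<open>kchain r i (gpart (vec1 r J) e) z\<close> False] by simp
    qed
    then have eq: "z = ?up (\<lambda>A. z A 0)" by (auto simp: fun_eq_iff)
    with that show ?thesis using up[of i e "\<lambda>A. z A 0"] by metis
  qed
  have vk: "vkd r (?up z) A = (\<lambda>j. if j = 0 then kd r Var z A else 0)" for z A
    by (auto simp: vkd_def fun_eq_iff)
  show ?thesis
  proof
    assume v: "kvan r (vec1 r J) i e"
    show "kvan1 r J i e"
      unfolding kvan1_def
    proof (intro allI impI)
      fix z assume z: "kchain r i (J \<inter> forms r (Suc e)) z" "\<forall>A. kd r Var z A = 0"
      have "\<forall>A. vkd r (?up z) A = 0" using z(2) by (simp add: vk fun_eq_iff)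
      with v up z(1) obtain w where w: "kchain r (Suc i) (gpart (vec1 r J) e) w" "\<And>A. vkd r w A = ?up z A"
        unfolding kvan_def by blast
      have "kd r Var (\<lambda>A. w A 0) A = z A" for A
        using fun_cong[OF w(2)[of A], of 0] by (simp add: vkd_def)
      then show "\<exists>w. kchain r (Suc i) (J \<inter> forms r e) w \<and> (\<forall>A. kd r Var w A = z A)"
        using dn[OF w(1)] by blast
    qed
  next
    assume v: "kvan1 r J i e"
    show "kvan r (vec1 r J) i e"
      unfolding kvan_def
    proof (intro allI impI)
      fix z assume z: "kchain r i (gpart (vec1 r J) (Suc e)) z" "\<forall>A. vkd r z A = 0"
      have "kd r Var (\<lambda>A. z A 0) A = 0" for A
        using z(2) fun_cong[of "vkd r z A" 0 0] unfolding vkd_def by simp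
      with dn[OF z(1)] v obtain w where w: "kchain r (Suc i) (J \<inter> forms r e) w" "\<And>A. kd r Var w A = z A 0"
        unfolding kvan1_def by blast
      have "vkd r (?up w) A = z A" for A
        using dn[OF z(1)] w(2) unfolding vk by metis
      then show "\<exists>w. kchain r (Suc i) (gpart (vec1 r J) e) w \<and> (\<forall>A. vkd r w A = z A)"
        using w(1) up by blast
    qed
  qed
qed

lemma linear_resolution_imp_kvan1:
  assumes "linear_resolution r D J" and e: "e \<ge> D"
  shows "kvan1 r J i e"
proof -
  from assms(1) obtain b :: "nat \<Rightarrow> nat" and g M where *: "\<forall>j<b 0. in_ring r (g j) \<and> homog D (g j)"
    and J: "J = gen_ideal r (g ` {..<b 0})"
    and **: "\<forall>t\<ge>1. \<forall>j<b (t - 1). \<forall>k<b t. in_ring r (M t j k) \<and> homog 1 (M t j k)"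
    and e0: "{v \<in> vecs r (b 0). (\<Sum>j<b 0. v j * g j) = 0} = mat_app (M 1) (b 1) (b 0) ` vecs r (b 1)"
    and ***: "\<forall>t\<ge>1. {v \<in> vecs r (b t). mat_app (M t) (b t) (b (t - 1)) v = (\<lambda>_. 0)}
                 = mat_app (M (t + 1)) (b (t + 1)) (b t) ` vecs r (b (t + 1))"
    unfolding linear_resolution_def by (elim exE conjE) (rule that)
  note g = *[rule_format] and M = **[rule_format] and ex = ***[rule_format]
  \<comment> \<open>The row of generators is prepended as a matrix into the free module of rank one,
    so that the resolution and its augmentation form one sequence, with entries of degree
    \<open>D\<close> at index 0 and degree 1 afterwards.\<close>
  define M' where "M' t = (if t = 0 then (\<lambda>j k. g k) else M t)" for t
  define b' where "b' t = (if t = 0 then 1 else b (t - 1))" for t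
  define \<delta> where "\<delta> t = (if t = 0 then D else 1 :: nat)" for t :: nat
  have m0: "mat_app (M' 0) (b' (Suc 0)) (b' 0) v = (\<lambda>j. if j = 0 then \<Sum>k<b 0. v k * g k else 0)" for v
    by (auto simp: mat_app_def M'_def b'_def fun_eq_iff mult.commute)
  have "kvan r (mat_app (M' 0) (b' (Suc 0)) (b' 0) ` vecs r (b' (Suc 0))) i e"
  proof (rule linear_resolution_vanish[where M=M' and b=b' and \<delta>=\<delta>])
    show "homat r (\<delta> t) (b' (Suc t)) (b' t) (M' t)" for t
      using g M[of t] by (cases t) (auto simp: homat_def \<delta>_def b'_def M'_def forms_def)
    show "{v \<in> vecs r (b' (Suc t)). mat_app (M' t) (b' (Suc t)) (b' t) v = 0}
        = mat_app (M' (Suc t)) (b' (Suc (Suc t))) (b' (Suc t)) ` vecs r (b' (Suc (Suc t)))" for t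
    proof (cases t)
      case 0
      then show ?thesis unfolding 0 m0 using e0 by (simp add: b'_def M'_def fun_eq_iff)
    next
      case (Suc s)
      then show ?thesis using ex[of t] by (simp add: b'_def M'_def zero_fun_def)
    qed
  qed (use e in \<open>auto simp: \<delta>_def\<close>)
  also have "mat_app (M' 0) (b' (Suc 0)) (b' 0) ` vecs r (b' (Suc 0)) = vec1 r J"
  proof -
    have "vec1 r J = {(\<lambda>j. if j = 0 then p else 0) | p. p \<in> J}"
    proof -
      have "in_ring r p" if "p \<in> J" for p
        using that g unfolding J by (elim gen_ideal_in_ring[rotated]) auto
      moreover have "v = (\<lambda>j. if j = 0 then v 0 else 0)" if "v \<in> vecs r 1" for v :: "nat \<Rightarrow> 'a mpoly"
        using that by (auto simp: vecs_def fun_eq_iff)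
      ultimately show ?thesis by (auto simp: vec1_def vecs_def)
    qed
    also have "\<dots> = mat_app (M' 0) (b' (Suc 0)) (b' 0) ` vecs r (b' (Suc 0))"
      unfolding image_cong[OF refl m0] J gen_ideal_image by (auto simp: b'_def)
    finally show ?thesis ..
  qed
  finally show ?thesis by (simp add: kvan_vec1)
qed

text \<open>\<open>linear_step\<close> is iterated on successive kernels. A state consists of target
  rank, source rank and matrix; the choice is dependent because each matrix has to cover the kernel
  of its predecessor.\<close>

lemma linear_resolution_if_kvan1:
  fixes J :: "'a::field mpoly set"
  assumes J: "pideal r J" "\<And>p. p \<in> J \<Longrightarrow> in_ring r p" "\<And>p e. p \<in> J \<Longrightarrow> hc e p \<in> J"
    and low: "\<And>p e. p \<in> J \<Longrightarrow> homog e p \<Longrightarrow> e < D \<Longrightarrow> p = 0"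
    and van: "\<And>i e. e \<ge> D \<Longrightarrow> kvan1 r J i e"
  shows "linear_resolution r D J"
proof -
  have Z: "vsub r 1 (vec1 r J)"
    using J unfolding vsub_def vec1_def by (auto simp: vecs_def pideal_def in_ring_part)
  define ker where "ker x = (case x of (c, b, M) \<Rightarrow> {v \<in> vecs r b. mat_app M b c v = (0 :: nat \<Rightarrow> 'a mpoly)})" for x
  define P where "P x \<longleftrightarrow> (case x of (c, b, M) \<Rightarrow> vsub r b (ker x) \<and> gpart (ker x) 0 \<subseteq> {0} \<and> (\<forall>i e. e \<ge> 1 \<longrightarrow> kvan r (ker x) i e))" for x
  define Q where "Q x y \<longleftrightarrow> (case x of (c, b, M) \<Rightarrow> case y of (c', b', M') \<Rightarrow> c' = b \<and> homat r 1 b' c' M'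
      \<and> ker x = mat_app M' b' c' ` vecs r b')" for x y
  have low': "gpart (vec1 r J) e \<subseteq> {0}" if "e < D" for e
  proof
    fix v assume "v \<in> gpart (vec1 r J) e"
    then have v: "v 0 \<in> J" "homog e (v 0)" "\<And>j. j \<ge> 1 \<Longrightarrow> v j = 0" by (auto simp: gpart_vec1 forms_def)
    then have "v j = 0" for j using low[OF v(1,2) that] by (cases j) auto
    then show "v \<in> {0}" by (auto simp: fun_eq_iff)
  qed
  obtain b0 M0 where M0: "homat r D b0 1 M0" "vec1 r J = mat_app M0 b0 1 ` vecs r b0"
    "vsub r b0 {v \<in> vecs r b0. mat_app M0 b0 1 v = 0}" "gpart {v \<in> vecs r b0. mat_app M0 b0 1 v = 0} 0 \<subseteq> {0}"
    "\<And>i e. e \<ge> 1 \<Longrightarrow> kvan r {v \<in> vecs r b0. mat_app M0 b0 1 v = 0} i e"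
    by (rule linear_step[OF Z low' van[folded kvan_vec1]]) (auto intro: that)
  have P0: "P (1, b0, M0)" unfolding P_def ker_def using M0(3-5) by simp
  have "\<exists>y. P y \<and> Q x y" if "P x" for x
  proof -
    obtain c b M where x: "x = (c, b, M)" by (cases x)
    from that have *: "vsub r b (ker x)" "\<And>e. e < 1 \<Longrightarrow> gpart (ker x) e \<subseteq> {0}" "\<And>i e. e \<ge> 1 \<Longrightarrow> kvan r (ker x) i e"
      unfolding P_def x by auto
    obtain b' M' where M': "homat r 1 b' b M'" "ker x = mat_app M' b' b ` vecs r b'"
      "vsub r b' {v \<in> vecs r b'. mat_app M' b' b v = 0}" "gpart {v \<in> vecs r b'. mat_app M' b' b v = 0} 0 \<subseteq> {0}"
      "\<And>i e. e \<ge> 1 \<Longrightarrow> kvan r {v \<in> vecs r b'. mat_app M' b' b v = 0} i e"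
      by (rule linear_step[OF *]) (auto intro: that)
    have "P (b, b', M')" unfolding P_def ker_def using M'(3-5) by simp
    with M'(1,2) show ?thesis by (intro exI[of _ "(b, b', M')"]) (auto simp: Q_def x)
  qed
  \<comment> \<open>The clause for index 0 pins the sequence to the chosen first matrix.\<close>
  then have step: "\<exists>y. (P y \<and> (Suc t = 0 \<longrightarrow> y = (1, b0, M0))) \<and> Q x y" if "P x \<and> (t = 0 \<longrightarrow> x = (1, b0, M0))" for x t
    using that by blast
  from dependent_nat_choice[of "\<lambda>n x. P x \<and> (n = 0 \<longrightarrow> x = (1, b0, M0))" "\<lambda>n. Q", OF _ step]
  obtain X where "\<forall>t. (P (X t) \<and> (t = 0 \<longrightarrow> X t = (1, b0, M0))) \<and> Q (X t) (X (Suc t))"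
    using P0 by blast
  then have X: "X 0 = (1, b0, M0)" "\<And>t. P (X t)" "\<And>t. Q (X t) (X (Suc t))" by auto
  define b where "b t = fst (snd (X t))" for t
  define M where "M t = snd (snd (X t))" for t
  have X': "X t = (if t = 0 then 1 else b (t - 1), b t, M t)" for t
  proof (cases t)
    case 0 then show ?thesis using X(1) by (simp add: b_def M_def)
  next
    case (Suc s)
    then show ?thesis using X(3)[of s] by (auto simp: Q_def b_def M_def split: prod.splits)
  qed
  have step: "homat r 1 (b (Suc t)) (b t) (M (Suc t))" "ker (X t) = mat_app (M (Suc t)) (b (Suc t)) (b t) ` vecs r (b (Suc t))" for t
    using X(3)[of t] unfolding Q_def X'[of "Suc t"] by (auto split: prod.splits)
  have bM0: "b 0 = b0" "M 0 = M0" using X(1) by (auto simp: b_def M_def)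
  have app0: "mat_app M0 b0 1 v = (\<lambda>j. if j = 0 then \<Sum>k<b0. v k * M0 0 k else 0)" for v
    by (auto simp: mat_app_def fun_eq_iff mult.commute)
  show ?thesis
    unfolding linear_resolution_def
  proof (intro exI[of _ b] exI[of _ "M0 0"] exI[of _ M] conjI allI impI ballI)
    show "in_ring r (M0 0 j)" "homog D (M0 0 j)" if "j < b 0" for j
      using M0(1) that bM0 by (auto simp: homat_def forms_def)
    have "p \<in> J \<longleftrightarrow> (\<exists>v\<in>vecs r b0. p = (\<Sum>j<b0. v j * M0 0 j))" for p
    proof -
      have "p \<in> J \<longleftrightarrow> (\<lambda>j. if j = 0 then p else 0) \<in> vec1 r J"
        using J(2) by (auto simp: vec1_def vecs_def)
      also have "\<dots> \<longleftrightarrow> (\<exists>v\<in>vecs r b0. p = (\<Sum>j<b0. v j * M0 0 j))"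
        unfolding M0(2) image_iff app0 by (auto simp: fun_eq_iff)
      finally show ?thesis .
    qed
    then show "J = gen_ideal r (M0 0 ` {..<b 0})" unfolding gen_ideal_image bM0 by blast
    show "in_ring r (M t j k)" "homog 1 (M t j k)" if "t \<ge> 1" "j < b (t - 1)" "k < b t" for t j k
      using step(1)[of "t - 1"] that by (auto simp: homat_def forms_def)
    show "{v \<in> vecs r (b 0). (\<Sum>j<b 0. v j * M0 0 j) = 0} = mat_app (M 1) (b 1) (b 0) ` vecs r (b 1)"
    proof -
      have "mat_app M0 b0 1 v = 0 \<longleftrightarrow> (\<Sum>j<b0. v j * M0 0 j) = 0" for v
        unfolding app0 by (auto simp: fun_eq_iff)
      then show ?thesis using step(2)[of 0] unfolding X'[of 0] ker_def bM0 by simp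
    qed
    show "{v \<in> vecs r (b t). mat_app (M t) (b t) (b (t - 1)) v = (\<lambda>_. 0)}
        = mat_app (M (t + 1)) (b (t + 1)) (b t) ` vecs r (b (t + 1))" if "t \<ge> 1" for t
      using step(2)[of t] that unfolding X'[of t] ker_def by (simp add: zero_fun_def)
  qed
qed

section \<open>Minors and radicals\<close>

lemma permutes_lessThan: "p permutes {..<n} \<Longrightarrow> i < n \<Longrightarrow> p i < n"
  using permutes_in_image[of p "{..<n}" i] by simp

lemma det_n_mat: "det_n n M = det (mat n n (\<lambda>(i, j). M i j))"
  unfolding det_n_def det_def by (auto simp: atLeast0LessThan permutes_lessThan intro!: sum.cong prod.cong)

lemma det_n_cong: "(\<And>i k. i < n \<Longrightarrow> k < n \<Longrightarrow> M i k = M' i k) \<Longrightarrow> det_n n M = det_n n M'"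
  unfolding det_n_mat by (intro arg_cong[of _ _ det] eq_matI) auto

lemma det_n_identical_rows:
  assumes "i < n" "j < n" "i \<noteq> j" "\<And>k. k < n \<Longrightarrow> M i k = M j k"
  shows "det_n n M = 0"
  unfolding det_n_mat
  by (rule det_identical_rows[of _ n i j]) (use assms in \<open>auto intro!: eq_vecI\<close>)

lemma det_n_identical_columns:
  assumes "i < n" "j < n" "i \<noteq> j" "\<And>k. k < n \<Longrightarrow> M k i = M k j"
  shows "det_n n M = 0"
  unfolding det_n_mat
  by (rule det_identical_columns[of _ n i j]) (use assms in \<open>auto intro!: eq_vecI\<close>)

lemma det_n_singular:
  fixes M :: "nat \<Rightarrow> nat \<Rightarrow> 'a::idom"
  assumes "\<And>i. i < n \<Longrightarrow> (\<Sum>k<n. M i k * v k) = 0" "l < n" "v l \<noteq> 0"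
  shows "det_n n M = 0"
proof -
  let ?A = "mat n n (\<lambda>(i, j). M i j)" and ?v = "vec n v"
  have "?v \<noteq> 0\<^sub>v n" using assms(2,3) by (metis index_vec index_zero_vec(1))
  moreover have "?A *\<^sub>v ?v = 0\<^sub>v n"
    using assms(1) by (intro eq_vecI) (auto simp: scalar_prod_def atLeast0LessThan)
  ultimately show ?thesis unfolding det_n_mat
    by (subst det_0_iff_vec_prod_zero[of _ n]) (auto intro!: exI[of _ ?v])
qed

lemma det_n_row_expand:
  "det_n (Suc c) (\<lambda>i k. if i = c then w k else M i k)
    = (\<Sum>p | p permutes {..<Suc c}. of_int (sign p) * w (p c) * (\<Prod>i<c. M i (p i)))"
  unfolding det_n_def by (rule sum.cong) (auto simp: mult_ac)

lemma det_n_last_row_sum: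
  "det_n (Suc c) (\<lambda>i k. if i = c then \<Sum>l\<in>X. x l * w l k else M i k)
    = (\<Sum>l\<in>X. x l * det_n (Suc c) (\<lambda>i k. if i = c then w l k else M i k))"
  unfolding det_n_row_expand sum_distrib_left sum_distrib_right
  by (subst sum.swap) (simp add: mult_ac)

lemma det_n_last_row_unit:
  "det_n (Suc c) (\<lambda>i k. if i = c then (if k = c then 1 else 0) else M i k) = det_n c M"
proof -
  have "det_n (Suc c) (\<lambda>i k. if i = c then (if k = c then 1 else 0) else M i k)
      = (\<Sum>p | p permutes {..<Suc c} \<and> p c = c. of_int (sign p) * (\<Prod>i<c. M i (p i)))"
    unfolding det_n_row_expand
    by (rule sum.mono_neutral_cong_right) (auto simp: finite_permutations)
  also have "{p. p permutes {..<Suc c} \<and> p c = c} = {p. p permutes {..<c}}"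
  proof (rule Collect_cong, rule iffI)
    fix p assume "p permutes {..<Suc c} \<and> p c = c"
    then show "p permutes {..<c}"
      using permutes_superset[of p "{..<Suc c}" "{..<c}"] by (auto simp: less_Suc_eq)
  next
    fix p assume "p permutes {..<c}"
    then show "p permutes {..<Suc c} \<and> p c = c"
      using permutes_subset[of p "{..<c}" "{..<Suc c}"] by (auto simp: permutes_not_in)
  qed
  finally show ?thesis by (simp add: det_n_def)
qed

lemma det_n_permute_columns:
  assumes \<tau>: "\<tau> permutes {..<n}"
  shows "det_n n (\<lambda>i k. M i (\<tau> k)) = of_int (sign \<tau>) * det_n n M"
proof -
  let ?P = "{p. p permutes {..<n}}"
  have "of_int (sign \<tau>) * det_n n M
      = (\<Sum>p\<in>?P. of_int (sign \<tau>) * (of_int (sign (\<tau> \<circ> p)) * (\<Prod>i<n. M i ((\<tau> \<circ> p) i))))"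
    unfolding det_n_def sum_distrib_left
    by (rule setum_permutations_compose_left[OF \<tau>])
  also have "\<dots> = (\<Sum>p\<in>?P. of_int (sign p) * (\<Prod>i<n. M i (\<tau> (p i))))"
  proof (rule sum.cong[OF refl])
    fix p assume p: "p \<in> ?P"
    have "sign (\<tau> \<circ> p) = sign \<tau> * sign p"
      by (rule sign_compose) (use \<tau> p in \<open>auto simp: permutation_permutes\<close>)
    then have "sign \<tau> * sign (\<tau> \<circ> p) = sign p" by (simp add: sign_def)
    then have "(of_int (sign \<tau>) * of_int (sign (\<tau> \<circ> p)) :: 'a) = of_int (sign p)" by (metis of_int_mult)
    then show "of_int (sign \<tau>) * (of_int (sign (\<tau> \<circ> p)) * (\<Prod>i<n. M i ((\<tau> \<circ> p) i)))
        = of_int (sign p) * (\<Prod>i<n. M i (\<tau> (p i)))" by (simp add: mult.assoc[symmetric])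
  qed
  finally show ?thesis by (simp add: det_n_def)
qed

lemma subst_of_int: "subst y (of_int k) = of_int k"
  using subst_Const[of y "of_int k"] by (simp add: Const_def)

lemma subst_det_n: "subst y (det_n n M) = det_n n (\<lambda>i k. subst y (M i k))"
  by (simp add: det_n_def subst_sum subst_mult subst_prod subst_of_int)

lemma in_ring_det_n: "(\<And>i k. i < n \<Longrightarrow> k < n \<Longrightarrow> in_ring r (M i k)) \<Longrightarrow> in_ring r (det_n n M)"
  unfolding det_n_def by (auto intro!: in_ring_sum in_ring_mult in_ring_prod simp: permutes_lessThan)

text \<open>The vector of signed maximal minors of the rows \<open>\<rho> 0, \<dots>, \<rho> (c - 1)\<close> and the columns
  \<open>\<tau> 0, \<dots>, \<tau> c\<close>, placed at the coordinates given by \<open>\<tau>\<close>.\<close>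
definition cram :: "nat \<Rightarrow> (nat \<Rightarrow> nat \<Rightarrow> 'a::comm_ring_1) \<Rightarrow> (nat \<Rightarrow> nat) \<Rightarrow> (nat \<Rightarrow> nat) \<Rightarrow> nat \<Rightarrow> 'a" where
  "cram c \<Theta> \<rho> \<tau> l = det_n (Suc c) (\<lambda>i k. if i = c then (if \<tau> k = l then 1 else 0) else \<Theta> (\<rho> i) (\<tau> k))"

lemma cram_sum:
  assumes "\<And>k. k \<le> c \<Longrightarrow> \<tau> k < n"
  shows "(\<Sum>l<n. x l * cram c \<Theta> \<rho> \<tau> l) = det_n (Suc c) (\<lambda>i k. if i = c then x (\<tau> k) else \<Theta> (\<rho> i) (\<tau> k))"
proof -
  have "(\<Sum>l<n. x l * cram c \<Theta> \<rho> \<tau> l)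
      = det_n (Suc c) (\<lambda>i k. if i = c then \<Sum>l<n. x l * (if \<tau> k = l then 1 else 0) else \<Theta> (\<rho> i) (\<tau> k))"
    unfolding cram_def by (rule det_n_last_row_sum[symmetric])
  also have "\<dots> = det_n (Suc c) (\<lambda>i k. if i = c then x (\<tau> k) else \<Theta> (\<rho> i) (\<tau> k))"
    by (rule det_n_cong) (use assms in \<open>auto simp: if_distrib[of "\<lambda>y. _ * y"] cong: if_cong\<close>)
  finally show ?thesis .
qed

text \<open>Pairing a row of \<Theta> with the vector appends that row to the minor. Hence the
  vector is annihilated by \<Theta> modulo the minors of size c + 1.\<close>

lemma cram_sum_row:
  assumes "\<And>k. k \<le> c \<Longrightarrow> \<tau> k < n"
  shows "(\<Sum>l<n. \<Theta> j l * cram c \<Theta> \<rho> \<tau> l) = det_n (Suc c) (\<lambda>i k. \<Theta> ((\<rho>(c := j)) i) (\<tau> k))"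
  by (subst cram_sum[OF assms]) (auto intro!: det_n_cong)

text \<open>The column \<open>\<tau> c\<close> and the unit row both come last, so the complementary
  minor appears without a sign.\<close>

lemma cram_last:
  assumes "l \<notin> \<tau> ` {..<c}" "\<tau> c = l"
  shows "cram c \<Theta> \<rho> \<tau> l = det_n c (\<lambda>i k. \<Theta> (\<rho> i) (\<tau> k))"
proof -
  have "cram c \<Theta> \<rho> \<tau> l = det_n (Suc c) (\<lambda>i k. if i = c then (if k = c then 1 else 0) else \<Theta> (\<rho> i) (\<tau> k))"
    unfolding cram_def
  proof (rule det_n_cong)
    fix i k assume "k < Suc c"
    then have "k \<noteq> c \<Longrightarrow> \<tau> k \<in> \<tau> ` {..<c}" by simp
    then have "\<tau> k = l \<longleftrightarrow> k = c" using assms by metis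
    then show "(if i = c then if \<tau> k = l then 1 else 0 else \<Theta> (\<rho> i) (\<tau> k))
        = (if i = c then if k = c then 1 else 0 else \<Theta> (\<rho> i) (\<tau> k))" by simp
  qed
  then show ?thesis by (simp add: det_n_last_row_unit)
qed

lemma cram_outside:
  assumes "l \<notin> \<tau> ` {..c}"
  shows "cram c \<Theta> \<rho> \<tau> l = 0"
  unfolding cram_def det_n_row_expand
proof (rule sum.neutral, rule)
  fix p assume "p \<in> {p. p permutes {..<Suc c}}"
  then have "p c < Suc c" using permutes_in_image[of p "{..<Suc c}" c] by simp
  then have "\<tau> (p c) \<noteq> l" using assms by auto
  then show "of_int (sign p) * (if \<tau> (p c) = l then 1 else 0) * (\<Prod>i<c. \<Theta> (\<rho> i) (\<tau> (p i))) = 0" by simp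
qed

lemma in_ring_cram:
  assumes "\<And>i k. i < c \<Longrightarrow> k \<le> c \<Longrightarrow> in_ring r (\<Theta> (\<rho> i) (\<tau> k))"
  shows "in_ring r (cram c \<Theta> \<rho> \<tau> l)"
  unfolding cram_def by (rule in_ring_det_n) (use assms in auto)

lemma pideal_radical:
  assumes U: "pideal m U" shows "pideal m (radical m U)"
  unfolding pideal_def
proof (intro conjI ballI allI impI)
  show "0 \<in> radical m U" using pideal_0[OF U] by (auto simp: radical_def intro: exI[of _ 1])
next
  fix p q assume "p \<in> radical m U" "q \<in> radical m U"
  then obtain s t where p: "in_ring m p" "p ^ s \<in> U" and q: "in_ring m q" "q ^ t \<in> U" by (auto simp: radical_def)
  have "(p + q) ^ (s + t) = (\<Sum>k\<le>s + t. of_nat ((s + t) choose k) * p ^ k * q ^ (s + t - k))"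
    by (rule binomial_ring)
  also have "\<dots> \<in> U"
  proof (rule pideal_sum[OF U])
    fix k assume "k \<in> {..s + t}"
    have n: "in_ring m (of_nat ((s + t) choose k) :: 'a mpoly)" using in_ring_of_int[of m "int ((s + t) choose k)"] by simp
    show "of_nat ((s + t) choose k) * p ^ k * q ^ (s + t - k) \<in> U"
    proof (cases "k \<ge> s")
      case True
      then have "p ^ k = p ^ s * p ^ (k - s)" by (simp flip: power_add)
      then have eq: "of_nat ((s + t) choose k) * p ^ k * q ^ (s + t - k)
          = (of_nat ((s + t) choose k) * p ^ (k - s) * q ^ (s + t - k)) * p ^ s"
        by (simp add: mult_ac)
      show ?thesis unfolding eq by (rule pideal_mult[OF U _ p(2)]) (simp add: n p q)
    next
      case False
      then have "s + t - k = (s - k) + t" by simp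
      then have eq: "of_nat ((s + t) choose k) * p ^ k * q ^ (s + t - k)
          = (of_nat ((s + t) choose k) * p ^ k * q ^ (s - k)) * q ^ t"
        by (simp add: mult_ac power_add)
      show ?thesis unfolding eq by (rule pideal_mult[OF U _ q(2)]) (simp add: n p q)
    qed
  qed
  finally show "p + q \<in> radical m U" using p q by (auto simp: radical_def)
next
  fix c p :: "'a mpoly" assume c: "in_ring m c" and "p \<in> radical m U"
  then obtain s where p: "in_ring m p" "p ^ s \<in> U" by (auto simp: radical_def)
  then have "(c * p) ^ s \<in> U" unfolding power_mult_distrib by (intro pideal_mult[OF U]) (simp add: c)
  then show "c * p \<in> radical m U" using p c by (auto simp: radical_def)
qed

lemma radical_powerD: "p ^ k \<in> radical m U \<Longrightarrow> in_ring m p \<Longrightarrow> p \<in> radical m U"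
  unfolding radical_def by (auto simp flip: power_mult)

section \<open>Linearly presented primary ideals\<close>

lemma Var_neq_0 [simp]: "Var i \<noteq> (0 :: 'a::comm_ring_1 mpoly)"
proof
  assume "Var i = (0 :: 'a mpoly)"
  then have "lkp (Var i :: 'a mpoly) (Poly_Mapping.single i 1) = 0" by simp
  then show False by (simp add: Var_def)
qed

lemma linear_form_expand:
  assumes p: "p \<in> forms n 1"
  shows "p = (\<Sum>l<n. Const (lkp p (Poly_Mapping.single l 1)) * Var l)"
proof (rule poly_mapping_eqI)
  fix m
  have *: "lkp (\<Sum>l<n. Const (lkp p (Poly_Mapping.single l 1)) * Var l) m
      = (\<Sum>l<n. if Poly_Mapping.single l 1 = m then lkp p m else 0)"
    by (auto simp: lookup_sum lookup_Const_mult Var_def lookup_single when_def intro!: sum.cong)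
  show "lkp p m = lkp (\<Sum>l<n. Const (lkp p (Poly_Mapping.single l 1)) * Var l) m"
  proof (cases "m \<in> kys p")
    case False
    then have "lkp p m = 0" by (simp add: in_keys_iff)
    then show ?thesis unfolding * by (simp cong: if_cong)
  next
    case True
    with p have m: "tdeg m = 1" "kys m \<subseteq> {..<n}" by (auto simp: forms_def homog_def in_ring_def)
    then have "m \<noteq> 0" by auto
    then obtain l where l: "l \<in> kys m" by fastforce
    have "(\<Sum>i\<in>kys m. lkp m i) = lkp m l + (\<Sum>i\<in>kys m - {l}. lkp m i)" using l by (simp add: sum.remove)
    moreover have "lkp m l > 0" using l by (simp add: in_keys_iff)
    ultimately have 1: "lkp m l = 1" "(\<Sum>i\<in>kys m - {l}. lkp m i) = 0" using m(1) unfolding tdeg_def by linarith+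
    have "m = Poly_Mapping.single l 1"
    proof (rule poly_mapping_eqI)
      fix i
      show "lkp m i = lkp (Poly_Mapping.single l 1) i"
        using 1 by (cases "i = l") (auto simp: lookup_single in_keys_iff)
    qed
    moreover have "l < n" using m l by auto
    moreover have "Poly_Mapping.single l' (1::nat) = Poly_Mapping.single l 1 \<longleftrightarrow> l' = l" for l'
      by (metis lookup_single_eq lookup_single_not_eq zero_neq_one)
    ultimately show ?thesis unfolding * by simp
  qed
qed

locale lin_pres_ideal =
  fixes n r d N :: nat and f :: "nat \<Rightarrow> 'k::field mpoly" and a :: "nat \<Rightarrow> nat \<Rightarrow> 'k mpoly"
  assumes n_pos: "n \<ge> 1"
    and f_S: "\<forall>i<r. in_ring n (f i)"
    and f_deg: "\<forall>i<r. homog d (f i)"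
    and lin_pres: "linearly_presented n r f"
    and m_primary: "primary_for n (max_ideal n) (gen_ideal n (f ` {..<r}))"
    and basis: "lin_syz_basis n r f N a"
begin

abbreviation I where "I \<equiv> gen_ideal n (f ` {..<r})"
abbreviation \<Theta> where "\<Theta> \<equiv> jac_dual r a"
abbreviation J where "J \<equiv> minors_ideal r N n \<Theta>"

lemma f_forms: "l < r \<Longrightarrow> f l \<in> forms n d"
  using f_S f_deg by (simp add: forms_def)

text \<open>One exponent for all variables, at least \<open>d\<close>, so that the coefficients
  expressing the power in the generators can be taken of degree P - d.\<close>

lemma ex_power_in_I: "\<exists>P\<ge>d. \<forall>l<n. Var l ^ P \<in> I"
proof -
  have "\<exists>t. Var l ^ t \<in> I" if "l < n" for l
  proof -
    have "Var l \<in> max_ideal n" unfolding max_ideal_def by (rule gen_ideal_base) (use that in auto)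
    then show ?thesis using m_primary by (auto simp: primary_for_def radical_def)
  qed
  then obtain t where t: "\<And>l. l < n \<Longrightarrow> Var l ^ t l \<in> I" by metis
  let ?P = "d + (\<Sum>l<n. t l)"
  have "Var l ^ ?P \<in> I" if l: "l < n" for l
  proof -
    have "t l \<le> (\<Sum>l<n. t l)" by (rule member_le_sum) (use l in auto)
    then have eq: "?P = (?P - t l) + t l" by simp
    show ?thesis
      by (subst eq, subst power_add) (intro pideal_mult[OF pideal_gen_ideal] t l in_ring_power in_ring_Var)
  qed
  then show ?thesis by (intro exI[of _ ?P]) auto
qed

definition P where "P = (SOME P. P \<ge> d \<and> (\<forall>l<n. Var l ^ P \<in> I))"

lemma P: "d \<le> P" "l < n \<Longrightarrow> Var l ^ P \<in> I"
  using someI_ex[OF ex_power_in_I] unfolding P_def by blast+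

lemma ex_g: "l < n \<Longrightarrow> \<exists>g. (\<forall>b<r. g b \<in> forms n (P - d)) \<and> Var l ^ P = (\<Sum>b<r. g b * f b)"
proof -
  assume l: "l < n"
  from P(2)[OF l] obtain v where v: "v \<in> vecs n r" "Var l ^ P = (\<Sum>b<r. v b * f b)"
    unfolding gen_ideal_image by blast
  have "Var l ^ P = hc ((P - d) + d) (\<Sum>b<r. v b * f b)"
    using P(1) hc_homog[OF homog_power[OF homog_Var[of l, where 'a='k], of P], of P] by (simp flip: v(2))
  also have "\<dots> = (\<Sum>b<r. hc (P - d) (v b) * f b)"
    unfolding part_sum by (rule sum.cong) (use f_deg in \<open>auto simp: hc_mult_homog\<close>)
  finally show ?thesis
    using vecs_in_ring[OF v(1)] by (intro exI[of _ "\<lambda>b. hc (P - d) (v b)"]) (auto intro: forms_hc)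
qed

definition g where "g l = (SOME g. (\<forall>b<r. g b \<in> forms n (P - d)) \<and> Var l ^ P = (\<Sum>b<r. g b * f b))"

lemma g_spec: "l < n \<Longrightarrow> (\<forall>b<r. g l b \<in> forms n (P - d)) \<and> Var l ^ P = (\<Sum>b<r. g l b * f b)"
  unfolding g_def by (rule someI_ex[OF ex_g])

lemma g: "l < n \<Longrightarrow> b < r \<Longrightarrow> g l b \<in> forms n (P - d)"
  using g_spec[THEN conjunct1] by simp

lemma gf: "l < n \<Longrightarrow> Var l ^ P = (\<Sum>b<r. g l b * f b)"
  by (rule g_spec[THEN conjunct2])

lemma r_pos: "r \<ge> 1"
proof (rule ccontr)
  assume "\<not> r \<ge> 1"
  then have "r = 0" by simp
  then have "Var 0 ^ P = (0 :: 'k mpoly)" using gf[of 0] n_pos by simp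
  then show False by simp
qed

lemma ex_f_nonzero: "\<exists>b<r. f b \<noteq> 0"
proof (rule ccontr)
  assume "\<not> (\<exists>b<r. f b \<noteq> 0)"
  then have "Var 0 ^ P = (0 :: 'k mpoly)" using gf[of 0] n_pos by simp
  then show False by simp
qed

text \<open>A nonzero form of degree 0 is a unit, contradicting that \<open>I\<close> is
  proper.\<close>

lemma d_pos: "d \<ge> 1"
proof (rule ccontr)
  assume "\<not> d \<ge> 1"
  then have "d = 0" by simp
  obtain b where b: "b < r" "f b \<noteq> 0" using ex_f_nonzero by blast
  have "homog 0 (f b)" using f_deg b \<open>d = 0\<close> by auto
  then have fb: "f b = Const (lkp (f b) 0)"
    by (intro poly_mapping_eqI) (auto simp: Const_def lookup_single when_def homog_def tdeg_eq_0_iff in_keys_iff)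
  then have "lkp (f b) 0 \<noteq> 0" using b(2) by auto
  then have "1 = Const (inverse (lkp (f b) 0)) * f b" by (subst fb) (simp flip: Const_mult)
  moreover have "Const (inverse (lkp (f b) 0)) * f b \<in> I"
    by (intro pideal_mult[OF pideal_gen_ideal] gen_ideal_base) (use b in auto)
  ultimately show False using m_primary by (simp add: primary_for_def)
qed

lemma syz_expand:
  assumes "s \<in> syz n r f"
  shows "\<exists>e. (\<forall>j<N. in_ring n (e j)) \<and> (\<forall>i. s i = (\<Sum>j<N. e j * a j i))"
proof -
  from lin_pres[unfolded linearly_presented_def, THEN bspec, OF assms] obtain F c where F: "finite F" "F \<subseteq> lin_syz n r f" "\<forall>\<alpha>\<in>F. in_ring n (c \<alpha>)"
    "s = (\<lambda>i. \<Sum>\<alpha>\<in>F. c \<alpha> * \<alpha> i)" by (elim exE conjE) (rule that)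
  have "\<forall>\<alpha>\<in>F. \<exists>x::nat \<Rightarrow> 'k. \<alpha> = (\<lambda>i. \<Sum>j<N. Const (x j) * a j i)"
    using basis[unfolded lin_syz_basis_def, THEN conjunct2, THEN conjunct2] F(2) by (meson subsetD)
  then obtain x :: "(nat \<Rightarrow> 'k mpoly) \<Rightarrow> nat \<Rightarrow> 'k" where
    x: "\<And>\<alpha>. \<alpha> \<in> F \<Longrightarrow> \<alpha> = (\<lambda>i. \<Sum>j<N. Const (x \<alpha> j) * a j i)" by metis
  have "s i = (\<Sum>j<N. (\<Sum>\<alpha>\<in>F. c \<alpha> * Const (x \<alpha> j)) * a j i)" for i
  proof -
    have "s i = (\<Sum>\<alpha>\<in>F. c \<alpha> * (\<Sum>j<N. Const (x \<alpha> j) * a j i))"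
      unfolding F(4) by (rule sum.cong[OF refl], subst (2) x) auto
    also have "\<dots> = (\<Sum>j<N. \<Sum>\<alpha>\<in>F. c \<alpha> * Const (x \<alpha> j) * a j i)"
      unfolding sum_distrib_left by (subst sum.swap) (simp add: mult.assoc)
    finally show ?thesis by (simp add: sum_distrib_right)
  qed
  moreover have "in_ring n (\<Sum>\<alpha>\<in>F. c \<alpha> * Const (x \<alpha> j))" for j using F(3) by auto
  ultimately show ?thesis by (intro exI[of _ "\<lambda>j. \<Sum>\<alpha>\<in>F. c \<alpha> * Const (x \<alpha> j)"]) blast
qed

lemma a_lin_syz: "j < N \<Longrightarrow> a j \<in> lin_syz n r f"
  using basis[unfolded lin_syz_basis_def, THEN conjunct1] by blast

lemma a_lin: "j < N \<Longrightarrow> i < r \<Longrightarrow> a j i \<in> forms n 1"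
  using a_lin_syz[of j] by (simp add: lin_syz_def syz_def forms_def)

lemma a_syz: "j < N \<Longrightarrow> (\<Sum>i<r. a j i * f i) = 0"
  using a_lin_syz[of j] by (simp add: lin_syz_def syz_def)

text \<open>The two groupings, by T_i and by y_l, of the bilinear form belonging to a linear syzygy.
  The target ring is arbitrary so that the identity is available for polynomials as well as along a
  line.\<close>

lemma row_eval:
  fixes h :: "'k \<Rightarrow> 'r::comm_ring_1" and y T :: "nat \<Rightarrow> 'r"
  assumes "coeff_hom h" "j < N"
  shows "(\<Sum>i<r. T i * peval h y (a j i))
    = (\<Sum>l<n. (\<Sum>i<r. h (lkp (a j i) (Poly_Mapping.single l 1)) * T i) * y l)"
proof -
  interpret h: coeff_hom h by fact
  have "(\<Sum>i<r. T i * peval h y (a j i))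
      = (\<Sum>i<r. T i * (\<Sum>l<n. h (lkp (a j i) (Poly_Mapping.single l 1)) * y l))"
  proof (rule sum.cong[OF refl])
    fix i assume "i \<in> {..<r}"
    then have "a j i \<in> forms n 1" using a_lin assms by simp
    then have "peval h y (a j i) = peval h y (\<Sum>l<n. Const (lkp (a j i) (Poly_Mapping.single l 1)) * Var l)"
      by (rule arg_cong[OF linear_form_expand])
    then show "T i * peval h y (a j i) = T i * (\<Sum>l<n. h (lkp (a j i) (Poly_Mapping.single l 1)) * y l)"
      by (simp add: h.peval_sum h.peval_mult)
  qed
  also have "\<dots> = (\<Sum>l<n. (\<Sum>i<r. h (lkp (a j i) (Poly_Mapping.single l 1)) * T i) * y l)"
    unfolding sum_distrib_left sum_distrib_right by (subst sum.swap) (simp add: mult_ac)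
  finally show ?thesis .
qed

text \<open>The Koszul syzygy of two generators is a combination of the linear ones. Evaluating this
  at \<open>T\<close> and \<open>y\<close> measures the failure of T and f(y) to be proportional by
  the entries of \<Theta>(T) y; this is how linear presentation enters.\<close>

lemma koszul_relation:
  fixes h :: "'k \<Rightarrow> 'r::comm_ring_1" and y T :: "nat \<Rightarrow> 'r"
  assumes h: "coeff_hom h" and b: "b1 < r" "b2 < r"
  shows "\<exists>e. (\<forall>j<N. in_ring n (e j)) \<and> T b1 * peval h y (f b2) - T b2 * peval h y (f b1)
    = (\<Sum>j<N. peval h y (e j) * (\<Sum>l<n. (\<Sum>i<r. h (lkp (a j i) (Poly_Mapping.single l 1)) * T i) * y l))"
proof (cases "b1 = b2")
  case True
  interpret h: coeff_hom h by fact
  show ?thesis using True by (intro exI[of _ "\<lambda>_. 0"]) simp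
next
  case False
  interpret h: coeff_hom h by fact
  define s where "s i = (if i = b1 then f b2 else 0) - (if i = b2 then f b1 else 0)" for i
  have sum: "(\<Sum>i<r. s i * w i) = f b2 * w b1 - f b1 * w b2" for w
    using b by (simp add: s_def left_diff_distrib sum_subtractf if_distrib[of "\<lambda>x. x * _"] cong: if_cong)
  have "s \<in> syz n r f" using b f_S sum[of f] by (auto simp: syz_def s_def mult.commute)
  from syz_expand[OF this] obtain e where e: "\<forall>j<N. in_ring n (e j)" "\<And>i. s i = (\<Sum>j<N. e j * a j i)" by blast
  have "T b1 * peval h y (f b2) - T b2 * peval h y (f b1) = (\<Sum>i<r. T i * peval h y (s i))"
    using b by (simp add: s_def h.peval_diff right_diff_distrib sum_subtractf if_distrib[of "\<lambda>x. _ * peval h y x"] cong: if_cong)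
  also have "\<dots> = (\<Sum>i<r. \<Sum>j<N. peval h y (e j) * (T i * peval h y (a j i)))"
    by (simp add: e(2) h.peval_sum h.peval_mult sum_distrib_left mult_ac)
  also have "\<dots> = (\<Sum>j<N. peval h y (e j) * (\<Sum>i<r. T i * peval h y (a j i)))"
    by (subst sum.swap) (simp add: sum_distrib_left)
  also have "\<dots> = (\<Sum>j<N. peval h y (e j) * (\<Sum>l<n. (\<Sum>i<r. h (lkp (a j i) (Poly_Mapping.single l 1)) * T i) * y l))"
    by (rule sum.cong) (auto simp: row_eval[OF h])
  finally show ?thesis using e(1) by blast
qed

lemma theta_forms: "\<Theta> j l \<in> forms r 1"
  unfolding jac_dual_def
proof (rule forms_sum)
  fix i assume "i \<in> {..<r}"
  then show "Const (lkp (a j i) (Poly_Mapping.single l 1)) * Var i \<in> forms r 1"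
    using forms_mult[OF forms_Const forms_Var, of i r] by simp
qed

lemma theta_in_ring: "in_ring r (\<Theta> j l)"
  using theta_forms by (simp add: forms_def)

text \<open>At T = f the bilinear form turns back into the syzygy it came from.\<close>

lemma theta_subst_f: "j < N \<Longrightarrow> (\<Sum>l<n. subst f (\<Theta> j l) * Var l) = 0"
proof -
  assume j: "j < N"
  have "(\<Sum>l<n. subst f (\<Theta> j l) * Var l)
      = (\<Sum>l<n. (\<Sum>i<r. Const (lkp (a j i) (Poly_Mapping.single l 1)) * f i) * Var l)"
    by (simp add: jac_dual_def subst_sum subst_mult)
  also have "\<dots> = (\<Sum>i<r. f i * peval Const Var (a j i))" using row_eval[OF Const.coeff_hom_axioms j] by simp
  also have "\<dots> = 0" using a_syz[OF j] by (simp add: subst_Var_id mult.commute flip: subst_peval)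
  finally show ?thesis .
qed

text \<open>Rows and columns may repeat or be out of order; this adds only zeros and signed copies
  of minors, and makes appending a row free of side conditions.\<close>

definition Ic :: "nat \<Rightarrow> 'k mpoly set" where
  "Ic c = gen_ideal r {det_n c (\<lambda>i k. \<Theta> (\<rho> i) (\<sigma> k)) | \<rho> \<sigma>. (\<forall>i<c. \<rho> i < N) \<and> (\<forall>k<c. \<sigma> k < n)}"

lemma Ic_minor: "(\<And>i. i < c \<Longrightarrow> \<rho> i < N) \<Longrightarrow> (\<And>k. k < c \<Longrightarrow> \<sigma> k < n) \<Longrightarrow> det_n c (\<lambda>i k. \<Theta> (\<rho> i) (\<sigma> k)) \<in> Ic c"
  unfolding Ic_def by (rule gen_ideal_base) blast

lemma Ic_pideal: "pideal r (Ic c)" unfolding Ic_def by (rule pideal_gen_ideal)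

end

section \<open>The minors of the Jacobian dual\<close>

interpretation pc: coeff_hom "\<lambda>c. [:Const c:]"
  by unfold_locales (auto simp: Const_add Const_mult one_pCons)

lemma sum_const_poly: "(\<Sum>x\<in>X. [:u x:]) = [:\<Sum>x\<in>X. u x:]"
  by (induction X rule: infinite_finite_induct) auto

lemma degree_peval_le:
  assumes "\<And>c. degree (h c) = 0" "\<And>l. degree (y l) \<le> 1" "homog e q"
  shows "degree (peval h y q) \<le> e"
  unfolding peval_def
proof (rule degree_sum_le)
  fix m assume m: "m \<in> kys q"
  have "degree (mono_eval y m) \<le> (\<Sum>i\<in>kys m. degree (y i ^ lkp m i))"
    unfolding mono_eval_def using degree_prod_sum_le[of "kys m" "\<lambda>i. y i ^ lkp m i"] by (simp add: o_def)
  also have "\<dots> \<le> (\<Sum>i\<in>kys m. lkp m i)"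
  proof (rule sum_mono)
    fix i
    have "degree (y i ^ lkp m i) \<le> degree (y i) * lkp m i" by (rule degree_power_le)
    also have "\<dots> \<le> lkp m i" using assms(2)[of i] by (cases "degree (y i)") auto
    finally show "degree (y i ^ lkp m i) \<le> lkp m i" .
  qed
  also have "\<dots> = e" using assms(3) m by (auto simp: homog_def tdeg_def)
  finally show "degree (h (lkp q m) * mono_eval y m) \<le> e"
    using degree_mult_le[of "h (lkp q m)" "mono_eval y m"] assms(1) by simp
qed simp

context lin_pres_ideal
begin

text \<open>A common solution space of dimension two of the equations \<open>\<Theta> y = 0\<close> would give a line
  \<open>y = v + t w\<close> on which all \<open>f b\<close> are proportional; but powers of the two coprime linear
  forms \<open>y\<^sub>l = \<delta>\<close> and \<open>y\<^sub>l\<^sub>' = t \<delta>\<close> are combinations of the \<open>f b\<close>.\<close>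
lemma minor_step:
  assumes c: "Suc c < n" and \<rho>: "\<And>i. i < c \<Longrightarrow> \<rho> i < N" and \<sigma>: "\<And>k. k < c \<Longrightarrow> \<sigma> k < n" and b: "b < r"
  defines "\<delta> \<equiv> det_n c (\<lambda>i k. \<Theta> (\<rho> i) (\<sigma> k))"
  shows "(Var b * \<delta> ^ P) * (Var b * \<delta> ^ P) \<in> Ic (Suc c)"
proof -
  let ?I = "Ic (Suc c)"
  have "card (\<sigma> ` {..<c}) \<le> c" using card_image_le[of "{..<c}" \<sigma>] by simp
  then have "card ({..<n} - \<sigma> ` {..<c}) \<ge> 2"
    using diff_card_le_card_Diff[of "\<sigma> ` {..<c}" "{..<n}"] c by simp
  \<comment> \<open>As c + 1 < n, two columns are free. They give two Cramer vectors whose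
    coordinates at l and l' are (\<delta>, 0) and (0, \<delta>), hence a line rather than a
    point.\<close>
  then obtain l l' where l: "l < n" "l \<notin> \<sigma> ` {..<c}" and l': "l' < n" "l' \<notin> \<sigma> ` {..<c}" and ll: "l \<noteq> l'"
    by (auto simp: card_le_Suc_iff numeral_2_eq_2)
  define v where "v = cram c \<Theta> \<rho> (\<sigma>(c := l))"
  define w where "w = cram c \<Theta> \<rho> (\<sigma>(c := l'))"
  have im: "(\<sigma>(c := m)) ` {..<c} = \<sigma> ` {..<c}" "(\<sigma>(c := m)) ` {..c} = insert m (\<sigma> ` {..<c})" for m
    by (auto simp: le_less image_iff)
  have \<delta>: "det_n c (\<lambda>i k. \<Theta> (\<rho> i) ((\<sigma>(c := m)) k)) = \<delta>" for m
    unfolding \<delta>_def by (rule det_n_cong) auto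
  have vl: "v l = \<delta>" "w l' = \<delta>" unfolding v_def w_def
    using cram_last[of l "\<sigma>(c := l)" c \<Theta> \<rho>] cram_last[of l' "\<sigma>(c := l')" c \<Theta> \<rho>] l l'
    by (simp_all add: im \<delta> fun_upd_same del: fun_upd_apply)
  have vl': "v l' = 0" "w l = 0" unfolding v_def w_def
    using cram_outside[of l' "\<sigma>(c := l)" c \<Theta> \<rho>] cram_outside[of l "\<sigma>(c := l')" c \<Theta> \<rho>] l l' ll
    unfolding im by simp_all
  have ring: "in_ring r (v m)" "in_ring r (w m)" for m
    unfolding v_def w_def by (intro in_ring_cram theta_in_ring)+
  have \<Theta>v: "(\<Sum>m<n. \<Theta> j m * v m) \<in> ?I" "(\<Sum>m<n. \<Theta> j m * w m) \<in> ?I" if "j < N" for j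
  proof -
    have "(\<Sum>m<n. \<Theta> j m * cram c \<Theta> \<rho> (\<sigma>(c := m')) m) \<in> ?I" if "m' < n" for m'
    proof -
      have *: "(\<sigma>(c := m')) k < n" if "k \<le> c" for k using \<sigma> that \<open>m' < n\<close> by auto
      show ?thesis
        by (subst cram_sum_row[OF *], assumption, rule Ic_minor) (use \<rho> * \<open>j < N\<close> in auto)
    qed
    then show "(\<Sum>m<n. \<Theta> j m * v m) \<in> ?I" "(\<Sum>m<n. \<Theta> j m * w m) \<in> ?I"
      unfolding v_def w_def using l l' by auto
  qed
  \<comment> \<open>\<open>U\<close> extends the ideal of (c+1)-minors to polynomials in the line
    parameter t, and \<open>C\<close> is the coefficient ring with t adjoined.\<close>
  define U where "U = {p :: 'k mpoly poly. \<forall>k. coeff p k \<in> ?I}"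
  define C where "C = {p :: 'k mpoly poly. \<forall>k. in_ring r (coeff p k)}"
  note Ip = Ic_pideal[of "Suc c"]
  have U_add: "p + q \<in> U" if "p \<in> U" "q \<in> U" for p q using that pideal_add[OF Ip] by (simp add: U_def)
  have U_diff: "p - q \<in> U" if "p \<in> U" "q \<in> U" for p q using that pideal_diff[OF Ip] by (simp add: U_def)
  have U_mult: "p * q \<in> U" if "p \<in> C" "q \<in> U" for p q
    using that by (auto simp: U_def C_def coeff_mult intro!: pideal_sum[OF Ip] pideal_mult[OF Ip])
  have U_sum: "sum g X \<in> U" if "\<And>x. x \<in> X \<Longrightarrow> g x \<in> U" for X :: "nat set" and g
    using that by (auto simp: U_def coeff_sum intro!: pideal_sum[OF Ip])
  have C_const: "[:q:] \<in> C" if "in_ring r q" for q using that by (auto simp: C_def coeff_pCons split: nat.splits)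
  have C_mult: "p * q \<in> C" if "p \<in> C" "q \<in> C" for p q using that by (auto simp: C_def coeff_mult)
  have C_sum: "sum g X \<in> C" if "\<And>x. x \<in> X \<Longrightarrow> g x \<in> C" for X :: "nat set" and g
    using that by (auto simp: C_def coeff_sum)
  let ?h = "\<lambda>c. [:Const c:] :: 'k mpoly poly"
  define y where "y m = [:v m, w m:]" for m
  define T where "T i = [:Var i :: 'k mpoly:]" for i
  define F where "F b = peval ?h y (f b)" for b
  have y_C: "y m \<in> C" for m using ring by (auto simp: C_def y_def coeff_pCons split: nat.splits)
  have T_C: "T i \<in> C" if "i < r" for i unfolding T_def by (rule C_const) (simp add: that)
  have ev_C: "peval ?h y q \<in> C" if "in_ring n q" for q
    by (rule pc.peval_closed[OF _ _ _ _ _ that])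
      (auto simp: y_C C_mult C_const, auto simp: C_def one_pCons coeff_pCons split: nat.splits)
  have F_C: "F b \<in> C" if "b < r" for b unfolding F_def by (rule ev_C) (use f_S that in auto)
  have row: "(\<Sum>m<n. (\<Sum>i<r. ?h (lkp (a j i) (Poly_Mapping.single m 1)) * T i) * y m) \<in> U" if "j < N" for j
  proof -
    have "(\<Sum>i<r. ?h (lkp (a j i) (Poly_Mapping.single m 1)) * T i) = [:\<Theta> j m:]" for m
      by (simp add: T_def jac_dual_def sum_const_poly mult.commute)
    then have eq: "(\<Sum>m<n. (\<Sum>i<r. ?h (lkp (a j i) (Poly_Mapping.single m 1)) * T i) * y m)
        = (\<Sum>m<n. [:\<Theta> j m * v m, \<Theta> j m * w m:])" by (simp add: y_def mult.commute)
    have "coeff (\<Sum>m<n. [:\<Theta> j m * v m, \<Theta> j m * w m:]) k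
        = (if k = 0 then \<Sum>m<n. \<Theta> j m * v m else if k = 1 then \<Sum>m<n. \<Theta> j m * w m else 0)" for k
      unfolding coeff_sum by (cases k; cases "k - 1") auto
    then show ?thesis unfolding eq using \<Theta>v[OF that] pideal_0[OF Ip] by (simp add: U_def)
  qed
  have rel: "T b1 * F b2 - T b2 * F b1 \<in> U" if bb: "b1 < r" "b2 < r" for b1 b2
  proof -
    from koszul_relation[OF pc.coeff_hom_axioms bb, of T y] obtain e where e: "\<forall>j<N. in_ring n (e j)"
      "T b1 * F b2 - T b2 * F b1
        = (\<Sum>j<N. peval ?h y (e j) * (\<Sum>m<n. (\<Sum>i<r. ?h (lkp (a j i) (Poly_Mapping.single m 1)) * T i) * y m))"
      unfolding F_def by blast
    show ?thesis unfolding e(2) by (intro U_sum U_mult ev_C row) (use e(1) in auto)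
  qed
  \<comment> \<open>In the expression of x_m^P through the generators, evaluated on the line, the
    values of f are replaced by T. By proportionality, T_b y_m^P is then congruent to F_b
    G_m.\<close>
  define G where "G m = (\<Sum>b'<r. peval ?h y (g m b') * T b')" for m
  have G_C: "G m \<in> C" if "m < n" for m
    unfolding G_def by (intro C_sum C_mult ev_C T_C) (use g[OF that] in \<open>auto simp: forms_def\<close>)
  have pow: "T b * y m ^ P - F b * G m \<in> U" if m: "m < n" for m
  proof -
    have "y m ^ P = peval ?h y (Var m ^ P)" by (simp add: pc.peval_power)
    also have "\<dots> = (\<Sum>b'<r. peval ?h y (g m b') * F b')"
      unfolding gf[OF m] F_def by (simp add: pc.peval_sum pc.peval_mult)
    finally have "T b * y m ^ P - F b * G m = (\<Sum>b'<r. peval ?h y (g m b') * (T b * F b' - T b' * F b))"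
      by (simp add: G_def sum_distrib_left algebra_simps sum_subtractf)
    also have "\<dots> \<in> U"
      by (rule U_sum, rule U_mult) (use g[OF m] b in \<open>auto simp: forms_def intro!: ev_C rel\<close>)
    finally show ?thesis .
  qed
  define u where "u = Var b * \<delta> ^ P"
  define X where "X = (monom 1 P :: 'k mpoly poly)"
  have X: "X = [:0, 1:] ^ P" by (simp add: X_def monom_altdef)
  have yl: "T b * y l ^ P = [:u:]" by (simp add: T_def y_def vl vl' u_def poly_const_pow)
  have "y l' = [:\<delta>:] * [:0, 1:]" by (simp add: y_def vl vl')
  then have yl': "T b * y l' ^ P = [:u:] * X"
    unfolding X by (simp only: power_mult_distrib) (simp add: T_def u_def poly_const_pow mult.commute)
  have E1: "[:u:] - F b * G l \<in> U" and E2: "[:u:] * X - F b * G l' \<in> U"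
    using pow[OF l(1)] pow[OF l'(1)] by (simp_all only: yl yl')
  \<comment> \<open>Cross multiplication eliminates F_b and leaves u G_l' congruent to u G_l
    t^P.\<close>
  have "G l' * ([:u:] - F b * G l) - G l * ([:u:] * X - F b * G l') \<in> U"
    by (intro U_diff U_mult G_C l l' E1 E2)
  then have E3: "[:u:] * G l' - [:u:] * G l * X \<in> U" by (simp add: algebra_simps)
  \<comment> \<open>G_l' has degree at most P - d, and d is positive. Below t^P the multiple of t^P
    contributes no coefficient, so every coefficient of u G_l' lies in the ideal; reinserting this
    in the second congruence gives u^2.\<close>
  have degG: "degree (G l') < P"
  proof -
    have "degree (G l') \<le> P - d"
      unfolding G_def
    proof (rule degree_sum_le)
      fix b' assume "b' \<in> {..<r}"
      then have "degree (peval ?h y (g l' b')) \<le> P - d"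
        by (intro degree_peval_le) (use g[OF l'(1)] in \<open>auto simp: forms_def y_def\<close>)
      then show "degree (peval ?h y (g l' b') * T b') \<le> P - d"
        using degree_mult_le[of "peval ?h y (g l' b')" "T b'"] by (simp add: T_def)
    qed simp
    then show ?thesis using d_pos P(1) by linarith
  qed
  have E4: "[:u:] * G l' \<in> U"
    unfolding U_def
  proof (intro CollectI allI)
    fix k
    show "coeff ([:u:] * G l') k \<in> ?I"
    proof (cases "k < P")
      case True
      have z: "coeff ([:u:] * G l * X) k = 0"
        using True coeff_monom_mult[of 1 P "[:u:] * G l" k] by (simp add: X_def mult.commute)
      have "coeff ([:u:] * G l' - [:u:] * G l * X) k \<in> ?I" using E3 unfolding U_def by blast
      then show ?thesis by (simp only: coeff_diff z diff_zero)
    next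
      case False
      then have "coeff ([:u:] * G l') k = 0" using degG by (simp add: coeff_eq_0)
      then show ?thesis using pideal_0[OF Ip] by (simp only:)
    qed
  qed
  have u_ring: "in_ring r u"
    unfolding u_def \<delta>_def using b by (intro in_ring_mult in_ring_power in_ring_det_n theta_in_ring) auto
  have "[:u:] * ([:u:] * X - F b * G l') + F b * ([:u:] * G l') \<in> U"
    by (intro U_add U_mult C_const u_ring E2 E4 F_C b)
  then have "[:u * u:] * X \<in> U" by (simp add: algebra_simps)
  then have "coeff ([:u * u:] * X) P \<in> ?I" by (simp add: U_def)
  then show ?thesis by (simp add: X_def u_def)
qed

text \<open>Induction on \<open>c\<close> from the unit ideal of 0-minors: \<open>minor_step\<close>
  puts T_b times every c-minor into the next radical, and some power of T_b is a combination of
  c-minors.\<close>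

lemma Var_in_radical_Ic: "c < n \<Longrightarrow> b < r \<Longrightarrow> Var b \<in> radical r (Ic c)"
proof (induction c)
  case 0
  have "1 \<in> Ic 0" using Ic_minor[of 0] by (simp add: det_n_def)
  then show ?case unfolding radical_def using 0 by (auto intro!: exI[of _ 0])
next
  case (Suc c)
  let ?R = "radical r (Ic (Suc c))"
  have R: "pideal r ?R" by (rule pideal_radical[OF Ic_pideal])
  have "{q. in_ring r q \<and> Var b * q \<in> ?R} \<supseteq> Ic c"
    unfolding Ic_def[of c]
  proof (rule gen_ideal_least)
    show "pideal r {q. in_ring r q \<and> Var b * q \<in> ?R}"
      using R by (auto simp: pideal_def distrib_left mult.left_commute)
    show "{det_n c (\<lambda>i k. \<Theta> (\<rho> i) (\<sigma> k)) |\<rho> \<sigma>. (\<forall>i<c. \<rho> i < N) \<and> (\<forall>k<c. \<sigma> k < n)}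
        \<subseteq> {q. in_ring r q \<and> Var b * q \<in> ?R}"
    proof safe
      fix \<rho> \<sigma> :: "nat \<Rightarrow> nat" assume *: "\<forall>i<c. \<rho> i < N" "\<forall>k<c. \<sigma> k < n"
      let ?\<delta> = "det_n c (\<lambda>i k. \<Theta> (\<rho> i) (\<sigma> k))"
      show ring: "in_ring r ?\<delta>" by (intro in_ring_det_n theta_in_ring)
      have "(Var b * ?\<delta> ^ P) * (Var b * ?\<delta> ^ P) \<in> Ic (Suc c)"
        by (rule minor_step) (use * Suc.prems in auto)
      \<comment> \<open>Raising the exponent of T_b from 2 to 2 P turns the product into a power of
        T_b \<delta>.\<close>
      then have "Var b ^ (2 * P - 2) * ((Var b * ?\<delta> ^ P) * (Var b * ?\<delta> ^ P)) \<in> Ic (Suc c)"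
        by (rule pideal_mult[OF Ic_pideal, rotated]) (simp add: Suc.prems)
      also have "Var b ^ (2 * P - 2) * ((Var b * ?\<delta> ^ P) * (Var b * ?\<delta> ^ P)) = (Var b * ?\<delta>) ^ (2 * P)"
      proof -
        have "2 * P = (2 * P - 2) + 2" using d_pos P(1) by simp
        then have "Var b ^ (2 * P) = Var b ^ (2 * P - 2) * Var b * (Var b :: 'k mpoly)"
          by (metis mult.assoc power2_eq_square power_add)
        moreover have "?\<delta> ^ (2 * P) = ?\<delta> ^ P * ?\<delta> ^ P" by (simp add: mult_2 power_add)
        ultimately show ?thesis by (simp add: power_mult_distrib mult_ac)
      qed
      finally show "Var b * ?\<delta> \<in> ?R" unfolding radical_def using ring Suc.prems by auto
    qed
  qed
  moreover obtain t where "Var b ^ t \<in> Ic c" using Suc by (auto simp: radical_def)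
  ultimately have "Var b * Var b ^ t \<in> ?R" by auto
  then have "Var b ^ Suc t \<in> ?R" by simp
  then show ?case by (rule radical_powerD) (use Suc.prems in simp)
qed

text \<open>The signed maximal minors of n - 1 rows of \<Theta>, spanning the kernel of these rows
  over the fraction field whenever they are independent; they play the role of an inverse to the map
  given by f.\<close>

definition \<Delta> :: "(nat \<Rightarrow> nat) \<Rightarrow> nat \<Rightarrow> 'k mpoly" where
  "\<Delta> \<rho> = cram (n - 1) \<Theta> \<rho> (\<lambda>k. k)"

lemma \<Delta>_in_ring: "in_ring r (\<Delta> \<rho> l)"
  unfolding \<Delta>_def by (intro in_ring_cram theta_in_ring)

text \<open>Distinct columns omit a single index. Appending it in the last place makes the column
  selection a permutation, whose sign is the constant; repeated columns give 0.\<close>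

lemma minor_eq_\<Delta>:
  assumes \<sigma>: "\<And>k. k < n - 1 \<Longrightarrow> \<sigma> k < n"
  shows "\<exists>c l. l < n \<and> det_n (n - 1) (\<lambda>i k. \<Theta> (\<rho> i) (\<sigma> k)) = of_int c * \<Delta> \<rho> l"
proof (cases "inj_on \<sigma> {..<n - 1}")
  case False
  then obtain i j where "i < n - 1" "j < n - 1" "i \<noteq> j" "\<sigma> i = \<sigma> j" by (auto simp: inj_on_def)
  then have "det_n (n - 1) (\<lambda>i k. \<Theta> (\<rho> i) (\<sigma> k)) = 0" by (intro det_n_identical_columns[of i _ j]) auto
  then show ?thesis using n_pos by (intro exI[of _ 0] exI[of _ 0]) simp
next
  case True
  have "card (\<sigma> ` {..<n - 1}) = n - 1" using card_image[OF True] by simp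
  then have "\<not> {..<n} \<subseteq> \<sigma> ` {..<n - 1}" using card_mono[of "\<sigma> ` {..<n - 1}" "{..<n}"] n_pos by auto
  then obtain l where l: "l < n" "l \<notin> \<sigma> ` {..<n - 1}" by auto
  define \<tau> where "\<tau> k = (if k < n - 1 then \<sigma> k else if k = n - 1 then l else k)" for k
  have inj: "inj_on \<tau> {..<n}"
    unfolding inj_on_def
  proof (intro ballI impI)
    fix i j assume "i \<in> {..<n}" "j \<in> {..<n}" "\<tau> i = \<tau> j"
    moreover have "k = n - 1" if "k < n" "\<not> k < n - 1" for k using that by simp
    ultimately show "i = j" using True l unfolding \<tau>_def
      by (cases "i < n - 1"; cases "j < n - 1") (auto simp: inj_on_def image_iff)
  qed
  moreover have "\<tau> ` {..<n} \<subseteq> {..<n}" using \<sigma> l by (auto simp: \<tau>_def)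
  ultimately have "bij_betw \<tau> {..<n} {..<n}" by (simp add: bij_betw_def endo_inj_surj)
  then have perm: "\<tau> permutes {..<n}" by (rule bij_imp_permutes) (use n_pos in \<open>auto simp: \<tau>_def\<close>)
  have im: "\<tau> ` {..<n - 1} = \<sigma> ` {..<n - 1}" by (auto simp: \<tau>_def)
  have n1: "Suc (n - 1) = n" using n_pos by simp
  have "det_n (n - 1) (\<lambda>i k. \<Theta> (\<rho> i) (\<sigma> k)) = det_n (n - 1) (\<lambda>i k. \<Theta> (\<rho> i) (\<tau> k))"
    by (rule det_n_cong) (simp add: \<tau>_def)
  also have "\<dots> = cram (n - 1) \<Theta> \<rho> \<tau> l" 
  proof (rule cram_last[symmetric])
    show "l \<notin> \<tau> ` {..<n - 1}" unfolding im by (rule l(2))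
    show "\<tau> (n - 1) = l" by (simp add: \<tau>_def)
  qed
  also have "\<dots> = of_int (sign \<tau>) * \<Delta> \<rho> l"
    unfolding cram_def \<Delta>_def n1
    using det_n_permute_columns[OF perm, of "\<lambda>i k. if i = n - 1 then (if k = l then 1 else 0) else \<Theta> (\<rho> i) k"]
    by simp
  finally show ?thesis using l by blast
qed

text \<open>Membership of the f_b(\<Delta>) in the radical passes to the entries of \<Delta>,
  because the powers x_l^P are combinations of the f_b, and hence to all (n-1)-minors, whose radical
  contains every T_b.\<close>

lemma Var_in_radical:
  assumes U: "pideal r U" and f\<Delta>: "\<And>b \<rho>. b < r \<Longrightarrow> (\<And>i. i < n - 1 \<Longrightarrow> \<rho> i < N) \<Longrightarrow> subst (\<Delta> \<rho>) (f b) \<in> radical r U"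
    and b: "b < r"
  shows "Var b \<in> radical r U"
proof -
  let ?R = "radical r U"
  have R: "pideal r ?R" by (rule pideal_radical[OF U])
  have \<Delta>: "\<Delta> \<rho> l \<in> ?R" if \<rho>: "\<And>i. i < n - 1 \<Longrightarrow> \<rho> i < N" and l: "l < n" for \<rho> l
  proof -
    have "\<Delta> \<rho> l ^ P = subst (\<Delta> \<rho>) (Var l ^ P)" by (simp add: subst_power)
    also have "\<dots> = (\<Sum>b<r. subst (\<Delta> \<rho>) (g l b) * subst (\<Delta> \<rho>) (f b))"
      unfolding gf[OF l] by (simp add: subst_sum subst_mult)
    also have "\<dots> \<in> ?R"
      by (rule pideal_sum[OF R], rule pideal_mult[OF R])
        (use g[OF l] in \<open>auto simp: forms_def intro!: f\<Delta> \<rho> subst_in_ring \<Delta>_in_ring\<close>)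
    finally show ?thesis by (rule radical_powerD) (rule \<Delta>_in_ring)
  qed
  have "Ic (n - 1) \<subseteq> ?R"
    unfolding Ic_def
  proof (rule gen_ideal_least[OF R], safe)
    fix \<rho> \<sigma> :: "nat \<Rightarrow> nat" assume *: "\<forall>i<n - 1. \<rho> i < N" "\<forall>k<n - 1. \<sigma> k < n"
    then obtain c l where "l < n" "det_n (n - 1) (\<lambda>i k. \<Theta> (\<rho> i) (\<sigma> k)) = of_int c * \<Delta> \<rho> l"
      using minor_eq_\<Delta>[of \<sigma> \<rho>] by blast
    then show "det_n (n - 1) (\<lambda>i k. \<Theta> (\<rho> i) (\<sigma> k)) \<in> ?R" using pideal_mult[OF R] \<Delta> * by simp
  qed
  moreover obtain t where "Var b ^ t \<in> Ic (n - 1)" using Var_in_radical_Ic[of "n - 1" b] n_pos b by (auto simp: radical_def)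
  ultimately have "Var b ^ t \<in> ?R" by blast
  then show ?thesis by (rule radical_powerD) (simp add: b)
qed

end

section \<open>Socles, colon ideals and powers\<close>

lemma prod_cong_mod:
  assumes U: "pideal r U" and "finite X"
    and "\<And>i. i \<in> X \<Longrightarrow> in_ring r (x i) \<and> in_ring r (x' i) \<and> x i - x' i \<in> U"
  shows "prod x X - prod x' X \<in> U"
  using assms(2,3)
proof (induction X)
  case empty then show ?case using pideal_0[OF U] by simp
next
  case (insert i X)
  have "prod x (insert i X) - prod x' (insert i X) = x i * (prod x X - prod x' X) + (x i - x' i) * prod x' X"
    using insert.hyps by (simp add: algebra_simps)
  also have "\<dots> \<in> U"
    using insert by (intro pideal_add[OF U] pideal_mult[OF U] pideal_mult2[OF U]) auto
  finally show ?case .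
qed

lemma subst_cong_mod:
  assumes U: "pideal r U" and p: "in_ring m p"
    and y: "\<And>i. i < m \<Longrightarrow> in_ring r (y i) \<and> in_ring r (y' i) \<and> y i - y' i \<in> U"
  shows "subst y p - subst y' p \<in> U"
proof -
  have "subst y p - subst y' p = (\<Sum>mon\<in>kys p. Const (lkp p mon) * (mono_eval y mon - mono_eval y' mon))"
    by (simp add: subst_peval peval_def right_diff_distrib sum_subtractf)
  also have "\<dots> \<in> U"
  proof (intro pideal_sum[OF U] pideal_mult[OF U] in_ring_Const)
    fix mon assume "mon \<in> kys p"
    then have lt: "\<And>i. i \<in> kys mon \<Longrightarrow> i < m" using p by (auto simp: in_ring_def)
    have pow: "y i ^ k - y' i ^ k \<in> U" if "i < m" for i k
      using prod_cong_mod[OF U, of "{..<k}" "\<lambda>_. y i" "\<lambda>_. y' i"] y[OF that] by simp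
    show "mono_eval y mon - mono_eval y' mon \<in> U"
      unfolding mono_eval_def by (rule prod_cong_mod[OF U]) (use lt pow y in auto)
  qed
  finally show ?thesis .
qed

text \<open>One index at a time, multiply by the highest power of \<open>\<phi> b\<close> that stays
  outside \<open>Y\<close>; what was reached for smaller indices persists. The multiplicative form
  covers both T_b acting on B and f_b acting on S.\<close>

lemma socle_element:
  fixes X Y :: "'a::comm_monoid_mult set" and \<phi> :: "nat \<Rightarrow> 'a"
  assumes p: "p \<in> X" "p \<notin> Y"
    and X: "\<And>b p. b < r \<Longrightarrow> p \<in> X \<Longrightarrow> \<phi> b * p \<in> X"
    and Y: "\<And>b p. b < r \<Longrightarrow> p \<in> Y \<Longrightarrow> \<phi> b * p \<in> Y"
    and nil: "\<And>b p. b < r \<Longrightarrow> p \<in> X \<Longrightarrow> \<exists>D. \<phi> b ^ D * p \<in> Y"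
  obtains q where "q \<in> X" "q \<notin> Y" "\<And>b. b < r \<Longrightarrow> \<phi> b * q \<in> Y"
proof -
  have "m \<le> r \<Longrightarrow> \<exists>q\<in>X. q \<notin> Y \<and> (\<forall>b<m. \<phi> b * q \<in> Y)" for m
  proof (induction m)
    case 0 then show ?case using p by blast
  next
    case (Suc m)
    then obtain q where q: "q \<in> X" "q \<notin> Y" "\<And>b. b < m \<Longrightarrow> \<phi> b * q \<in> Y" by auto
    have m: "m < r" using Suc by simp
    have pX: "\<phi> m ^ k * x \<in> X" if "x \<in> X" for k x
      by (induction k) (use that X[OF m] in \<open>auto simp: mult.assoc\<close>)
    have pY: "\<phi> m ^ k * x \<in> Y" if "x \<in> Y" for k x
      by (induction k) (use that Y[OF m] in \<open>auto simp: mult.assoc\<close>)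
    define D where "D = (LEAST D. \<phi> m ^ D * q \<in> Y)"
    have D: "\<phi> m ^ D * q \<in> Y" unfolding D_def using nil[OF m q(1)] by (rule LeastI_ex)
    then have "D \<noteq> 0" using q(2) by (cases D) auto
    then obtain E where E: "D = Suc E" by (cases D) auto
    have "\<phi> m ^ E * q \<notin> Y" using not_less_Least[of E "\<lambda>D. \<phi> m ^ D * q \<in> Y"] E unfolding D_def by simp
    moreover have "\<phi> b * (\<phi> m ^ E * q) \<in> Y" if "b < Suc m" for b
    proof (cases "b = m")
      case True then show ?thesis using D E by (simp add: mult.assoc)
    next
      case False
      then have "\<phi> m ^ E * (\<phi> b * q) \<in> Y" using q(3) that by (intro pY) simp
      then show ?thesis by (simp add: mult.left_commute)
    qed
    ultimately show ?case using pX[OF q(1)] by blast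
  qed
  from this[of r] show ?thesis using that by blast
qed

section \<open>Koszul chains of top degree and lifting of chains\<close>

definition topc :: "nat \<Rightarrow> 'a::zero \<Rightarrow> nat set \<Rightarrow> 'a" where
  "topc r x A = (if A = {..<r} then x else 0)"

lemma kchain_topc: "x \<in> Z \<Longrightarrow> kchain r r Z (topc r x)"
  using card_subset_eq[of "{..<r}"] by (auto simp: kchain_def topc_def)

lemma kchain_top_eq:
  assumes c: "kchain r r Z c" shows "c = topc r (c {..<r})"
proof
  fix A
  show "c A = topc r (c {..<r}) A"
    using kchain_out[OF c, of A] card_subset_eq[of "{..<r}" A] by (auto simp: topc_def)
qed

text \<open>The boundary coefficient at the complement of \<open>b\<close> is, up to sign,
  \<open>\<phi> b\<close> times the top coefficient, and a single nonzero \<open>\<phi> b\<close>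
  can be cancelled.\<close>

lemma kd_topc_inj:
  fixes \<phi> :: "nat \<Rightarrow> 'a::idom"
  assumes "\<And>A. kd r \<phi> (topc r x) A = kd r \<phi> (topc r y) A" and b: "b < r" "\<phi> b \<noteq> 0"
  shows "x = y"
proof -
  let ?A = "{..<r} - {b}"
  have "{..<r} - ?A = {b}" "insert b ?A = {..<r}" using b by auto
  then have "kd r \<phi> (topc r z) ?A = ksgn b ?A * \<phi> b * z" for z
    unfolding kd_def by (simp add: topc_def)
  then have "ksgn b ?A * \<phi> b * x = ksgn b ?A * \<phi> b * y" using assms(1)[of ?A] by simp
  then have "ksgn b ?A * (ksgn b ?A * \<phi> b * x) = ksgn b ?A * (ksgn b ?A * \<phi> b * y)" by (rule arg_cong)
  then have "(ksgn b ?A * ksgn b ?A) * \<phi> b * x = (ksgn b ?A * ksgn b ?A) * \<phi> b * y"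
    by (simp only: mult.assoc)
  then show ?thesis using b by (simp add: ksgn_sq)
qed

lemma kchain_image_lift:
  assumes z: "kchain r i (\<phi> ` Z) z" and \<phi>: "\<phi> 0 = 0"
  obtains u where "kchain r i Z u" "\<And>A. \<phi> (u A) = z A"
proof -
  have "\<exists>u. if A \<subseteq> {..<r} \<and> card A = i then u \<in> Z \<and> \<phi> u = z A else u = 0" for A
    using z unfolding kchain_def by (metis imageE)
  then obtain u where u: "\<And>A. if A \<subseteq> {..<r} \<and> card A = i then u A \<in> Z \<and> \<phi> (u A) = z A else u A = 0" by metis
  have "kchain r i Z u" unfolding kchain_def using u by meson
  moreover have "\<phi> (u A) = z A" for A
    using u[of A] kchain_out[OF z, of A] \<phi> by (cases "A \<subseteq> {..<r} \<and> card A = i") auto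
  ultimately show ?thesis by (rule that)
qed

lemma subst_ksgn: "subst y (ksgn l A) = ksgn l A"
  by (simp add: ksgn_def subst_power subst_uminus)

lemma subst_kd: "subst y (kd r Var c A) = kd r y (\<lambda>A. subst y (c A)) A"
  by (simp add: kd_def subst_sum subst_mult subst_ksgn)

section \<open>Generators of powers of an ideal\<close>

lemma gen_ideal_product:
  assumes U: "pideal m U" and x: "x \<in> gen_ideal m G" and y: "y \<in> gen_ideal m H"
    and GH: "\<And>g h. g \<in> G \<Longrightarrow> h \<in> H \<Longrightarrow> g * h \<in> U"
  shows "x * y \<in> U"
proof -
  have 1: "x * h \<in> U" if h: "h \<in> H" for h
  proof -
    have "gen_ideal m G \<subseteq> {x. x * h \<in> U}"
      by (rule gen_ideal_least) (use GH h U in \<open>auto simp: pideal_def distrib_right mult.assoc\<close>)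
    then show ?thesis using x by blast
  qed
  have "gen_ideal m H \<subseteq> {y. x * y \<in> U}"
    by (rule gen_ideal_least) (use 1 U in \<open>auto simp: pideal_def distrib_left mult.left_commute\<close>)
  then show ?thesis using y by blast
qed

lemma forms_Suc_monomial:
  assumes "m \<in> kys q" "q \<in> forms r (Suc t)"
  obtains m' i where "i < r" "Poly_Mapping.single m c = Poly_Mapping.single m' c * Var i"
    "Poly_Mapping.single m' c \<in> forms r t"
proof -
  have m: "tdeg m = Suc t" "kys m \<subseteq> {..<r}" using assms by (auto simp: forms_def homog_def in_ring_def)
  then have "m \<noteq> 0" by auto
  then obtain i where i: "i \<in> kys m" by fastforce
  define m' where "m' = m - Poly_Mapping.single i 1"
  have mm: "m = m' + Poly_Mapping.single i 1"
    by (rule poly_mapping_eqI) (use i in \<open>auto simp: m'_def lookup_add lookup_minus lookup_single when_def in_keys_iff\<close>)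
  have "kys m' \<subseteq> {..<r}" "tdeg m' = t"
    using m(2) keys_add_nat[of m' "Poly_Mapping.single i 1"] m(1) tdeg_add[of m' "Poly_Mapping.single i 1"] unfolding mm[symmetric] by auto
  then have "Poly_Mapping.single m' c \<in> forms r t" by (auto simp: forms_def in_ring_def homog_def)
  moreover have "Poly_Mapping.single m c = Poly_Mapping.single m' c * Var i"
    by (subst mm) (simp add: Var_def mult_single)
  ultimately show ?thesis using that m(2) i by blast
qed

text \<open>All forms of degree \<open>t\<close> are used instead of the monomials: their values
  make up a vector space, the shape in which the power is later compared with a graded piece of
  S.\<close>

lemma ideal_pow_gen_ideal:
  assumes y: "\<And>i. i < r \<Longrightarrow> in_ring n (y i)"
  shows "ideal_pow n (gen_ideal n (y ` {..<r})) t = gen_ideal n (subst y ` forms r t)"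
proof (induction t)
  case 0
  have "gen_ideal n {1} \<subseteq> gen_ideal n (subst y ` forms r 0)"
    by (rule gen_ideal_least[OF pideal_gen_ideal])
      (auto intro!: gen_ideal_base image_eqI[of _ _ 1] simp: forms_def)
  moreover have "gen_ideal n (subst y ` forms r 0) \<subseteq> gen_ideal n {1}"
  proof (rule gen_ideal_least[OF pideal_gen_ideal], safe)
    fix q :: "'a mpoly" assume "q \<in> forms r 0"
    then have "in_ring n (subst y q)" using y by (auto simp: forms_def intro: subst_in_ring)
    then have "subst y q * 1 \<in> gen_ideal n {1}" by (rule pideal_mult[OF pideal_gen_ideal]) (auto intro: gen_ideal_base)
    then show "subst y q \<in> gen_ideal n {1}" by simp
  qed
  ultimately show ?case by simp
next
  case (Suc t)
  let ?K = "gen_ideal n (y ` {..<r})"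
  have "ideal_prod n (ideal_pow n ?K t) ?K \<subseteq> gen_ideal n (subst y ` forms r (Suc t))"
    unfolding ideal_prod_def
  proof (rule gen_ideal_least[OF pideal_gen_ideal], safe)
    fix a b assume "a \<in> ideal_pow n ?K t" "b \<in> ?K"
    then show "a * b \<in> gen_ideal n (subst y ` forms r (Suc t))"
      unfolding Suc
    proof (rule gen_ideal_product[OF pideal_gen_ideal])
      fix g h assume "g \<in> subst y ` forms r t" "h \<in> y ` {..<r}"
      then obtain q i where "q \<in> forms r t" "g = subst y q" "i < r" "h = y i" by auto
      then have "q * Var i \<in> forms r (Suc t)" "g * h = subst y (q * Var i)"
        using forms_mult[OF _ forms_Var, of q r t i] by (auto simp: subst_mult)
      then show "g * h \<in> gen_ideal n (subst y ` forms r (Suc t))" by (auto intro: gen_ideal_base)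
    qed
  qed
  moreover have "gen_ideal n (subst y ` forms r (Suc t)) \<subseteq> ideal_prod n (ideal_pow n ?K t) ?K"
    unfolding ideal_prod_def
  proof (rule gen_ideal_least[OF pideal_gen_ideal], safe)
    fix q :: "'a mpoly" assume q: "q \<in> forms r (Suc t)"
    let ?G = "{a * b |a b. a \<in> ideal_pow n ?K t \<and> b \<in> ?K}"
    have "subst y q = (\<Sum>m\<in>kys q. subst y (Poly_Mapping.single m (lkp q m)))"
      by (simp add: sum_monomials flip: subst_sum)
    also have "\<dots> \<in> gen_ideal n ?G"
    proof (rule pideal_sum[OF pideal_gen_ideal])
      fix m assume "m \<in> kys q"
      then obtain m' i where i: "i < r" "Poly_Mapping.single m (lkp q m) = Poly_Mapping.single m' (lkp q m) * Var i"
        "Poly_Mapping.single m' (lkp q m) \<in> forms r t" using forms_Suc_monomial[OF _ q] by metis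
      have "subst y (Poly_Mapping.single m (lkp q m)) = subst y (Poly_Mapping.single m' (lkp q m)) * y i"
        unfolding i(2) by (simp add: subst_mult)
      moreover have "subst y (Poly_Mapping.single m' (lkp q m)) \<in> ideal_pow n ?K t"
        unfolding Suc using i(3) by (intro gen_ideal_base) auto
      moreover have "y i \<in> ?K" using i(1) by (intro gen_ideal_base) auto
      ultimately show "subst y (Poly_Mapping.single m (lkp q m)) \<in> gen_ideal n ?G"
        by (intro gen_ideal_base) blast
    qed
    finally show "subst y q \<in> gen_ideal n ?G" .
  qed
  ultimately show ?case by simp
qed

context lin_pres_ideal
begin

section \<open>Inverting the map given by the forms\<close>

lemma J_pideal: "pideal r J" unfolding minors_ideal_def by (rule pideal_gen_ideal)

lemma J_minor: "(\<And>i. i < n \<Longrightarrow> \<rho> i < N) \<Longrightarrow> det_n n (\<lambda>i l. \<Theta> (\<rho> i) l) \<in> J"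
proof (cases "inj_on \<rho> {..<n}")
  case True
  assume "\<And>i. i < n \<Longrightarrow> \<rho> i < N"
  then show ?thesis unfolding minors_ideal_def using True by (intro gen_ideal_base) blast
next
  case False
  then obtain i j where "i < n" "j < n" "i \<noteq> j" "\<rho> i = \<rho> j" by (auto simp: inj_on_def)
  then have "det_n n (\<lambda>i l. \<Theta> (\<rho> i) l) = 0" by (intro det_n_identical_rows[of i _ j]) auto
  then show ?thesis using pideal_0[OF J_pideal] by simp
qed

lemma IW_pideal: "pideal r (IW r f)"
  by (auto simp: pideal_def IW_def subst_add subst_mult)

text \<open>\<Theta>(f) annihilates the nonzero vector of variables, so its n-minors vanish.\<close>

lemma J_subset_IW: "J \<subseteq> IW r f"
  unfolding minors_ideal_def
proof (rule gen_ideal_least[OF IW_pideal], safe)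
  fix \<rho> assume \<rho>: "inj_on \<rho> {..<n}" "\<rho> ` {..<n} \<subseteq> {..<N}"
  have "det_n n (\<lambda>i l. subst f (\<Theta> (\<rho> i) l)) = 0"
    by (rule det_n_singular[of _ _ Var 0]) (use \<rho> n_pos theta_subst_f in auto)
  then show "det_n n (\<lambda>i l. \<Theta> (\<rho> i) l) \<in> IW r f"
    by (auto simp: IW_def subst_det_n intro!: in_ring_det_n theta_in_ring)
qed

text \<open>Modulo \<open>J\<close> all rows of \<Theta> annihilate \<open>\<Delta> \<rho>\<close>,
  so \<open>koszul_relation\<close> makes T and f(\<Delta>) proportional.\<close>

lemma \<Delta>_relation:
  assumes \<rho>: "\<And>i. i < n - 1 \<Longrightarrow> \<rho> i < N" and b: "b1 < r" "b2 < r"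
  shows "Var b1 * subst (\<Delta> \<rho>) (f b2) - Var b2 * subst (\<Delta> \<rho>) (f b1) \<in> J"
proof -
  have n1: "Suc (n - 1) = n" using n_pos by simp
  from koszul_relation[OF Const.coeff_hom_axioms b, of Var "\<Delta> \<rho>"] obtain e where e: "\<forall>j<N. in_ring n (e j)"
    "Var b1 * subst (\<Delta> \<rho>) (f b2) - Var b2 * subst (\<Delta> \<rho>) (f b1) = (\<Sum>j<N. subst (\<Delta> \<rho>) (e j) * (\<Sum>l<n. \<Theta> j l * \<Delta> \<rho> l))"
    unfolding jac_dual_def subst_peval by blast
  show ?thesis
    unfolding e(2)
  proof (rule pideal_sum[OF J_pideal], rule pideal_mult[OF J_pideal])
    fix j assume j: "j \<in> {..<N}"
    show "in_ring r (subst (\<Delta> \<rho>) (e j))" using e(1) j by (intro subst_in_ring[of n]) (auto intro: \<Delta>_in_ring)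
    have "(\<Sum>l<n. \<Theta> j l * \<Delta> \<rho> l) = det_n (Suc (n - 1)) (\<lambda>i k. \<Theta> ((\<rho>(n - 1 := j)) i) k)"
      unfolding \<Delta>_def by (rule cram_sum_row) (use n_pos in auto)
    then have eq: "(\<Sum>l<n. \<Theta> j l * \<Delta> \<rho> l) = det_n n (\<lambda>i k. \<Theta> ((\<rho>(n - 1 := j)) i) k)" by (simp only: n1)
    show "(\<Sum>l<n. \<Theta> j l * \<Delta> \<rho> l) \<in> J"
      unfolding eq by (rule J_minor) (use \<rho> j in auto)
  qed
qed

text \<open>Modulo \<open>J\<close>, f_b(\<Delta>)^e p(T) = p(f_b(\<Delta>) T) is congruent to p(T_b
  f(\<Delta>)), which is T_b^e times p(f) taken at \<Delta>, hence 0. So the colon ideal of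
  \<open>p\<close> contains powers of all f_b(\<Delta>).\<close>

lemma power_into_J:
  assumes p: "p \<in> IW r f" "p \<in> forms r e" and b: "b < r"
  shows "\<exists>D. Var b ^ D * p \<in> J"
proof -
  define U where "U = {q. in_ring r q \<and> q * p \<in> J}"
  have U: "pideal r U" using J_pideal by (auto simp: U_def pideal_def distrib_right mult.assoc)
  have "Var b \<in> radical r U"
  proof (rule Var_in_radical[OF U _ b])
    fix b \<rho> assume b: "b < r" and \<rho>: "\<And>i. i < n - 1 \<Longrightarrow> \<rho> i < N"
    let ?F = "\<lambda>i. subst (\<Delta> \<rho>) (f i)"
    have F: "in_ring r (?F i)" if "i < r" for i
      by (rule subst_in_ring[of n]) (use f_S that \<Delta>_in_ring in auto)
    have "subst (\<lambda>i. ?F b * Var i) p - subst (\<lambda>i. Var b * ?F i) p \<in> J"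
    proof (rule subst_cong_mod[OF J_pideal])
      show "in_ring r p" using p by (simp add: forms_def)
      fix i assume i: "i < r"
      show "in_ring r (?F b * Var i) \<and> in_ring r (Var b * ?F i) \<and> ?F b * Var i - Var b * ?F i \<in> J"
        using \<Delta>_relation[OF \<rho> i b] F b i by (simp add: mult.commute)
    qed
    moreover have "subst (\<lambda>i. ?F b * Var i) p = ?F b ^ e * p"
      using subst_scale[of e p "?F b" Var] p(2) by (simp add: forms_def subst_Var_id)
    moreover have "subst (\<lambda>i. Var b * ?F i) p = 0"
    proof -
      have "subst ?F p = subst (\<Delta> \<rho>) (subst f p)" by (simp add: subst_subst)
      then show ?thesis using subst_scale[of e p "Var b" ?F] p by (simp add: forms_def IW_def)
    qed
    ultimately have "?F b ^ e * p \<in> J" by simp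
    then show "?F b \<in> radical r U" using F[OF b] by (auto simp: radical_def U_def)
  qed
  then show ?thesis by (auto simp: radical_def U_def)
qed

text \<open>Append to the n - 1 rows of \<Theta>(f) the row with x_0 in place j and -x_j in place 0.
  All rows annihilate x, so the determinant is 0, and its expansion along the new row is the
  difference of the two sides.\<close>

lemma \<Delta>_proportional:
  assumes \<rho>: "\<And>i. i < n - 1 \<Longrightarrow> \<rho> i < N" and j: "j < n"
  shows "Var 0 * subst f (\<Delta> \<rho> j) = subst f (\<Delta> \<rho> 0) * Var j"
proof -
  have n1: "Suc (n - 1) = n" using n_pos by simp
  let ?T = "\<lambda>j l. subst f (\<Theta> j l)"
  have s: "subst f (\<Delta> \<rho> l) = cram (n - 1) ?T \<rho> (\<lambda>k. k) l" for l
    unfolding \<Delta>_def cram_def subst_det_n by (rule det_n_cong) auto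
  let ?x = "\<lambda>l. (if l = j then Var 0 else 0) - (if l = 0 then Var j else 0) :: 'k mpoly"
  have "(\<Sum>l<n. ?x l * cram (n - 1) ?T \<rho> (\<lambda>k. k) l) = det_n (Suc (n - 1)) (\<lambda>i k. if i = n - 1 then ?x k else ?T (\<rho> i) k)"
    by (rule cram_sum) (use n_pos in auto)
  also have "\<dots> = 0"
    unfolding n1
  proof (rule det_n_singular[of _ _ Var 0])
    fix i assume i: "i < n"
    show "(\<Sum>k<n. (if i = n - 1 then ?x k else ?T (\<rho> i) k) * Var k) = 0"
    proof (cases "i = n - 1")
      case True
      have "(\<Sum>k<n. ?x k * Var k) = Var 0 * Var j - Var j * Var 0"
        using j n_pos by (simp add: left_diff_distrib sum_subtractf if_distrib[of "\<lambda>x. x * _"] cong: if_cong)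
      then show ?thesis using True by (simp add: mult.commute)
    next
      case False
      then show ?thesis using theta_subst_f[of "\<rho> i"] \<rho>[of i] i by simp
    qed
  qed (use n_pos in auto)
  finally have "(\<Sum>l<n. ?x l * cram (n - 1) ?T \<rho> (\<lambda>k. k) l) = 0" .
  moreover have "(\<Sum>l<n. ?x l * cram (n - 1) ?T \<rho> (\<lambda>k. k) l)
      = Var 0 * cram (n - 1) ?T \<rho> (\<lambda>k. k) j - Var j * cram (n - 1) ?T \<rho> (\<lambda>k. k) 0"
    using j n_pos by (simp add: left_diff_distrib sum_subtractf if_distrib[of "\<lambda>x. x * _"] cong: if_cong)
  ultimately show ?thesis by (simp add: s mult.commute)
qed

text \<open>A form taken at \<Delta>(f) differs from the form itself by a power of \<Delta>_0(f) /
  x_0. Comparing f_b and s cancels this factor: f_b(\<Delta>(f))^t s = f_b^t s(\<Delta>(f)), whose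
  right side lies in A.\<close>

lemma power_into_subalgebra:
  assumes s: "s \<in> forms n (d * t)" and b: "b < r"
  shows "\<exists>D. f b ^ D * s \<in> subst f ` Collect (in_ring r)"
proof -
  let ?A = "subst f ` Collect (in_ring r)"
  have A_add: "x + y \<in> ?A" if "x \<in> ?A" "y \<in> ?A" for x y
  proof -
    from that obtain p q where "in_ring r p" "x = subst f p" "in_ring r q" "y = subst f q" by auto
    then show ?thesis by (intro image_eqI[of _ _ "p + q"]) (auto simp: subst_add)
  qed
  have A_mult: "x * y \<in> ?A" if "x \<in> ?A" "y \<in> ?A" for x y
  proof -
    from that obtain p q where "in_ring r p" "x = subst f p" "in_ring r q" "y = subst f q" by auto
    then show ?thesis by (intro image_eqI[of _ _ "p * q"]) (auto simp: subst_mult)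
  qed
  define U where "U = {q. in_ring r q \<and> subst f q * s \<in> ?A}"
  have "0 \<in> ?A" by (rule image_eqI[of _ _ 0]) auto
  then have U: "pideal r U"
    using A_add A_mult unfolding U_def pideal_def by (auto simp: subst_add subst_mult distrib_right mult.assoc)
  have "Var b \<in> radical r U"
  proof (rule Var_in_radical[OF U _ b])
    fix b \<rho> assume b: "b < r" and \<rho>: "\<And>i. i < n - 1 \<Longrightarrow> \<rho> i < N"
    let ?D = "\<lambda>l. subst f (\<Delta> \<rho> l)"
    let ?F = "subst (\<Delta> \<rho>) (f b)"
    have F: "in_ring r ?F" by (rule subst_in_ring[of n]) (use f_S b \<Delta>_in_ring in auto)
    have scale: "Var 0 ^ e * subst ?D q = ?D 0 ^ e * q" if "q \<in> forms n e" for e q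
    proof -
      have "Var 0 ^ e * subst ?D q = subst (\<lambda>l. Var 0 * ?D l) q"
        using subst_scale[of e q "Var 0" ?D] that by (simp add: forms_def)
      also have "\<dots> = subst (\<lambda>l. ?D 0 * Var l) q"
        by (rule subst_cong[of n]) (use that \<Delta>_proportional[OF \<rho>] in \<open>auto simp: forms_def\<close>)
      also have "\<dots> = ?D 0 ^ e * q" using subst_scale[of e q "?D 0" Var] that by (simp add: forms_def subst_Var_id)
      finally show ?thesis .
    qed
    \<comment> \<open>The t-th power of f_b has the degree d t of \<open>s\<close>, so both sides
      carry the same power of x_0, which is then cancelled.\<close>
    have "Var 0 ^ (d * t) * (subst ?D (f b) ^ t * s) = (Var 0 ^ d * subst ?D (f b)) ^ t * s"
      by (simp add: power_mult_distrib power_mult)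
    also have "\<dots> = f b ^ t * (?D 0 ^ (d * t) * s)"
      unfolding scale[OF f_forms[OF b]] by (simp add: power_mult_distrib power_mult mult_ac)
    also have "\<dots> = Var 0 ^ (d * t) * (f b ^ t * subst ?D s)"
      unfolding scale[OF s, symmetric] by (simp add: mult_ac)
    finally have "subst ?D (f b) ^ t * s = f b ^ t * subst ?D s" by simp
    moreover have "subst ?D (f b) = subst f ?F" "subst ?D s = subst f (subst (\<Delta> \<rho>) s)" by (simp_all add: subst_subst)
    ultimately have "subst f (?F ^ t) * s = subst f (Var b ^ t * subst (\<Delta> \<rho>) s)"
      by (simp add: subst_power subst_mult)
    moreover have "in_ring r (Var b ^ t * subst (\<Delta> \<rho>) s)"
      using b s by (auto intro!: in_ring_mult subst_in_ring[of n] \<Delta>_in_ring simp: forms_def)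
    ultimately have "?F ^ t \<in> U" using F by (auto simp: U_def)
    then show "?F \<in> radical r U" using F by (auto simp: radical_def)
  qed
  then obtain D where "Var b ^ D \<in> U" by (auto simp: radical_def)
  then have "f b ^ D * s \<in> ?A" by (simp add: U_def subst_power)
  then show ?thesis by blast
qed

text \<open>A preimage may be cut down to its component of degree \<open>t\<close>, by
  \<open>subst_hc\<close>.\<close>

lemma subalgebra_homog:
  assumes "x \<in> subst f ` Collect (in_ring r)" "x \<in> forms n (d * t)"
  shows "x \<in> subst f ` forms r t"
proof -
  from assms obtain q where q: "in_ring r q" "x = subst f q" by auto
  have "x = hc (d * t) x" using assms(2) hc_homog[of "d * t" x "d * t"] by (simp add: forms_def)
  also have "\<dots> = subst f (hc t q)" unfolding q(2) by (rule subst_hc[OF q(1) _ d_pos]) (use f_deg in auto)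
  finally show ?thesis using forms_hc[OF q(1)] by blast
qed

end

section \<open>Linear resolutions and powers of the ideal\<close>

context lin_pres_ideal
begin

lemma IW_forms_in_J:
  assumes van: "\<And>i e. e \<ge> n \<Longrightarrow> kvan1 r J i e"
    and p: "p \<in> IW r f" "p \<in> forms r e" "e \<ge> n"
  shows "p \<in> J"
proof (rule ccontr)
  assume "p \<notin> J"
  let ?X = "{p \<in> IW r f. \<exists>e\<ge>n. p \<in> forms r e}"
  obtain q where q: "q \<in> ?X" "q \<notin> J" "\<And>b. b < r \<Longrightarrow> Var b * q \<in> J"
  proof (rule socle_element[of p ?X J r Var])
    show "p \<in> ?X" using p by blast
    show "p \<notin> J" by fact
    show "Var b * q \<in> ?X" if "b < r" "q \<in> ?X" for b q
    proof -
      from that obtain e where "e \<ge> n" "q \<in> forms r e" by blast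
      then have "Var b * q \<in> forms r (Suc e)" "Suc e \<ge> n" using forms_mult[OF forms_Var[OF that(1)], of q e] by auto
      then show ?thesis using that pideal_mult[OF IW_pideal, of "Var b" q] by auto
    qed
    show "Var b * q \<in> J" if "b < r" "q \<in> J" for b q using that by (simp add: pideal_mult[OF J_pideal])
    show "\<exists>D. Var b ^ D * q \<in> J" if "b < r" "q \<in> ?X" for b q using power_into_J that by blast
  qed (rule that)
  from q(1) obtain e where e: "e \<ge> n" "q \<in> forms r e" by blast
  obtain r' where r': "r = Suc r'" using r_pos by (cases r) auto
  \<comment> \<open>The coefficients of this boundary are the T_b q up to sign, so it is a cycle
    over \<open>J\<close> although the chain itself is not.\<close>
  have "kchain r r' (J \<inter> forms r (Suc e)) (kd r Var (topc r q))"
  proof (rule kchain_kd)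
    show "kchain r (Suc r') {0, q} (topc r q)" using kchain_topc[of q "{0, q}" r] r' by simp
    show "Var l * x \<in> J \<inter> forms r (Suc e)" if "l < r" "x \<in> {0, q}" for l x
      using that q(3) forms_mult[OF forms_Var[OF that(1)] e(2)] pideal_0[OF J_pideal] by auto
  qed (auto simp: pideal_0[OF J_pideal] pideal_add[OF J_pideal] pideal_uminus[OF J_pideal])
  then obtain w where w: "kchain r (Suc r') (J \<inter> forms r e) w" "\<And>A. kd r Var w A = kd r Var (topc r q) A"
    using van[OF e(1), of r'] kd_kd unfolding kvan1_def by blast
  have w': "kchain r r (J \<inter> forms r e) w" using w(1) r' by simp
  have "kd r Var (topc r (w {..<r})) A = kd r Var (topc r q) A" for A
    using w(2)[of A] kchain_top_eq[OF w'] by simp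
  then have "w {..<r} = q" by (rule kd_topc_inj[of r Var _ _ 0]) (use r_pos in auto)
  then show False using kchainD[OF w', of "{..<r}"] q(2) by simp
qed

lemma forms_in_subalgebra:
  assumes van: "\<And>i e. e \<ge> n \<Longrightarrow> kvan1 r J i e" and s: "s \<in> forms n (d * t)" "t \<ge> n - 1"
  shows "s \<in> subst f ` Collect (in_ring r)"
proof (rule ccontr)
  let ?A = "subst f ` Collect (in_ring r)"
  assume "s \<notin> ?A"
  let ?X = "{s. \<exists>t\<ge>n - 1. s \<in> forms n (d * t)}"
  obtain q where q: "q \<in> ?X" "q \<notin> ?A" "\<And>b. b < r \<Longrightarrow> f b * q \<in> ?A"
  proof (rule socle_element[of s ?X ?A r f])
    show "s \<in> ?X" using s by blast
    show "s \<notin> ?A" by fact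
    show "f b * q \<in> ?X" if "b < r" "q \<in> ?X" for b q
    proof -
      from that obtain t where "t \<ge> n - 1" "q \<in> forms n (d * t)" by blast
      then have "f b * q \<in> forms n (d * Suc t)" "Suc t \<ge> n - 1" using forms_mult[OF f_forms[OF that(1)], of q "d * t"] by auto
      then show ?thesis by blast
    qed
    show "f b * q \<in> ?A" if "b < r" "q \<in> ?A" for b q
    proof -
      from that obtain p where "in_ring r p" "q = subst f p" by auto
      then show ?thesis using that(1) by (intro image_eqI[of _ _ "Var b * p"]) (auto simp: subst_mult)
    qed
    show "\<exists>D. f b ^ D * q \<in> ?A" if "b < r" "q \<in> ?X" for b q using power_into_subalgebra that by blast
  qed (rule that)
  from q(1) obtain t where t: "t \<ge> n - 1" "q \<in> forms n (d * t)" by blast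
  obtain r' where r': "r = Suc r'" using r_pos by (cases r) auto
  let ?Z = "subst f ` forms r (Suc t)"
  define z where "z = kd r f (topc r q)"
  have "kchain r r' ?Z z"
    unfolding z_def
  proof (rule kchain_kd)
    show "kchain r (Suc r') {0, q} (topc r q)" using kchain_topc[of q "{0, q}" r] r' by simp
    show Z0: "0 \<in> ?Z" by (rule image_eqI[of _ _ 0]) auto
    show "x + y \<in> ?Z" if xy: "x \<in> ?Z" "y \<in> ?Z" for x y
    proof -
      from xy obtain p p' where "p \<in> forms r (Suc t)" "p' \<in> forms r (Suc t)" "x = subst f p" "y = subst f p'" by blast
      then show ?thesis by (intro image_eqI[of _ _ "p + p'"]) (auto simp: subst_add)
    qed
    show "- x \<in> ?Z" if x: "x \<in> ?Z" for x
    proof -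
      from x obtain p where "p \<in> forms r (Suc t)" "x = subst f p" by blast
      then show ?thesis by (intro image_eqI[of _ _ "- p"]) (auto simp: subst_uminus)
    qed
    show "f l * x \<in> ?Z" if "l < r" "x \<in> {0, q}" for l x
    proof (cases "x = 0")
      case True then show ?thesis using Z0 by simp
    next
      case False
      then have "x = q" using that by simp
      moreover have "f l * q \<in> forms n (d * Suc t)" using forms_mult[OF f_forms[OF that(1)] t(2)] by simp
      ultimately show ?thesis using subalgebra_homog[OF q(3)[OF that(1)]] by blast
    qed
  qed simp
  \<comment> \<open>The cycle has coefficients in A; its lift to B need not be a cycle, but its
    boundary has coefficients in I(W), hence in \<open>J\<close> by degree.\<close>
  from kchain_image_lift[OF this] obtain \<gamma> where
    \<gamma>: "kchain r r' (forms r (Suc t)) \<gamma>" "\<And>A. subst f (\<gamma> A) = z A" by auto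
  have "subst f (kd r Var \<gamma> A) = 0" for A unfolding subst_kd \<gamma>(2) unfolding z_def by (rule kd_kd)
  moreover have kd\<gamma>: "kd r Var \<gamma> A \<in> forms r (Suc (Suc t))" for A
    by (rule kd_closed[OF \<gamma>(1)]) (auto dest: forms_mult[OF forms_Var])
  ultimately have "kd r Var \<gamma> A \<in> IW r f" for A by (auto simp: IW_def forms_def)
  then have kdJ: "kd r Var \<gamma> A \<in> J \<inter> forms r (Suc (Suc t))" for A
    using IW_forms_in_J[OF van _ kd\<gamma>] kd\<gamma> t(1) by auto
  \<comment> \<open>The second connecting step. For r = 1 there is no homological degree r - 2, and
    the boundary of the lift is zero already. Otherwise vanishing needs
    \<open>Suc t \<ge> n\<close>, which the threshold n - 1 provides.\<close>
  have "\<exists>w. kchain r r' (J \<inter> forms r (Suc t)) w \<and> (\<forall>A. kd r Var w A = kd r Var \<gamma> A)"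
  proof (cases r')
    case 0
    have "kd r Var \<gamma> A = 0" for A by (rule kd_out[OF \<gamma>(1)]) (simp add: 0)
    then show ?thesis by (intro exI[of _ "\<lambda>_. 0"]) (simp add: kchain_def pideal_0[OF J_pideal])
  next
    case (Suc r'')
    have "kchain r r'' (J \<inter> forms r (Suc (Suc t))) (kd r Var \<gamma>)"
      using kdJ kd_out[OF \<gamma>(1)] Suc by (auto simp: kchain_def)
    moreover have "kvan1 r J r'' (Suc t)" by (rule van) (use t in simp)
    ultimately show ?thesis using kd_kd Suc unfolding kvan1_def by blast
  qed
  then obtain w where w: "kchain r r' (J \<inter> forms r (Suc t)) w" "\<And>A. kd r Var w A = kd r Var \<gamma> A" by blast
  have w0: "subst f (w A) = 0" for A
    using kchain_in[OF w(1), of A] J_subset_IW pideal_0[OF J_pideal] by (auto simp: IW_def)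
  have "kchain r r' (forms r (Suc t)) (\<lambda>A. \<gamma> A - w A)"
    using kchainD[OF \<gamma>(1)] kchain_out[OF \<gamma>(1)] kchainD[OF w(1)] kchain_out[OF w(1)]
    unfolding kchain_def by auto
  moreover have "kd r Var (\<lambda>A. \<gamma> A - w A) A = 0" for A by (simp add: kd_diff w(2))
  ultimately obtain v where v: "kchain r (Suc r') (forms r t) v" "\<And>A. kd r Var v A = \<gamma> A - w A"
    by (rule koszul_exact_Var) (rule that)
  have v': "kchain r r (forms r t) v" using v(1) r' by simp
  define v0 where "v0 = v {..<r}"
  \<comment> \<open>The correction \<open>w\<close> dies under substitution of f, so the image of
    the top chain \<open>v\<close> has the same boundary as the chain of \<open>q\<close>.\<close>
  have "kd r f (topc r (subst f v0)) A = kd r f (topc r q) A" for A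
  proof -
    have "v A = topc r v0 A" for A unfolding v0_def by (rule fun_cong[OF kchain_top_eq[OF v']])
    then have "(\<lambda>A. subst f (v A)) = topc r (subst f v0)" by (auto simp: topc_def fun_eq_iff)
    then have "kd r f (topc r (subst f v0)) A = subst f (kd r Var v A)" by (simp add: subst_kd)
    also have "\<dots> = z A" by (simp add: v(2) subst_diff \<gamma>(2) w0)
    finally show ?thesis by (simp add: z_def)
  qed
  then have "subst f v0 = q" using kd_topc_inj[of r f] ex_f_nonzero by blast
  moreover have "in_ring r v0" using kchainD[OF v', of "{..<r}"] by (simp add: v0_def forms_def)
  ultimately show False using q(2) by blast
qed

lemma subst_f_forms: "subst f ` forms r t \<subseteq> forms n (d * t)"
  using f_S f_deg by (auto simp: forms_def intro: subst_in_ring subst_homog)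

text \<open>Both ideals are generated in degree d t, so they can be compared in that degree, where
  the coefficients of a combination reduce to constants.\<close>

lemma power_eq_iff:
  "ideal_pow n I t = ideal_pow n (max_ideal n) (d * t) \<longleftrightarrow> forms n (d * t) \<subseteq> subst f ` forms r t"
proof -
  have 1: "ideal_pow n I t = gen_ideal n (subst f ` forms r t)"
    by (rule ideal_pow_gen_ideal) (use f_S in simp)
  have "subst Var ` forms n (d * t) = (forms n (d * t) :: 'k mpoly set)" by (simp add: subst_Var_id)
  then have 2: "ideal_pow n (max_ideal n) (d * t) = (gen_ideal n (forms n (d * t)) :: 'k mpoly set)"
    unfolding max_ideal_def using ideal_pow_gen_ideal[of n n "Var :: nat \<Rightarrow> 'k mpoly" "d * t"] by simp
  show ?thesis
  proof
    assume "forms n (d * t) \<subseteq> subst f ` forms r t"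
    then show "ideal_pow n I t = ideal_pow n (max_ideal n) (d * t)"
      unfolding 1 2 using subst_f_forms[of t] by (metis subset_antisym)
  next
    assume eq: "ideal_pow n I t = ideal_pow n (max_ideal n) (d * t)"
    show "forms n (d * t) \<subseteq> subst f ` forms r t"
    proof
      fix x :: "'k mpoly" assume x: "x \<in> forms n (d * t)"
      then have "x \<in> gen_ideal n (subst f ` forms r t)" using gen_ideal_base[OF x] eq unfolding 1 2 by blast
      then obtain F c where F: "finite F" "F \<subseteq> subst f ` forms r t" "x = (\<Sum>g\<in>F. c g * g)"
        unfolding gen_ideal_def by blast
      have "x = hc (0 + d * t) (\<Sum>g\<in>F. c g * g)" using x hc_homog[of "d * t" x "d * t"] by (simp add: forms_def flip: F(3))
      also have "\<dots> = (\<Sum>g\<in>F. hc 0 (c g) * g)"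
        unfolding part_sum
        by (rule sum.cong[OF refl], rule hc_mult_homog) (use F(2) subst_f_forms[of t] in \<open>auto simp: forms_def\<close>)
      also have "\<dots> = (\<Sum>g\<in>F. Const (lkp (c g) 0) * g)"
      proof -
        have "hc 0 p = Const (lkp p 0)" for p :: "'k mpoly"
          by (rule poly_mapping_eqI) (auto simp: lookup_part tdeg_eq_0_iff Const_def lookup_single when_def)
        then show ?thesis by simp
      qed
      also have "\<dots> \<in> subst f ` Collect (in_ring r)"
      proof -
        have "\<forall>g\<in>F. \<exists>q. q \<in> forms r t \<and> g = subst f q" using F(2) by blast
        from bchoice[OF this] obtain h where h: "\<And>g. g \<in> F \<Longrightarrow> h g \<in> forms r t \<and> g = subst f (h g)" by blast
        then have "(\<Sum>g\<in>F. Const (lkp (c g) 0) * g) = subst f (\<Sum>g\<in>F. Const (lkp (c g) 0) * h g)"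
          unfolding subst_sum subst_mult by (intro sum.cong refl) simp
        moreover have "in_ring r (\<Sum>g\<in>F. Const (lkp (c g) 0) * h g)" using h by (auto simp: forms_def)
        ultimately show ?thesis by blast
      qed
      finally show "x \<in> subst f ` forms r t" using subalgebra_homog x by blast
    qed
  qed
qed

lemma power_eq_if_linear_resolution:
  assumes "linear_resolution r n J"
  shows "ideal_pow n I (n - 1) = ideal_pow n (max_ideal n) (d * (n - 1))"
  unfolding power_eq_iff
proof
  fix s :: "'k mpoly" assume s: "s \<in> forms n (d * (n - 1))"
  have "s \<in> subst f ` Collect (in_ring r)"
    by (rule forms_in_subalgebra[OF linear_resolution_imp_kvan1[OF assms] s]) auto
  then show "s \<in> subst f ` forms r (n - 1)" using s by (rule subalgebra_homog)
qed

section \<open>Vanishing over S and the converse implication\<close>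

lemma koszul_exact_f:
  assumes e: "e \<ge> n" and z: "kchain r q (forms n (d * e)) z" "\<And>A. kd r f z A = 0"
  obtains w where "kchain r (Suc q) (forms n (d * (e - 1))) w" "\<And>A. kd r f w A = z A"
proof -
  have de: "d * (e - 1) + d = d * e" using e n_pos by (cases e) auto
  \<comment> \<open>The coefficient degree d e is at least n d, so the bound of
    \<open>koszul_exact\<close> is exceeded by at least n, independently of P.\<close>
  have "n * P = n * (P - 1) + n" using P(1) d_pos by (cases P) auto
  moreover have "n * d \<le> d * e" using e by simp
  ultimately have deg: "d * (e - 1) + d + n * P > n * (P - 1) + n * d" using de n_pos by linarith
  show ?thesis
    by (rule koszul_exact[where f=f and g=g and N=P and n=n and d=d and a="d * (e - 1)" and z=z and q=q and r=r, OF f_forms P(1) g gf deg])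
      (use z[folded de] that in auto)
qed

text \<open>Vanishing of H_0(f; S) writes every form of degree d (t + 1) as a combination of the f_l
  with coefficients of degree d t once t + 1 >= n, so surjectivity propagates upwards.\<close>

lemma forms_surjective:
  assumes base: "forms n (d * (n - 1)) \<subseteq> subst f ` forms r (n - 1)" and t: "t \<ge> n - 1"
  shows "forms n (d * t) \<subseteq> subst f ` forms r t"
  using t
proof (induction t rule: nat_induct_at_least)
  case base then show ?case by fact
next
  case (Suc t)
  show ?case
  proof
    fix x :: "'k mpoly" assume x: "x \<in> forms n (d * Suc t)"
    define z where "z A = (if A = {} then x else 0)" for A :: "nat set"
    have z: "kchain r 0 (forms n (d * Suc t)) z"
      using x by (auto simp: kchain_def z_def dest: finite_subset)
    have kdz: "kd r f z A = 0" for A using kd_out[OF z] by simp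
    have "n \<le> Suc t" using Suc.hyps n_pos by linarith
    from koszul_exact_f[OF this z kdz] obtain w where
      w: "kchain r (Suc 0) (forms n (d * t)) w" "\<And>A. kd r f w A = z A" by auto
    have "\<exists>q. q \<in> forms r t \<and> w {l} = subst f q" for l
      using Suc.IH kchain_in[OF w(1), of "{l}"] by auto
    then obtain q where q: "\<And>l. q l \<in> forms r t" "\<And>l. w {l} = subst f (q l)" by metis
    have "x = kd r f w {}" by (simp add: w(2) z_def)
    also have "\<dots> = (\<Sum>l<r. f l * w {l})" by (simp add: kd_def ksgn_def)
    also have "\<dots> = subst f (\<Sum>l<r. Var l * q l)" by (simp add: subst_sum subst_mult q(2))
    finally have "x = subst f (\<Sum>l<r. Var l * q l)" .
    moreover have "(\<Sum>l<r. Var l * q l) \<in> forms r (Suc t)"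
      by (rule forms_sum) (use forms_mult[OF forms_Var q(1)] in auto)
    ultimately show "x \<in> subst f ` forms r (Suc t)" by blast
  qed
qed

lemma IW_hc: "p \<in> IW r f \<Longrightarrow> hc e p \<in> IW r f"
  using subst_hc[of r p d f e] f_deg d_pos by (auto simp: IW_def in_ring_part)

lemma IW_ge:
  "ideal_ge r n (IW r f) = {p \<in> IW r f. \<forall>m\<in>kys p. tdeg m \<ge> n}" (is "_ = ?R")
proof
  have "pideal r ?R"
    unfolding pideal_def
  proof (intro conjI ballI allI impI)
    fix p q assume "p \<in> ?R" "q \<in> ?R"
    then show "p + q \<in> ?R" using keys_add[of p q] pideal_add[OF IW_pideal] by blast
  next
    fix c p :: "'k mpoly" assume c: "in_ring r c" "p \<in> ?R"
    have "tdeg m \<ge> n" if m: "m \<in> kys (c * p)" for m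
    proof -
      from m obtain m1 m2 where "m = m1 + m2" "m2 \<in> kys p" using keys_mult[of c p] by blast
      then show ?thesis using c by (auto simp: tdeg_add intro: trans_le_add2)
    qed
    then show "c * p \<in> ?R" using c pideal_mult[OF IW_pideal] by blast
  qed (use pideal_0[OF IW_pideal] in auto)
  then show "ideal_ge r n (IW r f) \<subseteq> ?R"
    unfolding ideal_ge_def by (rule gen_ideal_least) (auto simp: homog_def)
  show "?R \<subseteq> ideal_ge r n (IW r f)"
  proof
    fix p assume p: "p \<in> ?R"
    have "p = (\<Sum>e\<in>tdeg ` kys p. hc e p)" by (rule sum_hc[symmetric]) auto
    also have "\<dots> \<in> ideal_ge r n (IW r f)"
      unfolding ideal_ge_def
    proof (rule pideal_sum[OF pideal_gen_ideal], rule gen_ideal_base)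
      fix e assume "e \<in> tdeg ` kys p"
      then show "hc e p \<in> {p \<in> IW r f. \<exists>e\<ge>n. homog e p}" using p IW_hc homog_hc by fastforce
    qed
    finally show "p \<in> ideal_ge r n (IW r f)" .
  qed
qed

text \<open>A cycle over \<open>J\<close> bounds some \<open>w\<close> over B, and f(w) is a cycle
  over S, hence a boundary. Lifting its primitive to B corrects \<open>w\<close> into I(W). The
  primitive has degree d (e - 1), so surjectivity from n - 1 on matches a truncation at n.\<close>

lemma linear_resolution_if_power_eq:
  assumes JW: "J = ideal_ge r n (IW r f)"
    and pow: "ideal_pow n I (n - 1) = ideal_pow n (max_ideal n) (d * (n - 1))"
  shows "linear_resolution r n J"
proof (rule linear_resolution_if_kvan1[OF J_pideal])
  note R = JW[unfolded IW_ge]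
  show "in_ring r p" if "p \<in> J" for p using that unfolding R by (auto simp: IW_def)
  show "hc e p \<in> J" if "p \<in> J" for p e using that IW_hc unfolding R by (auto simp: keys_part)
  show "p = 0" if "p \<in> J" "homog e p" "e < n" for p e
    using that unfolding R homog_def by (metis (mono_tags, lifting) all_not_in_conv keys_eq_empty leD mem_Collect_eq)
  have IWJ: "p \<in> J" if "p \<in> IW r f" "p \<in> forms r e" "e \<ge> n" for p e
    using that unfolding R by (auto simp: forms_def homog_def)
  fix i e assume e: "e \<ge> n"
  show "kvan1 r J i e"
    unfolding kvan1_def
  proof (intro allI impI)
    fix z assume z: "kchain r i (J \<inter> forms r (Suc e)) z" "\<forall>A. kd r Var z A = 0"
    have "kchain r i (forms r (Suc e)) z" using z(1) by (rule kchain_mono) auto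
    then obtain w where w: "kchain r (Suc i) (forms r e) w" "\<And>A. kd r Var w A = z A"
      by (rule koszul_exact_Var) (use z(2) in auto)
    have "kchain r (Suc i) (forms n (d * e)) (\<lambda>A. subst f (w A))"
      by (rule kchain_map[OF w(1)]) (use subst_f_forms in auto)
    moreover have "kd r f (\<lambda>A. subst f (w A)) A = 0" for A
    proof -
      have "z A \<in> J" using kchain_in[OF z(1)] pideal_0[OF J_pideal] by auto
      then show ?thesis using J_subset_IW by (auto simp: w(2) IW_def simp flip: subst_kd)
    qed
    ultimately obtain u where u: "kchain r (Suc (Suc i)) (forms n (d * (e - 1))) u" "\<And>A. kd r f u A = subst f (w A)"
      using koszul_exact_f[OF e] by blast
    have "forms n (d * (e - 1)) \<subseteq> subst f ` forms r (e - 1)"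
      by (rule forms_surjective[OF pow[unfolded power_eq_iff]]) (use e in simp)
    from kchain_image_lift[OF kchain_mono[OF u(1) this]] obtain u' where
      u': "kchain r (Suc (Suc i)) (forms r (e - 1)) u'" "\<And>A. subst f (u' A) = u A" by auto
    have kdu: "kd r Var u' A \<in> forms r e" for A
    proof (rule kd_closed[OF u'(1)])
      show "Var l * x \<in> forms r e" if "l < r" "x \<in> forms r (e - 1)" for l x
        using forms_mult[OF forms_Var[OF that(1)] that(2)] e n_pos by simp
    qed auto
    have "kchain r (Suc i) (J \<inter> forms r e) (\<lambda>A. w A - kd r Var u' A)"
      unfolding kchain_def
    proof (intro allI)
      fix A
      have f: "w A - kd r Var u' A \<in> forms r e" using kchain_in[OF w(1)] kdu by simp
      have "subst f (w A - kd r Var u' A) = 0" by (simp add: subst_diff subst_kd u'(2) u(2))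
      then have "w A - kd r Var u' A \<in> IW r f" using f by (simp add: IW_def forms_def)
      then have "w A - kd r Var u' A \<in> J \<inter> forms r e" using IWJ[OF _ f e] f by blast
      then show "if A \<subseteq> {..<r} \<and> card A = Suc i then w A - kd r Var u' A \<in> J \<inter> forms r e else w A - kd r Var u' A = 0"
        using kchain_out[OF w(1), of A] kd_out[OF u'(1), of A Var] by auto
    qed
    moreover have "kd r Var (\<lambda>A. w A - kd r Var u' A) A = z A" for A by (simp add: kd_diff w(2) kd_kd)
    ultimately show "\<exists>w. kchain r (Suc i) (J \<inter> forms r e) w \<and> (\<forall>A. kd r Var w A = z A)" by blast
  qed
qed

end

theorem theorem3p8:
  fixes n r d N :: nat
    and f :: "nat \<Rightarrow> 'k::field mpoly"
    and a :: "nat \<Rightarrow> nat \<Rightarrow> 'k mpoly"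
  assumes n_pos: "n \<ge> 1"
    and f_S: "\<forall>i<r. in_ring n (f i)"
    and f_deg: "\<forall>i<r. homog d (f i)"
    and lin_pres: "linearly_presented n r f"
    and m_primary: "primary_for n (max_ideal n) (gen_ideal n (f ` {..<r}))"
    and basis: "lin_syz_basis n r f N a"
  shows "(linear_resolution r n (minors_ideal r N n (jac_dual r a)) \<longrightarrow>
            ideal_pow n (gen_ideal n (f ` {..<r})) (n - 1) = ideal_pow n (max_ideal n) (d * (n - 1)))
       \<and> (minors_ideal r N n (jac_dual r a) = ideal_ge r n (IW r f) \<longrightarrow>
            (linear_resolution r n (minors_ideal r N n (jac_dual r a)) \<longleftrightarrow>
             ideal_pow n (gen_ideal n (f ` {..<r})) (n - 1) = ideal_pow n (max_ideal n) (d * (n - 1))))"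
proof -
  interpret lin_pres_ideal n r d N f a by unfold_locales (fact assms)+
  show ?thesis using power_eq_if_linear_resolution linear_resolution_if_power_eq by blast
qed

end
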